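(* Let $d\ge 1$ and $m$ be integers with $0<m\le d$, let $1\le p<\infty$, and let $D\ge 1$ be given. There exist constants $\delta, C_1, C_2>0$ depending only on $d,p,m,D$ such that the following holds. Let $f\in B^{m/p}_{p,1}(\mathbb{R}^d)$ and $N>0$ satisfy $\|f\|_{\dot{B}^{m/p}_{p,1}}\le N\|f\|_{L^p}$, and let $b>0$ satisfy $b^{m/p}<\delta N^{-1}$. Then for any set $G=\mathbb{R}^{d-m}\times E$, where $E\subset\mathbb{R}^m$ is a discrete set such that $\bigcup_{x\in E}[x-b,x+b]^m=\mathbb{R}^m$ and each point of $\mathbb{R}^m$ belongs to at most $D$ distinct sets of this union, one has \[C_1\|f\|_{L^p(\mathbb{R}^d)}\le b^{m/p}\left(\int_G|f(x)|^p\,d\mathcal{H}^{d-m}(x)\right)^{1/p}\le C_2\|f\|_{L^p(\mathbb{R}^d)}.\]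
   Context: Fix a nonnegative smooth $\rho$ on $\mathbb{R}^d$ supported in $\{1/2<|y|<2\}$ with $\sum_{j\in\mathbb{Z}}\rho(2^{-j}y)=1$ for $y\ne0$; $\mathcal{F}$ denotes the Fourier transform on tempered distributions. The homogeneous Besov (semi)norm is $\|f\|_{\dot{B}^s_{p,q}}=\bigl(\sum_{j\in\mathbb{Z}}2^{jsq}\|\mathcal{F}^{-1}[\rho(2^{-j}\cdot)\mathcal{F}f]\|_{L^p}^q\bigr)^{1/q}$ (equivalently defined through coefficients in a sufficiently regular orthonormal wavelet basis), and $B^s_{p,q}(\mathbb{R}^d)$ is the (inhomogeneous) Besov space, consisting of $f\in L^p$ with $\|f\|_{\dot B^s_{p,q}}<\infty$. Functions in $B^{m/p}_{p,1}(\mathbb{R}^d)$ are identified with their continuous representative, so their restriction to $G$ makes sense. $[x-b,x+b]^m$ denotes the cube in $\mathbb{R}^m$ centered at $x$ with side length $2b$, and $\mathcal{H}^{d-m}$ is the $(d-m)$-dimensional Hausdorff measure (counting measure when $m=d$). *)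

theory Defs
  imports "HOL-Analysis.Analysis"
begin

fun pderivs :: "'n::finite list \<Rightarrow> (real^'n \<Rightarrow> real) \<Rightarrow> real^'n \<Rightarrow> real" where
  "pderivs [] f = f"
| "pderivs (i # is) f = (\<lambda>x. frechet_derivative (pderivs is f) (at x) (axis i 1))"

definition smooth_fun :: "(real^'n::finite \<Rightarrow> real) \<Rightarrow> bool" where
  "smooth_fun f \<longleftrightarrow> (\<forall>is x. pderivs is f differentiable (at x))"

definition dyadic_bump :: "(real^'n::finite \<Rightarrow> real) \<Rightarrow> bool" where
  "dyadic_bump \<rho> \<longleftrightarrow> smooth_fun \<rho> \<and> (\<forall>y. \<rho> y \<ge> 0)
     \<and> (\<forall>y. \<rho> y \<noteq> 0 \<longrightarrow> 1/2 < norm y \<and> norm y < 2)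
     \<and> (\<forall>y. y \<noteq> 0 \<longrightarrow> ((\<lambda>j::int. \<rho> ((2 powr (- real_of_int j)) *\<^sub>R y)) has_sum 1) UNIV)"

text \<open>Kernel of the Littlewood-Paley block: inverse Fourier transform of rho(2^-j .),
  with the convention F^{-1} g (z) = integral of g(xi) exp(2 pi i z.xi) d xi.\<close>
definition lp_kernel :: "(real^'n::finite \<Rightarrow> real) \<Rightarrow> int \<Rightarrow> real^'n \<Rightarrow> complex" where
  "lp_kernel \<rho> j z = (\<integral>\<xi>. complex_of_real (\<rho> ((2 powr (- real_of_int j)) *\<^sub>R \<xi>)) * cis (2 * pi * (z \<bullet> \<xi>)) \<partial>lborel)"

text \<open>Littlewood-Paley block  F^{-1}[rho(2^-j .) F f] = f * F^{-1}[rho(2^-j .)].\<close>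
definition lp_block :: "(real^'n::finite \<Rightarrow> real) \<Rightarrow> int \<Rightarrow> (real^'n \<Rightarrow> complex) \<Rightarrow> real^'n \<Rightarrow> complex" where
  "lp_block \<rho> j f x = (\<integral>y. f y * lp_kernel \<rho> j (x - y) \<partial>lborel)"

definition ennroot :: "real \<Rightarrow> ennreal \<Rightarrow> ennreal" where
  "ennroot p a = (if a = \<infinity> then \<infinity> else ennreal (enn2real a powr (1 / p)))"

definition Lp_enorm :: "real \<Rightarrow> (real^'n::finite \<Rightarrow> complex) \<Rightarrow> ennreal" where
  "Lp_enorm p g = ennroot p (\<integral>\<^sup>+ x. ennreal (norm (g x) powr p) \<partial>lborel)"

definition in_Lp :: "real \<Rightarrow> (real^'n::finite \<Rightarrow> complex) \<Rightarrow> bool" where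
  "in_Lp p f \<longleftrightarrow> f \<in> borel_measurable lborel \<and> (\<integral>\<^sup>+ x. ennreal (norm (f x) powr p) \<partial>lborel) < \<infinity>"

definition Lp_norm :: "real \<Rightarrow> (real^'n::finite \<Rightarrow> complex) \<Rightarrow> real" where
  "Lp_norm p f = enn2real (Lp_enorm p f)"

definition besov_hom_1 :: "(real^'n::finite \<Rightarrow> real) \<Rightarrow> real \<Rightarrow> real \<Rightarrow> (real^'n \<Rightarrow> complex) \<Rightarrow> ennreal" where
  "besov_hom_1 \<rho> s p f =
     (\<integral>\<^sup>+ j. ennreal (2 powr (real_of_int j * s)) * Lp_enorm p (lp_block \<rho> j f) \<partial>count_space UNIV)"

definition in_besov_1 :: "(real^'n::finite \<Rightarrow> real) \<Rightarrow> real \<Rightarrow> real \<Rightarrow> (real^'n \<Rightarrow> complex) \<Rightarrow> bool" where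
  "in_besov_1 \<rho> s p f \<longleftrightarrow> in_Lp p f \<and> besov_hom_1 \<rho> s p f < \<infinity>"

text \<open>Normalized s-dimensional Hausdorff measure (s natural), restricted to Borel sets.
  For s = 0 it is the counting measure.\<close>
definition hausdorff_pre :: "nat \<Rightarrow> real \<Rightarrow> ('a::metric_space) set \<Rightarrow> ennreal" where
  "hausdorff_pre s \<delta> A = (INF C \<in> {C :: nat \<Rightarrow> 'a set. A \<subseteq> (\<Union>i. C i) \<and>
        (\<forall>i. bounded (C i) \<and> diameter (C i) < \<delta>)}.
     (\<Sum>i. (if C i = {} then 0 else ennreal (unit_ball_vol (real s) * (diameter (C i) / 2) ^ s))))"

definition hausdorff_outer :: "nat \<Rightarrow> ('a::metric_space) set \<Rightarrow> ennreal" where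
  "hausdorff_outer s A = (SUP \<delta> \<in> {0<..}. hausdorff_pre s \<delta> A)"

definition hausdorff_measure :: "nat \<Rightarrow> ('a::metric_space) measure" where
  "hausdorff_measure s = measure_of UNIV (sets borel) (hausdorff_outer s)"

definition discrete_set :: "('a::metric_space) set \<Rightarrow> bool" where
  "discrete_set E \<longleftrightarrow> (\<forall>x\<in>E. \<exists>e>0. \<forall>y\<in>E. y \<noteq> x \<longrightarrow> e \<le> dist x y)"

text \<open>R^d is split as R^{d-m} x R^m, the R^m factor consisting of the coordinates in S.
  A point of R^m is represented as a vector of R^d vanishing outside S.\<close>
definition coord_subspace :: "'n::finite set \<Rightarrow> (real^'n) set" where
  "coord_subspace S = {y. \<forall>i. i \<notin> S \<longrightarrow> y $ i = 0}"

definition cube_in :: "'n::finite set \<Rightarrow> real^'n \<Rightarrow> real \<Rightarrow> (real^'n) set" where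
  "cube_in S x b = {y \<in> coord_subspace S. \<forall>i\<in>S. \<bar>y $ i - x $ i\<bar> \<le> b}"

definition sample_set :: "'n::finite set \<Rightarrow> (real^'n) set \<Rightarrow> (real^'n) set" where
  "sample_set S E = {z. \<exists>x\<in>E. \<forall>i\<in>S. z $ i = x $ i}"

end

theory Submission
  imports Defs "HOL-Probability.Characteristic_Functions" "HOL-Probability.Sinc_Integral"
    "HOL-Real_Asymp.Real_Asymp"
begin

text \<open>
  On the cell of a sampling point \<open>e\<close>, compare \<open>f\<close> with its restriction to the slice through \<open>e\<close>.
  By Minkowski's inequality it suffices to bound the \<open>L\<^sup>p\<close> norm of this oscillation, taken over all
  cells, by half the norm of \<open>f\<close>; Hausdorff measure on a slice is comparable to Lebesgue measure,
  which turns integrals over cells into integrals over \<open>G\<close>.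

  Split \<open>f\<close> at the frequency \<open>2\<^sup>J\<close> of order \<open>\<eta> / b\<close>. The low frequencies form a mollification of \<open>f\<close>
  whose kernel varies by a factor \<open>O(2\<^sup>J b)\<close> across a cell, so Schur's test bounds their
  oscillation by \<open>O(\<eta>)\<close> times the norm of \<open>f\<close>. A block \<open>f\<^sub>j\<close> of frequency above \<open>\<eta> / b\<close> is its own
  mollification at scale \<open>2 powr (-j - 1)\<close>, and Schur's test bounds its oscillation by
  \<open>C(\<eta>) (2 powr j * b) powr (m / p)\<close> times its norm. By the Besov hypothesis these bounds add up to
  \<open>C(\<eta>) b powr (m / p) * N\<close> times the norm of \<open>f\<close>. Choose \<open>\<eta>\<close> first and then \<open>\<delta>\<close>.
\<close>

section \<open>Hausdorff measure and its restriction to slices\<close>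

text \<open>The sampling set is Lebesgue null, so an estimate of f up to null sets says nothing
  about its samples. Control at single points has two sources: mollifications and blocks are given
  by convolution integrals, and the mollifications of the continuous f converge to f everywhere. A
  telescoping identity writes the mollification at frequency 2^(J+n) as the low part plus n blocks;
  bounds uniform in n then pass to f by Fatou's lemma over the cells, and the infinite
  Littlewood-Paley series is never summed. The exponent m / p comes from the choice of majorants.
  Kernels are dominated by products of one-dimensional Cauchy weights, and moving such a kernel to a
  sampling point only widens it to scale b in the m sampled coordinates. This costs max 1 (r b) for
  each of them, so the Schur bound grows like (r b)^m and its p-th root like (r b)^(m/p), exactly
  the weight in the Besov norm. An isotropic majorant would give d / p. Cells may overlap. Functions
  are therefore integrated over pairs (e, x) with x in the cell of e, where a point is counted
  between 1 and D times.\<close>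

text \<open>Caratheodory's criterion for metric outer measures. It suffices to split every T along a
  closed F. The points of T - F far from F are separated from F; those close to F lie in shells
  whose total measure is at most 2 \<open>\<phi> T\<close>, so the tail of the shells tends to
  0.\<close>

lemma Caratheodory_metric:
  fixes \<phi> :: "'a::metric_space set \<Rightarrow> ennreal"
  assumes empty: "\<phi> {} = 0"
    and mono: "\<And>A B. A \<subseteq> B \<Longrightarrow> \<phi> A \<le> \<phi> B"
    and subadd: "\<And>A :: nat \<Rightarrow> 'a set. \<phi> (\<Union>i. A i) \<le> (\<Sum>i. \<phi> (A i))"
    and separated: "\<And>A B r. r > 0 \<Longrightarrow> (\<And>x y. x \<in> A \<Longrightarrow> y \<in> B \<Longrightarrow> r \<le> dist x y) \<Longrightarrow> \<phi> A + \<phi> B \<le> \<phi> (A \<union> B)"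
  shows "measure_space UNIV (sets borel) \<phi>"
proof -
  have un2: "\<phi> (A \<union> B) \<le> \<phi> A + \<phi> B" for A B
  proof -
    have "\<phi> (A \<union> B) \<le> \<phi> (\<Union>i. (\<lambda>i::nat. if i = 0 then A else if i = 1 then B else {}) i)"
      by (rule mono) (auto split: if_splits)
    also have "\<dots> \<le> (\<Sum>i. \<phi> ((\<lambda>i::nat. if i = 0 then A else if i = 1 then B else {}) i))"
      by (rule subadd)
    also have "\<dots> = (\<Sum>i\<in>{0,1::nat}. \<phi> ((\<lambda>i::nat. if i = 0 then A else if i = 1 then B else {}) i))"
      by (rule suminf_finite) (auto simp: empty)
    finally show ?thesis by simp
  qed
  have closed_split: "\<phi> (F \<inter> T) + \<phi> (T - F) \<le> \<phi> T" if "closed F" for F T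
  proof (cases "F = {} \<or> \<phi> T = \<infinity>")
    case True
    then show ?thesis by (auto simp: empty)
  next
    case False
    then have ne: "F \<noteq> {}" and fin: "\<phi> T \<noteq> \<infinity>" by auto
    \<comment> \<open>\<open>Tn n\<close> keeps distance 1 / (n + 1) from F, and \<open>R n\<close>
      is the shell between the distances 1 / (n + 2) and 1 / (n + 1). Closedness of F puts every
      point of T - F into some \<open>Tn n\<close> or shell.\<close>
    define Tn where "Tn n = {x \<in> T. 1 / real (Suc n) \<le> infdist x F}" for n
    define R where "R n = {x \<in> T. 1 / real (Suc (Suc n)) \<le> infdist x F \<and> infdist x F < 1 / real (Suc n)}" for n
    have fin_sub: "\<phi> A \<noteq> \<infinity>" if "A \<subseteq> T" for A
      using mono[OF that] fin by (auto simp: top_unique)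
    have main: "\<phi> (F \<inter> T) + \<phi> (Tn n) \<le> \<phi> T" for n
    proof -
      have "\<phi> (F \<inter> T) + \<phi> (Tn n) \<le> \<phi> ((F \<inter> T) \<union> Tn n)"
      proof (rule separated[of "1 / real (Suc n)"])
        fix x y assume "x \<in> F \<inter> T" "y \<in> Tn n"
        then show "1 / real (Suc n) \<le> dist x y"
          using infdist_le[of x F y] by (auto simp: Tn_def dist_commute)
      qed simp
      also have "\<dots> \<le> \<phi> T" by (rule mono) (auto simp: Tn_def)
      finally show ?thesis .
    qed
    have sepR: "1 / real (Suc (Suc i)) - 1 / real (Suc j) \<le> dist x y" if "x \<in> R i" "y \<in> R j" for x y i j
      using that infdist_triangle[of x F y] by (auto simp: R_def)
    \<comment> \<open>Adjacent shells touch, but shells with indices of equal parity are a positive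
      distance apart, so \<open>separated\<close> makes \<open>\<phi>\<close> superadditive on the
      even shells (e = 0) and on the odd ones (e = 1).\<close>
    have sums_step: "(\<Sum>i<n. \<phi> (R (2 * i + e))) \<le> \<phi> (\<Union>i<n. R (2 * i + e))" for n e
    proof (induction n)
      case (Suc n)
      have "(\<Sum>i<Suc n. \<phi> (R (2 * i + e))) \<le> \<phi> (\<Union>i<n. R (2 * i + e)) + \<phi> (R (2 * n + e))"
        using Suc by (simp add: add_mono)
      also have "\<dots> \<le> \<phi> ((\<Union>i<n. R (2 * i + e)) \<union> R (2 * n + e))"
      \<comment> \<open>For n = 0 and e = 0 the gap below would contain 1 / 0 = 0 and be negative;
        the union is then empty, so this case is treated apart.\<close>
      proof (cases n)
        case 0
        then show ?thesis by (simp add: empty)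
      next
        case (Suc k)
        show ?thesis
        proof (rule separated[of "1 / real (2 * n + e) - 1 / real (Suc (2 * n + e))"])
          show "0 < 1 / real (2 * n + e) - 1 / real (Suc (2 * n + e))"
            using Suc divide_strict_left_mono[of "real (2 * n + e)" "real (Suc (2 * n + e))" 1] by simp
          fix x y assume "x \<in> (\<Union>i<n. R (2 * i + e))" and y: "y \<in> R (2 * n + e)"
          then obtain i where i: "i < n" "x \<in> R (2 * i + e)" by auto
          have "1 / real (2 * n + e) \<le> 1 / real (Suc (Suc (2 * i + e)))"
            using i by (intro divide_left_mono) auto
          with sepR[OF i(2) y] show "1 / real (2 * n + e) - 1 / real (Suc (2 * n + e)) \<le> dist x y"
            by linarith
        qed
      qed
      also have "(\<Union>i<n. R (2 * i + e)) \<union> R (2 * n + e) = (\<Union>i<Suc n. R (2 * i + e))"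
        by (auto simp: lessThan_Suc)
      finally show ?case .
    qed (simp add: empty)
    have sums_le: "(\<Sum>i<n. \<phi> (R (2 * i + e))) \<le> \<phi> T" for n e
      by (rule order_trans[OF sums_step mono]) (auto simp: R_def)
    have split2: "(\<Sum>i<2*n. \<phi> (R i)) = (\<Sum>i<n. \<phi> (R (2 * i + 0))) + (\<Sum>i<n. \<phi> (R (2 * i + 1)))" for n
      by (induction n) (simp_all add: ac_simps)
    have dbl: "(\<Sum>i<2*n. \<phi> (R i)) \<le> \<phi> T + \<phi> T" for n
      unfolding split2 by (intro add_mono sums_le)
    have tot: "(\<Sum>i. \<phi> (R i)) \<le> \<phi> T + \<phi> T"
    proof (subst suminf_eq_SUP, rule SUP_least)
      fix n
      have "(\<Sum>i<n. \<phi> (R i)) \<le> (\<Sum>i<2*n. \<phi> (R i))"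
        by (rule sum_mono2) auto
      also note dbl
      finally show "(\<Sum>i<n. \<phi> (R i)) \<le> \<phi> T + \<phi> T" .
    qed
    have tot_fin: "(\<Sum>i. \<phi> (R i)) \<noteq> \<infinity>"
      using tot fin by (auto simp: top_unique ennreal_add_eq_top)
    have "summable (\<lambda>i. enn2real (\<phi> (R i)))"
    proof (rule summable_suminf_not_top)
      have "ennreal (enn2real (\<phi> (R i))) = \<phi> (R i)" for i
        using fin_sub[of "R i"] by (auto simp: R_def ennreal_enn2real_if)
      then show "(\<Sum>i. ennreal (enn2real (\<phi> (R i)))) \<noteq> top"
        using tot_fin by simp
    qed simp
    then have tail: "(\<lambda>n. ennreal (\<Sum>i. enn2real (\<phi> (R (i + n))))) \<longlonglongrightarrow> ennreal 0"
      by (intro tendsto_ennrealI suminf_exist_split2)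
    have tail_eq: "ennreal (\<Sum>i. enn2real (\<phi> (R (i + n)))) = (\<Sum>i. \<phi> (R (i + n)))" for n
    proof -
      have "ennreal (enn2real (\<phi> (R i))) = \<phi> (R i)" for i
        using fin_sub[of "R i"] by (auto simp: R_def ennreal_enn2real_if)
      moreover have "summable (\<lambda>i. enn2real (\<phi> (R (i + n))))"
        using \<open>summable (\<lambda>i. enn2real (\<phi> (R i)))\<close> by (rule summable_ignore_initial_segment)
      ultimately show ?thesis
        by (subst suminf_ennreal2[symmetric]) auto
    qed
    have cover: "T - F \<subseteq> Tn n \<union> (\<Union>i. R (i + n))" for n
    proof
      fix x assume x: "x \<in> T - F"
      then have pos: "infdist x F > 0"
        using in_closed_iff_infdist_zero[OF \<open>closed F\<close> ne, of x] infdist_nonneg[of x F] by auto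
      show "x \<in> Tn n \<union> (\<Union>i. R (i + n))"
      proof (cases "1 / real (Suc n) \<le> infdist x F")
        case True with x show ?thesis by (auto simp: Tn_def)
      next
        case False
        define k where "k = (LEAST k. 1 / real (Suc k) \<le> infdist x F)"
        obtain k0 where "1 / real (Suc k0) < infdist x F" using nat_approx_posE[OF pos] by blast
        then have k: "1 / real (Suc k) \<le> infdist x F"
          unfolding k_def by (intro LeastI[of "\<lambda>k. 1 / real (Suc k) \<le> infdist x F" k0]) simp
        have lt: "\<And>j. j < k \<Longrightarrow> infdist x F < 1 / real (Suc j)"
          unfolding k_def using not_less_Least by force
        have "n < k"
        proof (rule ccontr)
          assume "\<not> n < k"
          then have "1 / real (Suc n) \<le> 1 / real (Suc k)" by (intro divide_left_mono) auto
          with k False show False by linarith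
        qed
        then obtain i where i: "k = Suc (i + n)" by (metis add.commute less_imp_Suc_add add_Suc_right)
        have "x \<in> R (i + n)" using x k lt[of "i + n"] i by (auto simp: R_def)
        then show ?thesis by auto
      qed
    qed
    have "\<phi> (F \<inter> T) + \<phi> (T - F) \<le> \<phi> T + (\<Sum>i. \<phi> (R (i + n)))" for n
    proof -
      have "\<phi> (T - F) \<le> \<phi> (Tn n \<union> (\<Union>i. R (i + n)))" by (rule mono[OF cover])
      also have "\<dots> \<le> \<phi> (Tn n) + (\<Sum>i. \<phi> (R (i + n)))"
        by (rule order_trans[OF un2]) (intro add_left_mono subadd)
      finally have "\<phi> (F \<inter> T) + \<phi> (T - F) \<le> (\<phi> (F \<inter> T) + \<phi> (Tn n)) + (\<Sum>i. \<phi> (R (i + n)))"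
        by (simp add: add.assoc add_left_mono)
      also have "\<dots> \<le> \<phi> T + (\<Sum>i. \<phi> (R (i + n)))" by (intro add_right_mono main)
      finally show ?thesis .
    qed
    moreover have "(\<lambda>n. \<phi> T + (\<Sum>i. \<phi> (R (i + n)))) \<longlonglongrightarrow> \<phi> T + ennreal 0"
      using tail unfolding tail_eq by (intro tendsto_add tendsto_const)
    ultimately show ?thesis
      by (intro tendsto_lowerbound[where F=sequentially and f="\<lambda>n. \<phi> T + (\<Sum>i. \<phi> (R (i + n)))"]) auto
  qed
  interpret sigma_algebra UNIV "Pow UNIV :: 'a set set" by (rule sigma_algebra_Pow)
  have out: "outer_measure_space (Pow UNIV) \<phi>"
    unfolding outer_measure_space_def positive_def increasing_def countably_subadditive_def
    using empty mono subadd by auto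
  have ms: "measure_space UNIV (lambda_system UNIV (Pow UNIV) \<phi>) \<phi>"
    by (rule caratheodory_lemma[OF out])
  have "Collect closed \<subseteq> lambda_system UNIV (Pow UNIV) \<phi>"
  proof
    fix F :: "'a set" assume "F \<in> Collect closed"
    then have "closed F" by simp
    have "\<phi> (F \<inter> T) + \<phi> ((UNIV - F) \<inter> T) = \<phi> T" for T
    proof (rule antisym)
      have "(UNIV - F) \<inter> T = T - F" by auto
      then show "\<phi> (F \<inter> T) + \<phi> ((UNIV - F) \<inter> T) \<le> \<phi> T"
        using closed_split[OF \<open>closed F\<close>] by simp
      have "T = (F \<inter> T) \<union> ((UNIV - F) \<inter> T)" by auto
      then show "\<phi> T \<le> \<phi> (F \<inter> T) + \<phi> ((UNIV - F) \<inter> T)" using un2 by metis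
    qed
    then show "F \<in> lambda_system UNIV (Pow UNIV) \<phi>"
      by (simp add: lambda_system_def)
  qed
  moreover have "sigma_algebra UNIV (lambda_system UNIV (Pow UNIV) \<phi>)"
    using ms by (simp add: measure_space_def)
  ultimately have "sigma_sets UNIV (Collect closed) \<subseteq> lambda_system UNIV (Pow UNIV) \<phi>"
    by (metis sigma_algebra.sigma_sets_subset)
  then have "sets borel \<subseteq> lambda_system UNIV (Pow UNIV) \<phi>"
    by (simp add: borel_eq_closed)
  moreover have "sigma_algebra UNIV (sets borel :: 'a set set)"
    using sets.sigma_algebra_axioms[of "borel :: 'a measure"] by simp
  ultimately show ?thesis
    using measure_down[OF ms] by blast
qed

section \<open>Hausdorff premeasures and countable additivity\<close>

text \<open>The summand of \<open>hausdorff_pre\<close>. The exceptional value at the empty set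
  matters for s = 0: there every nonempty set weighs 1, and 0 ^ 0 = 1 would charge the empty sets
  that pad a finite cover.\<close>

definition hausdorff_weight :: "nat \<Rightarrow> 'a::metric_space set \<Rightarrow> ennreal" where
  "hausdorff_weight s C = (if C = {} then 0 else ennreal (unit_ball_vol (real s) * (diameter C / 2) ^ s))"

lemma hausdorff_weight_empty [simp]: "hausdorff_weight s {} = 0"
  by (simp add: hausdorff_weight_def)

lemma hausdorff_pre_le:
  assumes "A \<subseteq> (\<Union>i. C i)" "\<And>i. bounded (C i)" "\<And>i. diameter (C i) < \<delta>"
  shows "hausdorff_pre s \<delta> A \<le> (\<Sum>i. hausdorff_weight s (C i))"
  unfolding hausdorff_pre_def hausdorff_weight_def using assms by (intro INF_lower) auto

lemma hausdorff_pre_greatest: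
  assumes "\<And>C. A \<subseteq> (\<Union>i. C i) \<Longrightarrow> (\<And>i. bounded (C i)) \<Longrightarrow> (\<And>i. diameter (C i) < \<delta>) \<Longrightarrow>
     a \<le> (\<Sum>i. hausdorff_weight s (C i))"
  shows "a \<le> hausdorff_pre s \<delta> A"
  unfolding hausdorff_pre_def using assms unfolding hausdorff_weight_def by (intro INF_greatest) auto

lemma hausdorff_pre_close:
  assumes "hausdorff_pre s \<delta> A < e"
  obtains C where "A \<subseteq> (\<Union>i. C i)" "\<And>i. bounded (C i)" "\<And>i. diameter (C i) < \<delta>"
     "(\<Sum>i. hausdorff_weight s (C i)) < e"
  using assms unfolding hausdorff_pre_def INF_less_iff hausdorff_weight_def by auto

lemma hausdorff_pre_empty: "\<delta> > 0 \<Longrightarrow> hausdorff_pre s \<delta> {} = 0"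
  using hausdorff_pre_le[of "{}" "\<lambda>_. {}" \<delta> s] by (simp add: diameter_empty)

lemma hausdorff_pre_mono: "A \<subseteq> B \<Longrightarrow> hausdorff_pre s \<delta> A \<le> hausdorff_pre s \<delta> B"
  by (rule hausdorff_pre_greatest) (rule hausdorff_pre_le, auto)

lemma hausdorff_pre_antimono: "\<delta> \<le> \<delta>' \<Longrightarrow> hausdorff_pre s \<delta>' A \<le> hausdorff_pre s \<delta> A"
  by (rule hausdorff_pre_greatest) (rule hausdorff_pre_le, auto intro: less_le_trans)

text \<open>Nearly optimal covers of the sets \<open>A n\<close>, with errors e / 2 ^ (n + 1), are
  merged into one sequence by \<open>prod_decode\<close>.\<close>

lemma hausdorff_pre_subadd:
  fixes A :: "nat \<Rightarrow> 'a::metric_space set"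
  shows "hausdorff_pre s \<delta> (\<Union>i. A i) \<le> (\<Sum>i. hausdorff_pre s \<delta> (A i))"
proof (rule ennreal_le_epsilon)
  fix e :: real assume "0 < e" and fin: "(\<Sum>n. hausdorff_pre s \<delta> (A n)) < top"
  let ?O = "hausdorff_pre s \<delta>"
  have *: "?O (A n) < ?O (A n) + ennreal (e * (1/2)^Suc n)" for n
  proof -
    have "?O (A n) < top" using fin by (rule ennreal_suminf_lessD)
    then obtain r where "?O (A n) = ennreal r" "r \<ge> 0"
      by (cases "?O (A n)") auto
    then show ?thesis
      using \<open>0 < e\<close> by (simp add: ennreal_plus[symmetric] ennreal_less_iff del: ennreal_plus)
  qed
  have "\<exists>C. A n \<subseteq> (\<Union>i. C i) \<and> (\<forall>i. bounded (C i)) \<and> (\<forall>i. diameter (C i) < \<delta>) \<and>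
     (\<Sum>i. hausdorff_weight s (C i)) \<le> ?O (A n) + ennreal (e * (1/2)^Suc n)" for n
    by (rule hausdorff_pre_close[OF *[of n]]) (meson less_imp_le)
  then obtain B where B: "\<And>n. A n \<subseteq> (\<Union>i. B n i)" "\<And>n i. bounded (B n i)" "\<And>n i. diameter (B n i) < \<delta>"
     and Ble: "\<And>n. (\<Sum>i. hausdorff_weight s (B n i)) \<le> ?O (A n) + ennreal (e * (1/2)^Suc n)"
    by metis
  define C where "C = case_prod B o prod_decode"
  have A_C: "(\<Union>i. A i) \<subseteq> (\<Union>i. C i)"
    using B(1) by (auto simp add: C_def subset_eq) (metis prod.case prod_encode_inverse)
  have "?O (\<Union>i. A i) \<le> (\<Sum>i. hausdorff_weight s (C i))"
    using A_C B by (intro hausdorff_pre_le) (auto simp: C_def split_def)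
  also have "\<dots> = (\<Sum>i. (hausdorff_weight s \<circ> case_prod B) (prod_decode i))"
    by (simp add: C_def)
  also have "\<dots> = (\<Sum>n. \<Sum>i. hausdorff_weight s (B n i))"
    by (intro suminf_ennreal_2dimen) auto
  also have "\<dots> \<le> (\<Sum>n. ?O (A n) + ennreal (e * (1/2) ^ Suc n))"
    by (intro suminf_le allI Ble) auto
  also have "... = (\<Sum>n. ?O (A n)) + (\<Sum>n. ennreal e * ennreal ((1/2) ^ Suc n))"
    using \<open>0 < e\<close> by (subst suminf_add[symmetric])
                     (auto simp del: ennreal_suminf_cmult simp add: ennreal_mult[symmetric])
  also have "\<dots> = (\<Sum>n. ?O (A n)) + e"
    unfolding ennreal_suminf_cmult
    by (subst suminf_ennreal_eq[OF zero_le_power power_half_series]) auto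
  finally show "?O (\<Union>i. A i) \<le> (\<Sum>n. ?O (A n)) + e" .
qed

text \<open>A covering set of diameter below \<open>\<delta>\<close> cannot meet both A and B, so
  every cover of the union splits into a cover of A and one of B without using a set twice.\<close>

lemma hausdorff_pre_separated:
  fixes A B :: "'a::metric_space set"
  assumes sep: "\<And>x y. x \<in> A \<Longrightarrow> y \<in> B \<Longrightarrow> \<delta> \<le> dist x y" and "\<delta> > 0"
  shows "hausdorff_pre s \<delta> A + hausdorff_pre s \<delta> B \<le> hausdorff_pre s \<delta> (A \<union> B)"
proof (rule hausdorff_pre_greatest)
  fix C :: "nat \<Rightarrow> 'a set"
  assume C: "A \<union> B \<subseteq> (\<Union>i. C i)" "\<And>i. bounded (C i)" "\<And>i. diameter (C i) < \<delta>"
  define CA where "CA i = (if C i \<inter> A = {} then {} else C i)" for i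
  define CB where "CB i = (if C i \<inter> B = {} then {} else C i)" for i
  have "hausdorff_pre s \<delta> A + hausdorff_pre s \<delta> B \<le> (\<Sum>i. hausdorff_weight s (CA i)) + (\<Sum>i. hausdorff_weight s (CB i))"
  proof (intro add_mono hausdorff_pre_le)
    show "A \<subseteq> (\<Union>i. CA i)" "B \<subseteq> (\<Union>i. CB i)"
      using C(1) by (fastforce simp: CA_def CB_def)+
  qed (use C \<open>\<delta> > 0\<close> in \<open>auto simp: CA_def CB_def\<close>)
  also have "\<dots> = (\<Sum>i. hausdorff_weight s (CA i) + hausdorff_weight s (CB i))"
    by (rule suminf_add) auto
  also have "\<dots> \<le> (\<Sum>i. hausdorff_weight s (C i))"
  proof (intro suminf_le summableI allI)
    fix i
    have "C i \<inter> A = {} \<or> C i \<inter> B = {}"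
    proof (rule ccontr)
      assume "\<not> ?thesis"
      then obtain x y where "x \<in> C i" "x \<in> A" "y \<in> C i" "y \<in> B" by auto
      with sep diameter_bounded_bound[OF C(2)[of i], of x y] C(3)[of i] show False
        by (meson leD le_less_trans order_trans)
    qed
    then show "hausdorff_weight s (CA i) + hausdorff_weight s (CB i) \<le> hausdorff_weight s (C i)"
      by (auto simp: CA_def CB_def)
  qed
  finally show "hausdorff_pre s \<delta> A + hausdorff_pre s \<delta> B \<le> (\<Sum>i. hausdorff_weight s (C i))" .
qed

lemma hausdorff_pre_le_outer: "\<delta> > 0 \<Longrightarrow> hausdorff_pre s \<delta> A \<le> hausdorff_outer s A"
  unfolding hausdorff_outer_def by (intro SUP_upper) auto

lemma hausdorff_outer_least: "(\<And>\<delta>. \<delta> > 0 \<Longrightarrow> hausdorff_pre s \<delta> A \<le> a) \<Longrightarrow> hausdorff_outer s A \<le> a"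
  unfolding hausdorff_outer_def by (intro SUP_least) auto

text \<open>Without countable additivity on the Borel sets, \<open>measure_of\<close> would turn
  \<open>hausdorff_measure\<close> into the zero measure.\<close>

lemma measure_space_hausdorff_outer: "measure_space UNIV (sets borel) (hausdorff_outer s :: 'a::metric_space set \<Rightarrow> ennreal)"
proof (rule Caratheodory_metric)
  show "hausdorff_outer s {} = (0 :: ennreal)"
    using hausdorff_outer_least[of s "{}" 0] by (simp add: hausdorff_pre_empty)
  show "hausdorff_outer s A \<le> hausdorff_outer s B" if "A \<subseteq> B" for A B :: "'a set"
    by (rule hausdorff_outer_least) (rule order_trans[OF hausdorff_pre_mono[OF that] hausdorff_pre_le_outer])
  show "hausdorff_outer s (\<Union>i. A i) \<le> (\<Sum>i. hausdorff_outer s (A i))" for A :: "nat \<Rightarrow> 'a set"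
    by (rule hausdorff_outer_least, rule order_trans[OF hausdorff_pre_subadd])
      (auto intro!: suminf_le hausdorff_pre_le_outer)
  fix A B :: "'a set" and r :: real
  assume r: "r > 0" and sep: "\<And>x y. x \<in> A \<Longrightarrow> y \<in> B \<Longrightarrow> r \<le> dist x y"
  \<comment> \<open>The resolutions for A and B are kept independent so that the two suprema can be
    taken one after the other. Both are lowered to a common one that does not exceed the gap
    r.\<close>
  have pre: "hausdorff_pre s \<delta> A + hausdorff_pre s \<delta>' B \<le> hausdorff_outer s (A \<union> B)"
    if "\<delta> > 0" "\<delta>' > 0" for \<delta> \<delta>'
  proof -
    define \<epsilon> where "\<epsilon> = min r (min \<delta> \<delta>')"
    have "\<epsilon> > 0" using that r by (simp add: \<epsilon>_def)
    have "hausdorff_pre s \<delta> A + hausdorff_pre s \<delta>' B \<le> hausdorff_pre s \<epsilon> A + hausdorff_pre s \<epsilon> B"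
      by (intro add_mono hausdorff_pre_antimono) (auto simp: \<epsilon>_def)
    also have "\<dots> \<le> hausdorff_pre s \<epsilon> (A \<union> B)"
      using sep \<open>\<epsilon> > 0\<close> by (intro hausdorff_pre_separated) (auto simp: \<epsilon>_def min.coboundedI1)
    also have "\<dots> \<le> hausdorff_outer s (A \<union> B)"
      by (rule hausdorff_pre_le_outer[OF \<open>\<epsilon> > 0\<close>])
    finally show ?thesis .
  qed
  have *: "hausdorff_pre s \<delta> A + hausdorff_outer s B \<le> hausdorff_outer s (A \<union> B)" if "\<delta> > 0" for \<delta>
  proof -
    have "hausdorff_pre s \<delta> A + hausdorff_outer s B = (SUP \<delta>'\<in>{0<..}. hausdorff_pre s \<delta> A + hausdorff_pre s \<delta>' B)"
      unfolding hausdorff_outer_def[of s B] by (rule ennreal_SUP_add_right) auto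
    also have "\<dots> \<le> hausdorff_outer s (A \<union> B)"
      using that by (intro SUP_least pre) auto
    finally show ?thesis .
  qed
  have "hausdorff_outer s A + hausdorff_outer s B = (SUP \<delta>\<in>{0<..}. hausdorff_pre s \<delta> A + hausdorff_outer s B)"
    unfolding hausdorff_outer_def[of s A] by (rule ennreal_SUP_add_left[symmetric]) auto
  also have "\<dots> \<le> hausdorff_outer s (A \<union> B)"
    by (intro SUP_least *) auto
  finally show "hausdorff_outer s A + hausdorff_outer s B \<le> hausdorff_outer s (A \<union> B)" .
qed

lemma sets_hausdorff_measure [measurable_cong, simp]:
  "sets (hausdorff_measure s :: 'a::metric_space measure) = sets borel"
  unfolding hausdorff_measure_def using sets.sigma_sets_eq[of "borel :: 'a measure"] by simp

lemma space_hausdorff_measure [simp]: "space (hausdorff_measure s) = UNIV"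
  unfolding hausdorff_measure_def by (rule space_measure_of) simp

lemma emeasure_hausdorff_measure:
  "A \<in> sets borel \<Longrightarrow> emeasure (hausdorff_measure s) A = hausdorff_outer s A"
  using measure_space_hausdorff_outer[of s]
  by (intro emeasure_measure_of[OF hausdorff_measure_def]) (auto simp: measure_space_def)

text \<open>Induction over measurable functions instead of a density, because nothing is known here
  about sigma-finiteness of Hausdorff measure.\<close>

lemma nn_integral_mono_emeasure:
  assumes sets: "sets M = sets N" and le: "\<And>A. A \<in> sets M \<Longrightarrow> c * emeasure M A \<le> emeasure N A"
    and f: "f \<in> borel_measurable M"
  shows "c * (\<integral>\<^sup>+x. f x \<partial>M) \<le> (\<integral>\<^sup>+x. f x \<partial>N)"
  using f
proof (induction rule: borel_measurable_induct)
  case (cong f g)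
  have "(\<integral>\<^sup>+x. f x \<partial>M) = (\<integral>\<^sup>+x. g x \<partial>M)" "(\<integral>\<^sup>+x. f x \<partial>N) = (\<integral>\<^sup>+x. g x \<partial>N)"
    using cong(3) sets_eq_imp_space_eq[OF sets] by (auto intro!: nn_integral_cong)
  with cong show ?case by simp
next
  case (set A)
  then show ?case using le sets by simp
next
  case (mult u a)
  have "u \<in> borel_measurable N" using mult(2) measurable_cong_sets[OF sets refl] by blast
  with mult show ?case
    by (simp add: nn_integral_cmult mult.left_commute mult_left_mono)
next
  case (add u v)
  have "u \<in> borel_measurable N" "v \<in> borel_measurable N"
    using add measurable_cong_sets[OF sets refl] by blast+
  with add show ?case
    by (simp add: nn_integral_add distrib_left add_mono)
next
  case (seq U)
  have "U i \<in> borel_measurable N" for i using seq(1) measurable_cong_sets[OF sets refl] by blast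
  then have "(\<integral>\<^sup>+x. (SUP i. U i x) \<partial>N) = (SUP i. \<integral>\<^sup>+x. U i x \<partial>N)"
    using seq by (intro nn_integral_monotone_convergence_SUP) auto
  moreover have "(\<integral>\<^sup>+x. (SUP i. U i x) \<partial>M) = (SUP i. \<integral>\<^sup>+x. U i x \<partial>M)"
    using seq by (intro nn_integral_monotone_convergence_SUP) auto
  ultimately show ?case
    using seq by (simp add: image_comp SUP_mult_left_ennreal SUP_mono')
qed

section \<open>Slices, the cylinders around them, and the two measure comparisons\<close>

lemma emeasure_cbox_cart:
  fixes l u :: "real^'n::finite"
  assumes "\<And>i. l $ i \<le> u $ i"
  shows "emeasure lborel (cbox l u) = ennreal (\<Prod>i\<in>UNIV. u $ i - l $ i)"
    and "emeasure lborel (box l u) = ennreal (\<Prod>i\<in>UNIV. u $ i - l $ i)"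
proof -
  have le: "\<And>b. b \<in> Basis \<Longrightarrow> l \<bullet> b \<le> u \<bullet> b"
    using assms by (auto simp: Basis_vec_def inner_axis)
  have "(\<Prod>b\<in>Basis. (u - l) \<bullet> b) = (\<Prod>i\<in>UNIV. u $ i - l $ i)"
    by (simp add: Basis_vec_def cart_eq_inner_axis axis_eq_axis prod.UNION_disjoint inner_diff_left)
  then show "emeasure lborel (cbox l u) = ennreal (\<Prod>i\<in>UNIV. u $ i - l $ i)"
    and "emeasure lborel (box l u) = ennreal (\<Prod>i\<in>UNIV. u $ i - l $ i)"
    using le by (simp_all add: emeasure_lborel_cbox emeasure_lborel_box)
qed

text \<open>\<open>graft S a\<close> is the orthogonal projection onto the affine subspace
  \<open>slice S a\<close>. The cell of a sampling point a is \<open>cylinder S a b\<close>, a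
  neighbourhood of this subspace that is bounded in the sampled directions only;
  \<open>graft S a\<close> carries each point of the cell to the point where f is sampled.\<close>

definition graft :: "'n::finite set \<Rightarrow> real^'n \<Rightarrow> real^'n \<Rightarrow> real^'n" where
  "graft S a x = (\<chi> i. if i \<in> S then a $ i else x $ i)"

definition cylinder :: "'n::finite set \<Rightarrow> real^'n \<Rightarrow> real \<Rightarrow> (real^'n) set" where
  "cylinder S a b = {x. \<forall>i\<in>S. \<bar>x $ i - a $ i\<bar> \<le> b}"

definition slice :: "'n::finite set \<Rightarrow> real^'n \<Rightarrow> (real^'n) set" where
  "slice S a = {z. \<forall>i\<in>S. z $ i = a $ i}"

lemma graft_nth [simp]: "graft S a x $ i = (if i \<in> S then a $ i else x $ i)"
  by (simp add: graft_def)

lemma graft_in_slice: "graft S a x \<in> slice S a"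
  by (simp add: slice_def)

lemma continuous_on_graft [continuous_intros]:
  fixes f g :: "'a::topological_space \<Rightarrow> real^'n::finite"
  assumes "continuous_on A f" "continuous_on A g"
  shows "continuous_on A (\<lambda>x. graft S (f x) (g x))"
  unfolding graft_def
proof (rule continuous_on_vec_lambda)
  fix i show "continuous_on A (\<lambda>x. if i \<in> S then f x $ i else g x $ i)"
    using assms by (cases "i \<in> S") (auto intro!: continuous_intros)
qed

lemma measurable_graft [measurable]: "graft S a \<in> borel_measurable borel"
  by (intro borel_measurable_continuous_onI continuous_intros)

lemma closed_slice: "closed (slice S a)"
proof -
  have "slice S a = (\<Inter>i\<in>S. {z. z $ i = a $ i})" by (auto simp: slice_def)
  moreover have "closed {z. z $ i = a $ i}" for i by (intro closed_Collect_eq continuous_intros)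
  ultimately show ?thesis by auto
qed

lemma closed_cylinder: "closed (cylinder S a b)"
proof -
  have "cylinder S a b = (\<Inter>i\<in>S. {z. \<bar>z $ i - a $ i\<bar> \<le> b})" by (auto simp: cylinder_def)
  moreover have "closed {z. \<bar>z $ i - a $ i\<bar> \<le> b}" for i by (intro closed_Collect_le continuous_intros)
  ultimately show ?thesis by auto
qed

lemma borel_slice [measurable]: "slice S a \<in> sets borel"
  by (rule borel_closed[OF closed_slice])

lemma borel_cylinder [measurable]: "cylinder S a b \<in> sets borel"
  by (rule borel_closed[OF closed_cylinder])

lemma borel_cylinder_vimage [measurable]:
  "A \<in> sets borel \<Longrightarrow> {x \<in> cylinder S a b. graft S a x \<in> A} \<in> sets borel"
proof -
  assume "A \<in> sets borel"
  then have "cylinder S a b \<inter> (graft S a -` A \<inter> space borel) \<in> sets borel"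
    by (intro sets.Int borel_cylinder measurable_sets[OF measurable_graft])
  also have "cylinder S a b \<inter> (graft S a -` A \<inter> space borel) = {x \<in> cylinder S a b. graft S a x \<in> A}"
    by auto
  finally show ?thesis .
qed

lemma prod_split_card:
  fixes S :: "'n::finite set"
  shows "(\<Prod>i\<in>UNIV. if i \<in> S then (u::real) else v) = u ^ card S * v ^ (CARD('n) - card S)"
proof -
  have "(\<Prod>i\<in>UNIV. if i \<in> S then u else v) = (\<Prod>i\<in>S. u) * (\<Prod>i\<in>-S. v)"
    by (subst prod.If_cases) (auto simp: Compl_eq)
  then show ?thesis by (simp add: Compl_eq_Diff_UNIV card_Diff_subset)
qed

text \<open>A covering set of diameter t is replaced by a box with sides 2 b in the sampled
  directions and 2 t in the k others. The boxes cover the part of the cylinder above A, and the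
  volume (2 b) ^ m (2 t) ^ k, with m the cardinality of S, is the stated constant times the
  Hausdorff weight of a set of diameter t.\<close>

lemma cylinder_le_hausdorff:
  fixes S :: "'n::finite set" and a :: "real^'n"
  defines "k \<equiv> CARD('n) - card S"
  assumes "b > 0" and "A \<in> sets borel"
  shows "emeasure lborel {x \<in> cylinder S a b. graft S a x \<in> A}
    \<le> ennreal ((2 * b) ^ card S * 4 ^ k / unit_ball_vol k) * emeasure (hausdorff_measure k) (A \<inter> slice S a)"
proof -
  define B where "B = {x \<in> cylinder S a b. graft S a x \<in> A}"
  define c where "c = (2 * b) ^ card S * 4 ^ k / unit_ball_vol (real k)"
  have c: "c > 0" using assms unit_ball_vol_pos[of "real k"] by (simp add: c_def)
  \<comment> \<open>Any positive resolution serves here, since every premeasure lies below the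
    Hausdorff measure.\<close>
  have "emeasure lborel B \<le> ennreal c * hausdorff_pre k 1 (A \<inter> slice S a)"
  proof -
    have "inverse (ennreal c) * emeasure lborel B \<le> hausdorff_pre k 1 (A \<inter> slice S a)"
    proof (rule hausdorff_pre_greatest)
      fix C :: "nat \<Rightarrow> (real^'n) set"
      assume C: "A \<inter> slice S a \<subseteq> (\<Union>i. C i)" "\<And>i. bounded (C i)" "\<And>i. diameter (C i) < 1"
      define p where "p i = (SOME p. p \<in> C i)" for i
      define bx where "bx i = (if C i = {} then {} else
         cbox (\<chi> j. if j \<in> S then a $ j - b else p i $ j - diameter (C i))
              (\<chi> j. if j \<in> S then a $ j + b else p i $ j + diameter (C i)))" for i
      have m: "emeasure lborel (bx i) = ennreal c * hausdorff_weight k (C i)" for i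
      proof (cases "C i = {}")
        case False
        have d: "diameter (C i) \<ge> 0" using C(2) by (rule diameter_ge_0)
        have "emeasure lborel (bx i) = ennreal (\<Prod>j\<in>UNIV. if j \<in> S then 2 * b else 2 * diameter (C i))"
          using False d \<open>b > 0\<close> unfolding bx_def
          by (subst if_not_P, simp, subst emeasure_cbox_cart) (auto intro!: arg_cong[where f=ennreal] prod.cong split: if_splits)
        also have "\<dots> = ennreal ((2 * b) ^ card S * (2 * diameter (C i)) ^ k)"
          by (simp add: prod_split_card k_def)
        also have "(2 * b) ^ card S * (2 * diameter (C i)) ^ k = c * (unit_ball_vol (real k) * (diameter (C i) / 2) ^ k)"
        proof -
          have "(2 * diameter (C i)) ^ k = 4 ^ k * (diameter (C i) / 2) ^ k"
            unfolding power_mult_distrib[symmetric] by simp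
          moreover have "unit_ball_vol (real k) \<noteq> 0" by (metis less_irrefl of_nat_0_le_iff unit_ball_vol_pos)
          ultimately show ?thesis by (simp add: c_def)
        qed
        also have "ennreal \<dots> = ennreal c * hausdorff_weight k (C i)"
          using False c d unit_ball_vol_pos[of "real k"]
          by (simp add: hausdorff_weight_def ennreal_mult[symmetric])
        finally show ?thesis .
      qed (simp add: bx_def)
      have "B \<subseteq> (\<Union>i. bx i)"
      proof
        fix x assume x: "x \<in> B"
        then obtain i where i: "graft S a x \<in> C i" using C(1) graft_in_slice by (force simp: B_def)
        then have "p i \<in> C i" unfolding p_def by (rule someI)
        then have "dist (graft S a x) (p i) \<le> diameter (C i)"
          using C(2) i by (intro diameter_bounded_bound)
        then have "\<bar>graft S a x $ j - p i $ j\<bar> \<le> diameter (C i)" for j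
          using component_le_norm_cart[of "graft S a x - p i" j] by (simp add: dist_norm)
        then have "\<bar>x $ j - p i $ j\<bar> \<le> diameter (C i)" if "j \<notin> S" for j
          using that by (metis graft_nth)
        then have "x \<in> bx i"
          using i x by (fastforce simp: bx_def B_def cylinder_def mem_box_cart abs_le_iff)
        then show "x \<in> (\<Union>i. bx i)" by auto
      qed
      then have "emeasure lborel B \<le> emeasure lborel (\<Union>i. bx i)"
        by (intro emeasure_mono) (auto simp: bx_def)
      also have "\<dots> \<le> (\<Sum>i. emeasure lborel (bx i))"
        by (intro emeasure_subadditive_countably) (auto simp: bx_def)
      also have "\<dots> = ennreal c * (\<Sum>i. hausdorff_weight k (C i))"
        by (simp add: m)
      finally have "inverse (ennreal c) * emeasure lborel B \<le> inverse (ennreal c) * (ennreal c * (\<Sum>i. hausdorff_weight k (C i)))"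
        by (rule mult_left_mono) simp
      also have "\<dots> = (\<Sum>i. hausdorff_weight k (C i))"
        using c by (simp add: mult.assoc[symmetric] inverse_ennreal ennreal_mult[symmetric])
      finally show "inverse (ennreal c) * emeasure lborel B \<le> (\<Sum>i. hausdorff_weight k (C i))" .
    qed
    then have "ennreal c * (inverse (ennreal c) * emeasure lborel B) \<le> ennreal c * hausdorff_pre k 1 (A \<inter> slice S a)"
      by (rule mult_left_mono) simp
    moreover have "ennreal c * (inverse (ennreal c) * emeasure lborel B) = emeasure lborel B"
      using c by (simp add: mult.assoc[symmetric] inverse_ennreal ennreal_mult[symmetric])
    ultimately show ?thesis by simp
  qed
  also have "\<dots> \<le> ennreal c * hausdorff_outer k (A \<inter> slice S a)"
    by (intro mult_left_mono hausdorff_pre_le_outer) auto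
  also have "hausdorff_outer k (A \<inter> slice S a) = emeasure (hausdorff_measure k) (A \<inter> slice S a)"
    using assms(3) by (intro emeasure_hausdorff_measure[symmetric]) auto
  finally show ?thesis by (simp add: B_def c_def)
qed

lemma hausdorff_pre_finite_cover:
  assumes "finite I" "A \<subseteq> (\<Union>i\<in>I. C i)" "\<And>i. i \<in> I \<Longrightarrow> bounded (C i)" "\<And>i. i \<in> I \<Longrightarrow> diameter (C i) < \<delta>" "\<delta> > 0"
  shows "hausdorff_pre s \<delta> A \<le> (\<Sum>i\<in>I. hausdorff_weight s (C i))"
proof -
  obtain e where e: "bij_betw e {..<card I} I"
    using ex_bij_betw_nat_finite[OF \<open>finite I\<close>] by (auto simp: atLeast0LessThan)
  define C' where "C' i = (if i < card I then C (e i) else {})" for i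
  have eI: "e i \<in> I" if "i < card I" for i
    using bij_betwE[OF e] that by auto
  have "A \<subseteq> (\<Union>i. C' i)"
  proof
    fix x assume "x \<in> A"
    then obtain i where "i \<in> I" "x \<in> C i" using assms(2) by auto
    then obtain j where "j < card I" "e j = i" using bij_betw_imp_surj_on[OF e] by (metis imageE lessThan_iff)
    then have "x \<in> C' j" using \<open>x \<in> C i\<close> by (auto simp: C'_def)
    then show "x \<in> (\<Union>i. C' i)" by blast
  qed
  then have "hausdorff_pre s \<delta> A \<le> (\<Sum>i. hausdorff_weight s (C' i))"
    using assms eI by (intro hausdorff_pre_le) (auto simp: C'_def diameter_empty)
  also have "\<dots> = (\<Sum>i<card I. hausdorff_weight s (C' i))"
    by (rule suminf_finite) (auto simp: C'_def)
  also have "\<dots> = (\<Sum>i<card I. hausdorff_weight s (C (e i)))"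
    by (simp add: C'_def)
  also have "\<dots> = (\<Sum>i\<in>I. hausdorff_weight s (C i))"
    by (rule sum.reindex_bij_betw[OF e])
  finally show ?thesis .
qed

lemma dist_le_card_mult:
  fixes x y :: "real^'n::finite"
  assumes "\<And>i. \<bar>x $ i - y $ i\<bar> \<le> r"
  shows "dist x y \<le> real CARD('n) * r"
proof -
  have "dist x y \<le> (\<Sum>i\<in>UNIV. \<bar>(x - y) $ i\<bar>)" unfolding dist_norm by (rule norm_le_l1_cart)
  also have "\<dots> \<le> real CARD('n) * r" using assms by (intro sum_bounded_above) auto
  finally show ?thesis .
qed

text \<open>A compact subset of the slice is covered by cells of a grid so fine that the cells
  meeting it stay inside \<open>U\<close>; their cylinders are disjoint.\<close>

lemma hausdorff_compact_le_cylinder: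
  fixes S :: "'n::finite set" and a :: "real^'n"
  defines "k \<equiv> CARD('n) - card S"
  assumes "b > 0" "compact K" "K \<subseteq> slice S a" "open U" "K \<subseteq> U"
  shows "ennreal ((2 * b) ^ card S) * hausdorff_outer k K
    \<le> ennreal (unit_ball_vol k * (CARD('n) / 2) ^ k) * emeasure lborel {x \<in> cylinder S a b. graft S a x \<in> U}"
proof -
  define B where "B = {x \<in> cylinder S a b. graft S a x \<in> U}"
  define d where "d = real CARD('n)"
  have d: "d > 0" by (simp add: d_def)
  obtain \<epsilon> where \<epsilon>: "\<epsilon> > 0" "(\<Union>x\<in>K. ball x \<epsilon>) \<subseteq> U"
    using compact_subset_open_imp_ball_epsilon_subset[OF assms(3,5,6)] .
  have pre: "ennreal ((2 * b) ^ card S) * hausdorff_pre k \<delta> K \<le> ennreal (unit_ball_vol k * (d / 2) ^ k) * emeasure lborel B"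
    if "\<delta> > 0" for \<delta>
  proof -
    \<comment> \<open>A grid cell of side r has diameter at most d r = min \<open>\<epsilon>\<close>
      \<open>\<delta>\<close> / 2. It is thus admissible at resolution \<open>\<delta>\<close>, and
      it stays in U once it meets K.\<close>
    define r where "r = min \<epsilon> \<delta> / (2 * d)"
    have r: "r > 0" "d * r < \<epsilon>" "d * r < \<delta>"
      using \<epsilon> that d by (auto simp: r_def field_simps min_def)
    \<comment> \<open>The label of the grid cell. The sampled coordinates are ignored, so x and
      \<open>graft S a x\<close> carry the same label.\<close>
    define n where "n x = (\<lambda>i. if i \<in> S then 0 else \<lfloor>x $ i / r\<rfloor>)" for x :: "real^'n"
    have near: "\<bar>x $ i - y $ i\<bar> \<le> r" if "n x = n y" "i \<notin> S" for x y i
    proof -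
      have "\<lfloor>x $ i / r\<rfloor> = \<lfloor>y $ i / r\<rfloor>" using that by (auto simp: n_def dest: fun_cong[of _ _ i])
      then have "\<bar>x $ i / r - y $ i / r\<bar> \<le> 1" by linarith
      then show ?thesis using r(1) by (simp add: field_simps abs_le_iff)
    qed
    have near_slice: "dist x y \<le> d * r" if "x \<in> slice S a" "y \<in> slice S a" "n x = n y" for x y
      unfolding d_def
    proof (rule dist_le_card_mult)
      fix i show "\<bar>x $ i - y $ i\<bar> \<le> r"
        using near[OF that(3), of i] that r by (cases "i \<in> S") (auto simp: slice_def)
    qed
    define I where "I = n ` K"
    define C where "C \<nu> = {z \<in> slice S a. n z = \<nu>}" for \<nu>
    have "finite I"
    proof -
      obtain R where R: "\<And>x. x \<in> K \<Longrightarrow> norm x \<le> R"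
        using compact_imp_bounded[OF assms(3)] by (auto simp: bounded_iff)
      have "I \<subseteq> {f. \<forall>i. f i \<in> {- \<lceil>\<bar>R\<bar> / r\<rceil> - 1 .. \<lceil>\<bar>R\<bar> / r\<rceil>}}"
      proof
        fix f assume "f \<in> I"
        then obtain x where x: "x \<in> K" "f = n x" by (auto simp: I_def)
        have "f i \<in> {- \<lceil>\<bar>R\<bar> / r\<rceil> - 1 .. \<lceil>\<bar>R\<bar> / r\<rceil>}" for i
        proof -
          have "\<bar>x $ i\<bar> \<le> \<bar>R\<bar>" using R[OF x(1)] component_le_norm_cart[of x i] by linarith
          then have "\<bar>x $ i / r\<bar> \<le> \<bar>R\<bar> / r" using r by (simp add: divide_right_mono)
          then have "- \<lceil>\<bar>R\<bar> / r\<rceil> - 1 \<le> \<lfloor>x $ i / r\<rfloor>" "\<lfloor>x $ i / r\<rfloor> \<le> \<lceil>\<bar>R\<bar> / r\<rceil>" by linarith+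
          moreover have "\<bar>R\<bar> / r \<ge> 0" using r by simp
          then have "- \<lceil>\<bar>R\<bar> / r\<rceil> - 1 \<le> 0" "0 \<le> \<lceil>\<bar>R\<bar> / r\<rceil>" by linarith+
          ultimately show ?thesis unfolding x(2) n_def by (cases "i \<in> S") auto
        qed
        then show "f \<in> {f. \<forall>i. f i \<in> {- \<lceil>\<bar>R\<bar> / r\<rceil> - 1 .. \<lceil>\<bar>R\<bar> / r\<rceil>}}" by simp
      qed
      moreover have "finite {f :: 'n \<Rightarrow> int. \<forall>i. f i \<in> {- \<lceil>\<bar>R\<bar> / r\<rceil> - 1 .. \<lceil>\<bar>R\<bar> / r\<rceil>}}"
        by (rule finite_set_of_finite_funs[of UNIV, simplified]) auto
      ultimately show ?thesis by (rule finite_subset)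
    qed
    have diamC: "diameter (C \<nu>) \<le> d * r" for \<nu>
      using near_slice r d by (intro diameter_le) (auto simp: C_def dist_norm)
    have bddC: "bounded (C \<nu>)" for \<nu>
      unfolding bounded_two_points using near_slice by (auto simp: C_def intro!: exI[of _ "d * r"])
    define G where "G \<nu> = {x \<in> cylinder S a b. n x = \<nu>}" for \<nu>
    have G_eq: "G \<nu> = cylinder S a b \<inter> (\<Inter>i\<in>-S. {x. \<lfloor>x $ i / r\<rfloor> = \<nu> i})" if "\<nu> \<in> I" for \<nu>
      using that by (auto simp: G_def n_def I_def fun_eq_iff)
    have G_meas: "G \<nu> \<in> sets borel" if "\<nu> \<in> I" for \<nu>
    proof -
      have "{x \<in> space borel. \<forall>i\<in>-S. \<lfloor>x $ i / r\<rfloor> = \<nu> i} \<in> sets (borel :: (real^'n) measure)"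
        by measurable
      moreover have "G \<nu> = cylinder S a b \<inter> {x \<in> space borel. \<forall>i\<in>-S. \<lfloor>x $ i / r\<rfloor> = \<nu> i}"
        unfolding G_eq[OF that] by auto
      ultimately show ?thesis by (simp only: sets.Int borel_cylinder)
    qed
    \<comment> \<open>A lower bound for the volume is enough, so an open box inside the half-open
      cell avoids any discussion of its boundary.\<close>
    have G_vol: "ennreal ((2 * b) ^ card S * r ^ k) \<le> emeasure lborel (G \<nu>)" if "\<nu> \<in> I" for \<nu>
    proof -
      define l where "l = (\<chi> i. if i \<in> S then a $ i - b else of_int (\<nu> i) * r)"
      define u where "u = (\<chi> i. if i \<in> S then a $ i + b else of_int (\<nu> i) * r + r)"
      have "emeasure lborel (box l u) = ennreal (\<Prod>i\<in>UNIV. if i \<in> S then 2 * b else r)"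
        using r \<open>b > 0\<close> unfolding l_def u_def
        by (subst emeasure_cbox_cart) (auto intro!: arg_cong[where f=ennreal] prod.cong split: if_splits)
      then have "ennreal ((2 * b) ^ card S * r ^ k) = emeasure lborel (box l u)"
        by (simp add: prod_split_card k_def)
      also have "\<dots> \<le> emeasure lborel (G \<nu>)"
      proof (rule emeasure_mono)
        show "box l u \<subseteq> G \<nu>"
        proof
          fix x assume x: "x \<in> box l u"
          have "\<lfloor>x $ i / r\<rfloor> = \<nu> i" if "i \<notin> S" for i
          proof -
            have "of_int (\<nu> i) * r < x $ i" "x $ i < of_int (\<nu> i) * r + r"
              using x that by (auto simp: mem_box_cart l_def u_def dest: spec[of _ i])
            then have "of_int (\<nu> i) \<le> x $ i / r" "x $ i / r < of_int (\<nu> i) + 1"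
              using r by (auto simp: field_simps)
            then show ?thesis by (rule floor_unique)
          qed
          moreover have "\<bar>x $ i - a $ i\<bar> \<le> b" if "i \<in> S" for i
            using x that by (auto simp: mem_box_cart l_def u_def dest: spec[of _ i])
          then have "x \<in> cylinder S a b" by (simp add: cylinder_def)
          ultimately show "x \<in> G \<nu>" using G_eq[OF that] by auto
        qed
      qed (use G_meas[OF that] in auto)
      finally show ?thesis .
    qed
    have "ennreal ((2 * b) ^ card S) * hausdorff_pre k \<delta> K
        \<le> ennreal ((2 * b) ^ card S) * (\<Sum>\<nu>\<in>I. hausdorff_weight k (C \<nu>))"
    proof (intro mult_left_mono hausdorff_pre_finite_cover \<open>finite I\<close> bddC \<open>\<delta> > 0\<close>)
      show "K \<subseteq> (\<Union>\<nu>\<in>I. C \<nu>)" using assms(4) by (auto simp: I_def C_def)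
      show "diameter (C \<nu>) < \<delta>" for \<nu> using diamC[of \<nu>] r by linarith
    qed simp
    also have "\<dots> \<le> ennreal ((2 * b) ^ card S) * (\<Sum>\<nu>\<in>I. ennreal (unit_ball_vol k * (d * r / 2) ^ k))"
    proof (intro mult_left_mono sum_mono)
      fix \<nu>
      have "unit_ball_vol k * (diameter (C \<nu>) / 2) ^ k \<le> unit_ball_vol k * (d * r / 2) ^ k"
        using diamC[of \<nu>] diameter_ge_0[OF bddC[of \<nu>]] by (intro mult_left_mono power_mono) auto
      then show "hausdorff_weight k (C \<nu>) \<le> ennreal (unit_ball_vol k * (d * r / 2) ^ k)"
        by (auto simp: hausdorff_weight_def intro: ennreal_leI)
    qed simp
    also have "\<dots> = (\<Sum>\<nu>\<in>I. ennreal (unit_ball_vol k * (d / 2) ^ k) * ennreal ((2 * b) ^ card S * r ^ k))"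
      unfolding sum_distrib_left
    proof (rule sum.cong[OF refl])
      have "(d * r / 2) ^ k = (d / 2) ^ k * r ^ k" unfolding power_mult_distrib[symmetric] by simp
      then show "ennreal ((2 * b) ^ card S) * ennreal (unit_ball_vol k * (d * r / 2) ^ k) =
        ennreal (unit_ball_vol k * (d / 2) ^ k) * ennreal ((2 * b) ^ card S * r ^ k)"
        using \<open>b > 0\<close> d r by (subst (1 2) ennreal_mult[symmetric]) (auto simp: ac_simps)
    qed
    also have "\<dots> \<le> ennreal (unit_ball_vol k * (d / 2) ^ k) * (\<Sum>\<nu>\<in>I. emeasure lborel (G \<nu>))"
      unfolding sum_distrib_left[symmetric] by (intro mult_left_mono sum_mono G_vol) auto
    also have "(\<Sum>\<nu>\<in>I. emeasure lborel (G \<nu>)) = emeasure lborel (\<Union>\<nu>\<in>I. G \<nu>)"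
      using G_meas by (intro sum_emeasure \<open>finite I\<close>) (auto simp: disjoint_family_on_def G_def)
    also have "\<dots> \<le> emeasure lborel B"
    proof (rule emeasure_mono)
      show "(\<Union>\<nu>\<in>I. G \<nu>) \<subseteq> B"
      proof
        fix x assume "x \<in> (\<Union>\<nu>\<in>I. G \<nu>)"
        then obtain z where z: "z \<in> K" "n x = n z" "x \<in> cylinder S a b" by (auto simp: I_def G_def)
        have "n (graft S a x) i = n z i" for i
          using fun_cong[OF z(2), of i] by (cases "i \<in> S") (simp_all add: n_def)
        then have "n (graft S a x) = n z" by (rule ext)
        then have "dist z (graft S a x) \<le> d * r"
          using near_slice[of z "graft S a x"] z assms(4) by (auto simp: graft_in_slice)
        then have "graft S a x \<in> U" using r \<epsilon> z(1) by (force simp: ball_def)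
        then show "x \<in> B" using z by (simp add: B_def)
      qed
    qed (use assms(5) in \<open>auto simp: B_def intro!: borel_cylinder_vimage\<close>)
    finally show ?thesis by (simp add: mult_left_mono)
  qed
  show ?thesis
    unfolding hausdorff_outer_def SUP_mult_left_ennreal
    using pre by (intro SUP_least) (auto simp: B_def d_def)
qed

text \<open>From compact sets to open sets by exhaustion, then to bounded Borel sets by outer
  regularity, then to all Borel sets by monotone limits. Regularity is applied to the push-forward
  of Lebesgue measure, which is finite over bounded sets, whereas the finiteness of Hausdorff
  measure is among the consequences.\<close>

lemma hausdorff_le_cylinder:
  fixes S :: "'n::finite set" and a :: "real^'n"
  defines "k \<equiv> CARD('n) - card S"
  assumes "b > 0" "A \<in> sets borel"
  shows "ennreal ((2 * b) ^ card S / (unit_ball_vol k * (CARD('n) / 2) ^ k)) * emeasure (hausdorff_measure k) (A \<inter> slice S a)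
    \<le> emeasure lborel {x \<in> cylinder S a b. graft S a x \<in> A}"
proof -
  define H where "H = (hausdorff_measure k :: (real^'n) measure)"
  define w where "w = unit_ball_vol (real k) * (real CARD('n) / 2) ^ k"
  define \<kappa> where "\<kappa> = ennreal ((2 * b) ^ card S / w)"
  define \<mu> where "\<mu> A = emeasure lborel {x \<in> cylinder S a b. graft S a x \<in> A}" for A
  have "unit_ball_vol (real k) > 0" by simp
  then have w: "w > 0" by (simp add: w_def)
  have setsH[simp]: "sets H = sets borel" by (simp add: H_def)
  have \<mu>_mono: "\<mu> A \<le> \<mu> B" if "A \<subseteq> B" "B \<in> sets borel" for A B
    unfolding \<mu>_def using that by (intro emeasure_mono) (auto intro: borel_cylinder_vimage)
  have compact_case: "\<kappa> * emeasure H K \<le> \<mu> U" if "compact K" "K \<subseteq> slice S a" "open U" "K \<subseteq> U" for K U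
  proof -
    have "ennreal ((2 * b) ^ card S) * emeasure H K \<le> ennreal w * \<mu> U"
      using hausdorff_compact_le_cylinder[OF \<open>b > 0\<close> that] that(1)
      unfolding H_def w_def \<mu>_def k_def by (subst emeasure_hausdorff_measure) (auto intro: borel_compact)
    then have "ennreal (1 / w) * (ennreal ((2 * b) ^ card S) * emeasure H K) \<le> ennreal (1 / w) * (ennreal w * \<mu> U)"
      by (rule mult_left_mono) simp
    then show ?thesis
      using w \<open>b > 0\<close> by (simp add: mult.assoc[symmetric] ennreal_mult[symmetric] \<kappa>_def)
  qed
  have open_case: "\<kappa> * emeasure H (U \<inter> slice S a) \<le> \<mu> U" if "open U" for U
  proof -
    \<comment> \<open>Points of the slice in the ball of radius n and at distance at least 1 / (n +
      1) from the complement of U: an increasing compact exhaustion.\<close>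
    define K where "K n = slice S a \<inter> cball 0 (real n) \<inter> (\<Inter>y\<in>-U. {x. 1 / real (Suc n) \<le> dist x y})" for n
    have comp: "compact (K n)" for n
    proof -
      have "closed {x. 1 / real (Suc n) \<le> dist x y}" for y :: "real^'n"
        by (intro closed_Collect_le continuous_intros)
      then have "closed (slice S a \<inter> (\<Inter>y\<in>-U. {x. 1 / real (Suc n) \<le> dist x y}))"
        by (intro closed_Int closed_slice closed_INT) auto
      then have "compact (cball 0 (real n) \<inter> (slice S a \<inter> (\<Inter>y\<in>-U. {x. 1 / real (Suc n) \<le> dist x y})))"
        by (intro compact_Int_closed compact_cball)
      then show ?thesis by (simp add: K_def Int_ac)
    qed
    have inc: "incseq K"
    proof (rule incseq_SucI, rule subsetI)
      fix n x assume x: "x \<in> K n"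
      have "1 / real (Suc (Suc n)) \<le> 1 / real (Suc n)" by (intro divide_left_mono) auto
      then have "1 / real (Suc (Suc n)) \<le> dist x y" if "1 / real (Suc n) \<le> dist x y" for y
        using that by linarith
      with x show "x \<in> K (Suc n)" by (auto simp: K_def)
    qed
    have KU: "K n \<subseteq> U" for n
    proof
      fix x assume x: "x \<in> K n"
      show "x \<in> U"
      proof (rule ccontr)
        assume "x \<notin> U"
        with x have "1 / real (Suc n) \<le> dist x x" unfolding K_def by blast
        then show False by simp
      qed
    qed
    have "U \<inter> slice S a = (\<Union>n. K n)"
    proof (intro subset_antisym subsetI)
      fix x assume x: "x \<in> U \<inter> slice S a"
      then obtain e where e: "e > 0" "ball x e \<subseteq> U" using \<open>open U\<close> by (auto simp: open_contains_ball)
      obtain n1 where n1: "1 / real (Suc n1) < e" using nat_approx_posE[OF e(1)] by blast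
      obtain n2 where n2: "norm x \<le> real n2" using real_arch_simple by blast
      define n where "n = max n1 n2"
      have "1 / real (Suc n) \<le> 1 / real (Suc n1)" by (intro divide_left_mono) (auto simp: n_def)
      then have "1 / real (Suc n) < e" using n1 by linarith
      then have "1 / real (Suc n) \<le> dist x y" if "y \<notin> U" for y
        using that e(2) by (meson in_mono leI less_le_trans less_imp_le mem_ball)
      moreover have "norm x \<le> real n" using n2 by (simp add: n_def)
      ultimately have "x \<in> K n" using x by (auto simp: K_def)
      then show "x \<in> (\<Union>n. K n)" by blast
    next
      fix x assume "x \<in> (\<Union>n. K n)"
      then obtain n where "x \<in> K n" by auto
      then show "x \<in> U \<inter> slice S a" using KU[of n] by (auto simp: K_def)
    qed
    then have "emeasure H (U \<inter> slice S a) = (SUP n. emeasure H (K n))"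
      using comp inc by (subst SUP_emeasure_incseq) (auto intro: borel_compact)
    then have "\<kappa> * emeasure H (U \<inter> slice S a) = (SUP n. \<kappa> * emeasure H (K n))"
      by (simp add: SUP_mult_left_ennreal)
    also have "\<dots> \<le> \<mu> U"
      using comp KU that by (intro SUP_least compact_case) (auto simp: K_def)
    finally show ?thesis .
  qed
  have bounded_case: "\<kappa> * emeasure H ((A \<inter> ball 0 R) \<inter> slice S a) \<le> \<mu> (A \<inter> ball 0 R)" for R
  proof -
    define Q where "Q = {x \<in> cylinder S a b. graft S a x \<in> ball 0 R}"
    have Q_borel: "Q \<in> sets borel" unfolding Q_def by (intro borel_cylinder_vimage) auto
    have "bounded Q"
    proof -
      have "Q \<subseteq> cbox (\<chi> i. - (\<bar>a $ i\<bar> + b + \<bar>R\<bar>)) (\<chi> i. \<bar>a $ i\<bar> + b + \<bar>R\<bar>)"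
      proof
        fix x assume x: "x \<in> Q"
        have "\<bar>x $ i\<bar> \<le> \<bar>a $ i\<bar> + b + \<bar>R\<bar>" for i
        proof (cases "i \<in> S")
          case True
          then have "\<bar>x $ i - a $ i\<bar> \<le> b" using x by (auto simp: Q_def cylinder_def)
          then show ?thesis by linarith
        next
          case False
          then have "\<bar>x $ i\<bar> \<le> norm (graft S a x)" using component_le_norm_cart[of "graft S a x" i] by simp
          moreover have "norm (graft S a x) < R" using x by (auto simp: Q_def)
          ultimately show ?thesis using \<open>b > 0\<close> by linarith
        qed
        then have "- (\<bar>a $ i\<bar> + b + \<bar>R\<bar>) \<le> x $ i \<and> x $ i \<le> \<bar>a $ i\<bar> + b + \<bar>R\<bar>" for i
          by (metis abs_le_D1 abs_le_D2 minus_le_iff)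
        then show "x \<in> cbox (\<chi> i. - (\<bar>a $ i\<bar> + b + \<bar>R\<bar>)) (\<chi> i. \<bar>a $ i\<bar> + b + \<bar>R\<bar>)"
          by (simp add: mem_box_cart)
      qed
      then show ?thesis using bounded_cbox bounded_subset by blast
    qed
    \<comment> \<open>Q is bounded because the cylinder confines the sampled coordinates and the
      ball confines the others; hence M is a finite Borel measure and \<open>outer_regular\<close>
      applies.\<close>
    define M where "M = distr (density lborel (indicator Q)) borel (graft S a)"
    have M_eq: "emeasure M B = \<mu> (B \<inter> ball 0 R)" if "B \<in> sets borel" for B
    proof -
      have pre: "graft S a -` B \<in> sets borel"
        using measurable_sets[OF measurable_graft that, of S a] by simp
      have "emeasure M B = emeasure (density lborel (indicator Q)) (graft S a -` B)"
        unfolding M_def using that by (subst emeasure_distr) auto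
      also have "\<dots> = emeasure lborel (Q \<inter> graft S a -` B)"
        using Q_borel pre by (subst emeasure_density) (auto simp: indicator_inter_arith[symmetric])
      also have "Q \<inter> graft S a -` B = {x \<in> cylinder S a b. graft S a x \<in> B \<inter> ball 0 R}"
        by (auto simp: Q_def)
      finally show ?thesis by (simp add: \<mu>_def)
    qed
    have setsM: "sets M = sets borel" by (simp add: M_def)
    have "emeasure M (space M) = \<mu> (ball 0 R)" using M_eq[of UNIV] by (simp add: M_def)
    also have "\<dots> = emeasure lborel Q" by (simp add: \<mu>_def Q_def)
    also have "\<dots> < \<infinity>" using emeasure_bounded_finite[OF \<open>bounded Q\<close>] by simp
    finally have fin: "emeasure M (space M) \<noteq> \<infinity>" by simp
    have "\<mu> (A \<inter> ball 0 R) = emeasure M A" using M_eq[OF assms(3)] by simp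
    also have "\<dots> = (INF U \<in> {U. A \<subseteq> U \<and> open U}. emeasure M U)"
      by (rule outer_regular[OF setsM fin assms(3)])
    also have "\<dots> \<ge> \<kappa> * emeasure H ((A \<inter> ball 0 R) \<inter> slice S a)"
    proof (rule INF_greatest)
      fix U assume "U \<in> {U. A \<subseteq> U \<and> open U}"
      then have U: "A \<subseteq> U" "open U" by auto
      have "\<kappa> * emeasure H ((A \<inter> ball 0 R) \<inter> slice S a) \<le> \<kappa> * emeasure H ((U \<inter> ball 0 R) \<inter> slice S a)"
        using U by (intro mult_left_mono emeasure_mono) auto
      also have "\<dots> \<le> \<mu> (U \<inter> ball 0 R)" using U by (intro open_case) auto
      also have "\<dots> = emeasure M U" using M_eq[of U] U by auto
      finally show "\<kappa> * emeasure H ((A \<inter> ball 0 R) \<inter> slice S a) \<le> emeasure M U" .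
    qed
    finally show ?thesis .
  qed
  have "(\<Union>n. (A \<inter> ball 0 (real n)) \<inter> slice S a) = A \<inter> slice S a"
  proof -
    have "\<exists>n. norm x < real n" for x :: "real^'n" using reals_Archimedean2 by blast
    then show ?thesis by auto
  qed
  then have "emeasure H (A \<inter> slice S a) = (SUP n. emeasure H ((A \<inter> ball 0 (real n)) \<inter> slice S a))"
    using assms(3) by (subst SUP_emeasure_incseq) (auto simp: incseq_def)
  then have "\<kappa> * emeasure H (A \<inter> slice S a) = (SUP n. \<kappa> * emeasure H ((A \<inter> ball 0 (real n)) \<inter> slice S a))"
    by (simp add: SUP_mult_left_ennreal)
  also have "\<dots> \<le> \<mu> A"
    using assms(3) by (intro SUP_least order_trans[OF bounded_case \<mu>_mono]) auto
  finally show ?thesis by (simp add: \<kappa>_def w_def H_def \<mu>_def)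
qed

text \<open>Both integrals integrate h itself: \<open>N1\<close> is the push-forward of Lebesgue
  measure on the cylinder under \<open>graft S a\<close>, and \<open>N2\<close> is Hausdorff measure
  restricted to the slice. The two preceding set inequalities compare these measures.\<close>

lemma nn_integral_slice_compare:
  fixes S :: "'n::finite set" and a :: "real^'n"
  defines "k \<equiv> CARD('n) - card S"
  assumes "b > 0" and h[measurable]: "h \<in> borel_measurable borel"
  shows "(\<integral>\<^sup>+x. h (graft S a x) * indicator (cylinder S a b) x \<partial>lborel)
    \<le> ennreal ((2 * b) ^ card S * 4 ^ k / unit_ball_vol k) * (\<integral>\<^sup>+x. h x * indicator (slice S a) x \<partial>hausdorff_measure k)"
   and "ennreal ((2 * b) ^ card S / (unit_ball_vol k * (CARD('n) / 2) ^ k)) * (\<integral>\<^sup>+x. h x * indicator (slice S a) x \<partial>hausdorff_measure k)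
    \<le> (\<integral>\<^sup>+x. h (graft S a x) * indicator (cylinder S a b) x \<partial>lborel)"
proof -
  define N1 where "N1 = distr (density lborel (indicator (cylinder S a b))) borel (graft S a)"
  define N2 where "N2 = density (hausdorff_measure k :: (real^'n) measure) (indicator (slice S a))"
  have N1: "(\<integral>\<^sup>+x. h x \<partial>N1) = (\<integral>\<^sup>+x. h (graft S a x) * indicator (cylinder S a b) x \<partial>lborel)"
    unfolding N1_def by (subst nn_integral_distr, simp, simp, subst nn_integral_density) (auto simp: mult.commute)
  have N2: "(\<integral>\<^sup>+x. h x \<partial>N2) = (\<integral>\<^sup>+x. h x * indicator (slice S a) x \<partial>hausdorff_measure k)"
    unfolding N2_def by (subst nn_integral_density) (auto simp: mult.commute)
  have e1: "emeasure N1 A = emeasure lborel {x \<in> cylinder S a b. graft S a x \<in> A}" if "A \<in> sets borel" for A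
  proof -
    have pre: "graft S a -` A \<in> sets borel"
      using measurable_sets[OF measurable_graft that, of S a] by simp
    have "emeasure N1 A = emeasure (density lborel (indicator (cylinder S a b))) (graft S a -` A)"
      unfolding N1_def using that by (subst emeasure_distr) auto
    also have "\<dots> = emeasure lborel (cylinder S a b \<inter> graft S a -` A)"
      using pre by (subst emeasure_density) (auto simp: indicator_inter_arith[symmetric])
    also have "cylinder S a b \<inter> graft S a -` A = {x \<in> cylinder S a b. graft S a x \<in> A}" by auto
    finally show ?thesis .
  qed
  have e2: "emeasure N2 A = emeasure (hausdorff_measure k) (A \<inter> slice S a)" if "A \<in> sets borel" for A
    unfolding N2_def using that by (subst emeasure_density) (auto simp: indicator_inter_arith[symmetric] Int_commute)
  have sets: "sets N1 = sets borel" "sets N2 = sets borel" by (simp_all add: N1_def N2_def)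
  define c where "c = (2 * b) ^ card S * 4 ^ k / unit_ball_vol (real k)"
  have "unit_ball_vol (real k) > 0" by simp
  then have c: "c > 0" using \<open>b > 0\<close> by (simp add: c_def)
  have "inverse (ennreal c) * (\<integral>\<^sup>+x. h x \<partial>N1) \<le> (\<integral>\<^sup>+x. h x \<partial>N2)"
  proof (rule nn_integral_mono_emeasure)
    fix A assume "A \<in> sets N1"
    then have "emeasure N1 A \<le> ennreal c * emeasure N2 A"
      using cylinder_le_hausdorff[OF \<open>b > 0\<close>, of A S a] by (simp add: sets e1 e2 c_def k_def)
    then have "inverse (ennreal c) * emeasure N1 A \<le> inverse (ennreal c) * (ennreal c * emeasure N2 A)"
      by (rule mult_left_mono) simp
    then show "inverse (ennreal c) * emeasure N1 A \<le> emeasure N2 A"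
      using c by (simp add: mult.assoc[symmetric] inverse_ennreal ennreal_mult[symmetric])
  qed (auto simp: sets N1_def)
  then have "ennreal c * (inverse (ennreal c) * (\<integral>\<^sup>+x. h x \<partial>N1)) \<le> ennreal c * (\<integral>\<^sup>+x. h x \<partial>N2)"
    by (rule mult_left_mono) simp
  then show "(\<integral>\<^sup>+x. h (graft S a x) * indicator (cylinder S a b) x \<partial>lborel)
    \<le> ennreal ((2 * b) ^ card S * 4 ^ k / unit_ball_vol k) * (\<integral>\<^sup>+x. h x * indicator (slice S a) x \<partial>hausdorff_measure k)"
    unfolding c_def[symmetric]
    using c by (simp add: mult.assoc[symmetric] inverse_ennreal ennreal_mult[symmetric] N1 N2)
  have "ennreal ((2 * b) ^ card S / (unit_ball_vol k * (CARD('n) / 2) ^ k)) * (\<integral>\<^sup>+x. h x \<partial>N2) \<le> (\<integral>\<^sup>+x. h x \<partial>N1)"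
  proof (rule nn_integral_mono_emeasure)
    fix A assume "A \<in> sets N2"
    then show "ennreal ((2 * b) ^ card S / (unit_ball_vol k * (CARD('n) / 2) ^ k)) * emeasure N2 A \<le> emeasure N1 A"
      using hausdorff_le_cylinder[OF \<open>b > 0\<close>, of A S a] by (simp add: sets e1 e2 k_def)
  qed (auto simp: sets N2_def)
  then show "ennreal ((2 * b) ^ card S / (unit_ball_vol k * (CARD('n) / 2) ^ k)) * (\<integral>\<^sup>+x. h x * indicator (slice S a) x \<partial>hausdorff_measure k)
    \<le> (\<integral>\<^sup>+x. h (graft S a x) * indicator (cylinder S a b) x \<partial>lborel)"
    by (simp add: N1 N2)
qed

section \<open>Integral inequalities\<close>

text \<open>The graph of the convex function t powr p lies above its tangent at s; this rearranged
  form follows from Young's inequality with the conjugate exponent p / (p - 1).\<close>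

lemma powr_tangent:
  fixes p s t :: real
  assumes "1 \<le> p" "0 \<le> t" "0 < s"
  shows "p * s powr (p - 1) * t \<le> t powr p + (p - 1) * s powr p"
proof (cases "p = 1")
  case True
  then show ?thesis using assms by simp
next
  case False
  then have p: "p > 1" using assms by simp
  define q where "q = p / (p - 1)"
  have q: "q > 1" "1 / p + 1 / q = 1" using p by (auto simp: q_def field_simps)
  have "t * s powr (p - 1) \<le> t powr p / p + (s powr (p - 1)) powr q / q"
    using p q assms by (intro Youngs_inequality) auto
  also have "(s powr (p - 1)) powr q = s powr p" using p by (simp add: powr_powr q_def)
  also have "s powr p / q = (p - 1) * s powr p / p" by (simp add: q_def)
  finally show ?thesis using p by (simp add: field_simps)
qed

text \<open>Jensen's inequality for a weight of total mass at most W, without normalising it: the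
  tangent inequality is integrated against w.\<close>

lemma nn_integral_Jensen_powr:
  fixes g w :: "'a \<Rightarrow> real" and u W p :: real
  assumes p: "1 \<le> p" and [measurable]: "g \<in> borel_measurable M" "w \<in> borel_measurable M"
    and nonneg: "\<And>x. 0 \<le> g x" "\<And>x. 0 \<le> w x" and "0 \<le> u" "0 < W"
    and w: "(\<integral>\<^sup>+x. w x \<partial>M) \<le> ennreal W" and u: "ennreal u \<le> (\<integral>\<^sup>+x. g x * w x \<partial>M)"
  shows "ennreal (u powr p) \<le> ennreal (W powr (p - 1)) * (\<integral>\<^sup>+x. g x powr p * w x \<partial>M)"
proof (cases "u = 0 \<or> (\<integral>\<^sup>+x. g x powr p * w x \<partial>M) = \<infinity>")
  case True
  then show ?thesis using \<open>0 < W\<close> by (auto simp: ennreal_mult_top)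
next
  case False
  then have "u > 0" using \<open>0 \<le> u\<close> by simp
  obtain A where A: "(\<integral>\<^sup>+x. g x powr p * w x \<partial>M) = ennreal A" "A \<ge> 0"
    using False by (cases "\<integral>\<^sup>+x. g x powr p * w x \<partial>M") auto
  \<comment> \<open>The tangent is taken at the mean value u / W, where both terms in s become
    multiples of \<open>s powr p * W\<close>.\<close>
  define s where "s = u / W"
  have s: "s > 0" using \<open>u > 0\<close> \<open>0 < W\<close> by (simp add: s_def)
  have "ennreal (p * s powr (p - 1) * u) = ennreal (p * s powr (p - 1)) * ennreal u"
    using p by (simp add: ennreal_mult' \<open>0 \<le> u\<close>)
  also have "\<dots> \<le> ennreal (p * s powr (p - 1)) * (\<integral>\<^sup>+x. g x * w x \<partial>M)"
    by (intro mult_left_mono u) auto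
  also have "\<dots> = (\<integral>\<^sup>+x. ennreal (p * s powr (p - 1) * (g x * w x)) \<partial>M)"
    using p nonneg by (subst nn_integral_cmult[symmetric]) (auto simp: ennreal_mult)
  also have "\<dots> \<le> (\<integral>\<^sup>+x. ennreal (g x powr p * w x) + ennreal ((p - 1) * s powr p) * ennreal (w x) \<partial>M)"
  proof (rule nn_integral_mono)
    fix x
    have "p * s powr (p - 1) * g x * w x \<le> (g x powr p + (p - 1) * s powr p) * w x"
      using p nonneg s by (intro mult_right_mono powr_tangent) auto
    then have "ennreal (p * s powr (p - 1) * (g x * w x)) \<le> ennreal (g x powr p * w x + (p - 1) * s powr p * w x)"
      by (intro ennreal_leI) (simp add: algebra_simps)
    also have "\<dots> = ennreal (g x powr p * w x) + ennreal ((p - 1) * s powr p) * ennreal (w x)"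
      using p nonneg by (subst ennreal_plus) (auto simp: ennreal_mult)
    finally show "ennreal (p * s powr (p - 1) * (g x * w x)) \<le> ennreal (g x powr p * w x) + ennreal ((p - 1) * s powr p) * ennreal (w x)" .
  qed
  also have "\<dots> = ennreal A + ennreal ((p - 1) * s powr p) * (\<integral>\<^sup>+x. w x \<partial>M)"
    by (simp add: nn_integral_add nn_integral_cmult A)
  also have "\<dots> \<le> ennreal A + ennreal ((p - 1) * s powr p) * ennreal W"
    by (intro add_left_mono mult_left_mono w) auto
  also have "\<dots> = ennreal (A + (p - 1) * s powr p * W)"
    using p A \<open>0 < W\<close> by (simp add: ennreal_mult[symmetric] ennreal_plus[symmetric] del: ennreal_plus)
  finally have "p * s powr (p - 1) * u \<le> A + (p - 1) * s powr p * W"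
    using A p \<open>0 < W\<close> by (subst (asm) ennreal_le_iff) auto
  moreover have "s powr p * W = s powr (p - 1) * u"
    using \<open>u > 0\<close> \<open>0 < W\<close> by (simp add: powr_diff s_def)
  then have "p * s powr (p - 1) * u = p * (s powr p * W)" by simp
  moreover have "(p - 1) * s powr p * W = p * (s powr p * W) - s powr p * W"
    by (simp add: algebra_simps)
  ultimately have "s powr p * W \<le> A" by linarith
  moreover have "u powr p = W powr (p - 1) * (s powr p * W)"
    using \<open>u > 0\<close> \<open>0 < W\<close> by (simp add: s_def powr_divide powr_diff)
  ultimately have "u powr p \<le> W powr (p - 1) * A" by (simp add: mult_left_mono)
  then show ?thesis using A by (simp add: ennreal_mult[symmetric] ennreal_leI)
qed

text \<open>Jensen's inequality with the weight \<open>k x\<close> bounds \<open>U x powr p\<close>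
  by K1 powr (p - 1) times the integral of \<open>g y powr p * k x y\<close>. Tonelli's theorem then
  turns the integral over x into K2.\<close>

lemma Schur_test:
  fixes k :: "'a \<Rightarrow> 'b \<Rightarrow> real" and g :: "'b \<Rightarrow> real" and U :: "'a \<Rightarrow> real"
  assumes "sigma_finite_measure M" "sigma_finite_measure N" and p: "1 \<le> p"
    and k[measurable]: "(\<lambda>(x, y). k x y) \<in> borel_measurable (M \<Otimes>\<^sub>M N)" and g[measurable]: "g \<in> borel_measurable N"
    and nonneg: "\<And>x y. 0 \<le> k x y" "\<And>y. 0 \<le> g y" "\<And>x. 0 \<le> U x"
    and K1: "\<And>x. x \<in> space M \<Longrightarrow> (\<integral>\<^sup>+y. k x y \<partial>N) \<le> ennreal K1" and K2: "\<And>y. y \<in> space N \<Longrightarrow> (\<integral>\<^sup>+x. k x y \<partial>M) \<le> ennreal K2"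
    and pos: "0 < K1" "0 \<le> K2"
    and U: "\<And>x. x \<in> space M \<Longrightarrow> ennreal (U x) \<le> (\<integral>\<^sup>+y. g y * k x y \<partial>N)"
  shows "(\<integral>\<^sup>+x. U x powr p \<partial>M) \<le> ennreal (K1 powr (p - 1) * K2) * (\<integral>\<^sup>+y. g y powr p \<partial>N)"
proof -
  interpret M: sigma_finite_measure M by fact
  interpret N: sigma_finite_measure N by fact
  interpret pair_sigma_finite M N ..
  have kx[measurable]: "k x \<in> borel_measurable N" if "x \<in> space M" for x
    using measurable_compose[OF measurable_Pair1'[OF that] k] by simp
  have ky: "(\<lambda>x. k x y) \<in> borel_measurable M" if "y \<in> space N" for y
    using measurable_compose[OF measurable_Pair2'[OF that] k] by simp
  have "(\<integral>\<^sup>+x. U x powr p \<partial>M) \<le> (\<integral>\<^sup>+x. ennreal (K1 powr (p - 1)) * (\<integral>\<^sup>+y. g y powr p * k x y \<partial>N) \<partial>M)"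
    using p nonneg pos K1 U kx by (intro nn_integral_mono nn_integral_Jensen_powr) auto
  also have "\<dots> = ennreal (K1 powr (p - 1)) * (\<integral>\<^sup>+x. \<integral>\<^sup>+y. g y powr p * k x y \<partial>N \<partial>M)"
    by (rule nn_integral_cmult) measurable
  also have "(\<integral>\<^sup>+x. \<integral>\<^sup>+y. g y powr p * k x y \<partial>N \<partial>M) = (\<integral>\<^sup>+y. \<integral>\<^sup>+x. g y powr p * k x y \<partial>M \<partial>N)"
    by (rule Fubini'[symmetric]) measurable
  also have "\<dots> = (\<integral>\<^sup>+y. ennreal (g y powr p) * (\<integral>\<^sup>+x. k x y \<partial>M) \<partial>N)"
    using ky nonneg by (intro nn_integral_cong) (subst nn_integral_cmult[symmetric], auto simp: ennreal_mult)
  also have "\<dots> \<le> (\<integral>\<^sup>+y. ennreal (g y powr p) * ennreal K2 \<partial>N)"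
    by (intro nn_integral_mono mult_left_mono K2) auto
  also have "\<dots> = ennreal K2 * (\<integral>\<^sup>+y. ennreal (g y powr p) \<partial>N)"
    by (subst nn_integral_multc) (auto simp: mult.commute)
  finally show ?thesis using pos by (simp add: ennreal_mult mult.assoc mult_left_mono)
qed

text \<open>Convexity at the points s / a and t / b with weights a / (a + b) and b / (a + b). The
  right-hand side is linear in \<open>s powr p\<close> and \<open>t powr p\<close>, so integrating
  it yields Minkowski's inequality with a and b as the two norms.\<close>

lemma powr_sum_convex:
  fixes a b s t p :: real
  assumes "1 \<le> p" "0 < a" "0 < b" "0 \<le> s" "0 \<le> t"
  shows "(s + t) powr p \<le> (a + b) powr (p - 1) * (a powr (1 - p) * s powr p + b powr (1 - p) * t powr p)"
proof (cases "s + t = 0")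
  case False
  define r where "r = (s + t) / (a + b)"
  have r: "r > 0" using assms False by (simp add: r_def)
  have 1: "p * r powr (p - 1) * (s / a) \<le> (s / a) powr p + (p - 1) * r powr p"
    using assms r by (intro powr_tangent) auto
  have 2: "p * r powr (p - 1) * (t / b) \<le> (t / b) powr p + (p - 1) * r powr p"
    using assms r by (intro powr_tangent) auto
  have "p * r powr (p - 1) * (s + t) = a * (p * r powr (p - 1) * (s / a)) + b * (p * r powr (p - 1) * (t / b))"
    using assms by (simp add: algebra_simps)
  also have "\<dots> \<le> a * ((s / a) powr p + (p - 1) * r powr p) + b * ((t / b) powr p + (p - 1) * r powr p)"
    using assms 1 2 by (intro add_mono mult_left_mono) auto
  also have "\<dots> = a * (s / a) powr p + b * (t / b) powr p + (p - 1) * (r powr p * (a + b))"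
    by (simp add: algebra_simps)
  also have rr: "r powr p * (a + b) = r powr (p - 1) * (s + t)"
    using r assms by (simp add: powr_diff r_def)
  finally have "r powr p * (a + b) \<le> a * (s / a) powr p + b * (t / b) powr p"
    unfolding rr by (simp add: algebra_simps)
  also have "\<dots> = a powr (1 - p) * s powr p + b powr (1 - p) * t powr p"
    using assms by (simp add: powr_divide powr_diff)
  finally have "(a + b) powr (p - 1) * (r powr p * (a + b)) \<le>
     (a + b) powr (p - 1) * (a powr (1 - p) * s powr p + b powr (1 - p) * t powr p)"
    by (rule mult_left_mono) simp
  also have "(a + b) powr (p - 1) * (r powr p * (a + b)) = (s + t) powr p"
    using assms by (simp add: r_def powr_divide powr_diff)
  finally show ?thesis .
next
  case True
  then show ?thesis using assms by simp
qed

text \<open>Enlarging \<open>a\<close> and \<open>b\<close> slightly covers the cases \<open>a = 0\<close> and \<open>b = 0\<close>, in which the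
  weights of \<open>powr_sum_convex\<close> degenerate.\<close>

lemma nn_Minkowski:
  fixes u v w :: "'a \<Rightarrow> real" and a b p :: real
  assumes p: "1 \<le> p" and [measurable]: "u \<in> borel_measurable M" "v \<in> borel_measurable M"
    and nonneg: "\<And>x. 0 \<le> u x" "\<And>x. 0 \<le> v x" "0 \<le> a" "0 \<le> b"
    and u: "(\<integral>\<^sup>+x. u x powr p \<partial>M) \<le> ennreal (a powr p)"
    and v: "(\<integral>\<^sup>+x. v x powr p \<partial>M) \<le> ennreal (b powr p)"
    and w: "\<And>x. x \<in> space M \<Longrightarrow> 0 \<le> w x" "\<And>x. x \<in> space M \<Longrightarrow> w x \<le> u x + v x"
  shows "(\<integral>\<^sup>+x. w x powr p \<partial>M) \<le> ennreal ((a + b) powr p)"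
proof -
  have *: "(\<integral>\<^sup>+x. w x powr p \<partial>M) \<le> ennreal ((a' + b') powr p)"
    if ab: "a < a'" "b < b'" for a' b'
  proof -
    have pos: "0 < a'" "0 < b'" using ab nonneg by auto
    define c where "c = (a' + b') powr (p - 1)"
    have "(\<integral>\<^sup>+x. w x powr p \<partial>M) \<le> (\<integral>\<^sup>+x. ennreal (c * a' powr (1 - p)) * ennreal (u x powr p) + ennreal (c * b' powr (1 - p)) * ennreal (v x powr p) \<partial>M)"
    proof (rule nn_integral_mono)
      fix x assume x: "x \<in> space M"
      have "w x powr p \<le> (u x + v x) powr p"
        using p w[OF x] by (intro powr_mono2) auto
      also have "\<dots> \<le> c * (a' powr (1 - p) * u x powr p + b' powr (1 - p) * v x powr p)"
        unfolding c_def using p pos nonneg by (intro powr_sum_convex) auto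
      finally show "ennreal (w x powr p) \<le> ennreal (c * a' powr (1 - p)) * ennreal (u x powr p) + ennreal (c * b' powr (1 - p)) * ennreal (v x powr p)"
        by (simp add: ennreal_mult[symmetric] ennreal_plus[symmetric] c_def algebra_simps del: ennreal_plus)
    qed
    also have "\<dots> = ennreal (c * a' powr (1 - p)) * (\<integral>\<^sup>+x. u x powr p \<partial>M) + ennreal (c * b' powr (1 - p)) * (\<integral>\<^sup>+x. v x powr p \<partial>M)"
      by (simp add: nn_integral_add nn_integral_cmult)
    also have "\<dots> \<le> ennreal (c * a' powr (1 - p)) * ennreal (a' powr p) + ennreal (c * b' powr (1 - p)) * ennreal (b' powr p)"
      using p ab nonneg by (intro add_mono mult_left_mono order_trans[OF u] order_trans[OF v] ennreal_leI powr_mono2) auto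
    also have "\<dots> = ennreal (c * (a' powr (1 - p) * a' powr p + b' powr (1 - p) * b' powr p))"
      by (simp add: ennreal_mult[symmetric] ennreal_plus[symmetric] c_def algebra_simps del: ennreal_plus)
    also have "c * (a' powr (1 - p) * a' powr p + b' powr (1 - p) * b' powr p) = (a' + b') powr p"
      using pos by (simp add: c_def powr_add[symmetric] powr_diff)
    finally show ?thesis .
  qed
  have lim: "(\<lambda>n. ennreal ((a + 1 / real (Suc n) + (b + 1 / real (Suc n))) powr p)) \<longlonglongrightarrow> ennreal ((a + 0 + (b + 0)) powr p)"
    using p by (intro tendsto_intros tendsto_ennrealI tendsto_powr' LIMSEQ_Suc[OF lim_1_over_n]) (auto intro: always_eventually)
  have bound: "(\<integral>\<^sup>+x. w x powr p \<partial>M) \<le> ennreal ((a + 1 / real (Suc n) + (b + 1 / real (Suc n))) powr p)" for n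
    by (rule *) auto
  have "(\<integral>\<^sup>+x. w x powr p \<partial>M) \<le> ennreal ((a + 0 + (b + 0)) powr p)"
    using bound by (intro LIMSEQ_le_const[OF lim]) blast
  then show ?thesis by simp
qed

section \<open>Product weights and Gaussians\<close>

lemma prod_Basis_cart:
  "(\<Prod>b\<in>(Basis :: (real^'n::finite) set). f b) = (\<Prod>i\<in>UNIV. f (axis i 1))"
proof -
  have B: "(Basis :: (real^'n) set) = range (\<lambda>i. axis i 1)" by (auto simp: Basis_vec_def)
  have "inj (\<lambda>i :: 'n. axis i (1::real))" by (auto simp: inj_on_def axis_eq_axis)
  then show ?thesis unfolding B by (subst prod.reindex) auto
qed

lemma nn_integral_prod_cart:
  fixes f :: "'n::finite \<Rightarrow> real \<Rightarrow> ennreal"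
  assumes [measurable]: "\<And>i. f i \<in> borel_measurable borel"
  shows "(\<integral>\<^sup>+x. (\<Prod>i\<in>UNIV. f i (x $ i)) \<partial>(lborel :: (real^'n) measure)) = (\<Prod>i\<in>UNIV. \<integral>\<^sup>+x. f i x \<partial>lborel)"
proof -
  define idx where "idx b = (SOME i. b = axis i (1::real))" for b :: "real^'n"
  have idx: "idx (axis i 1) = i" for i
    unfolding idx_def by (rule some_equality) (auto simp: axis_eq_axis)
  have "(\<integral>\<^sup>+x. (\<Prod>b\<in>Basis. f (idx b) (x \<bullet> b)) \<partial>(lborel :: (real^'n) measure)) = (\<Prod>b\<in>(Basis :: (real^'n) set). \<integral>\<^sup>+x. f (idx b) x \<partial>lborel)"
    by (rule nn_integral_lborel_prod) auto
  then show ?thesis by (simp add: prod_Basis_cart idx inner_axis)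
qed

lemma lborel_integral_prod_cart:
  fixes f :: "'n::finite \<Rightarrow> real \<Rightarrow> complex"
  assumes int: "\<And>i. integrable lborel (f i)"
  shows "integrable lborel (\<lambda>x::real^'n. \<Prod>i\<in>UNIV. f i (x $ i))"
    and "(\<integral>x. (\<Prod>i\<in>UNIV. f i (x $ i)) \<partial>(lborel :: (real^'n) measure)) = (\<Prod>i\<in>UNIV. \<integral>x. f i x \<partial>lborel)"
proof -
  let ?B = "Basis :: (real^'n) set"
  define idx where "idx b = (SOME i. b = axis i (1::real))" for b :: "real^'n"
  have idx: "idx (axis i 1) = i" for i
    unfolding idx_def by (rule some_equality) (auto simp: axis_eq_axis)
  interpret product_sigma_finite "\<lambda>_ :: real^'n. lborel :: real measure" ..
  have [measurable]: "f i \<in> borel_measurable borel" for i using int[of i] by auto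
  have meas: "(\<lambda>x. \<Prod>b\<in>?B. f (idx b) (x \<bullet> b)) \<in> borel_measurable borel" by measurable
  have sum: "(\<Sum>b\<in>?B. g b *\<^sub>R b) \<bullet> c = g c" if "c \<in> ?B" for g c
    using that by (simp add: inner_sum_left_Basis)
  have P1: "integrable (\<Pi>\<^sub>M b\<in>?B. lborel) (\<lambda>g. \<Prod>b\<in>?B. f (idx b) (g b))"
    using int by (intro product_integrable_prod) auto
  have P2: "(\<integral>g. (\<Prod>b\<in>?B. f (idx b) (g b)) \<partial>(\<Pi>\<^sub>M b\<in>?B. lborel)) = (\<Prod>b\<in>?B. \<integral>x. f (idx b) x \<partial>lborel)"
    using int by (intro product_integral_prod) auto
  have mT: "(\<lambda>g. \<Sum>b\<in>?B. g b *\<^sub>R b) \<in> (\<Pi>\<^sub>M b\<in>?B. lborel) \<rightarrow>\<^sub>M borel" by measurable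
  have "integrable lborel (\<lambda>x. \<Prod>b\<in>?B. f (idx b) (x \<bullet> b))"
    by (subst lborel_eq, subst integrable_distr_eq[OF mT meas]) (use P1 in \<open>simp add: sum cong: prod.cong\<close>)
  then show "integrable lborel (\<lambda>x::real^'n. \<Prod>i\<in>UNIV. f i (x $ i))"
    by (simp add: prod_Basis_cart idx inner_axis)
  have "(\<integral>x. (\<Prod>b\<in>?B. f (idx b) (x \<bullet> b)) \<partial>lborel) = (\<Prod>b\<in>?B. \<integral>x. f (idx b) x \<partial>lborel)"
    by (subst lborel_eq, subst integral_distr[OF mT meas]) (use P2 in \<open>simp add: sum cong: prod.cong\<close>)
  then show "(\<integral>x. (\<Prod>i\<in>UNIV. f i (x $ i)) \<partial>(lborel :: (real^'n) measure)) = (\<Prod>i\<in>UNIV. \<integral>x. f i x \<partial>lborel)"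
    by (simp add: prod_Basis_cart idx inner_axis)
qed

lemma nn_integral_inverse_1_plus_square: "(\<integral>\<^sup>+x. ennreal (inverse (1 + x\<^sup>2)) \<partial>lborel) = ennreal pi"
proof -
  have "integrable lborel (\<lambda>x::real. inverse (1 + x\<^sup>2))"
    using integrable_inverse_1_plus_square by (simp add: set_integrable_def)
  moreover have "(\<integral>x. inverse (1 + (x::real)\<^sup>2) \<partial>lborel) = pi"
    using LBINT_inverse_1_plus_square by (simp add: interval_lebesgue_integral_def set_lebesgue_integral_def)
  ultimately show ?thesis by (subst nn_integral_eq_integral) auto
qed

text \<open>A product of unnormalised Cauchy densities with a separate scale in each coordinate. The
  product form gives an exact integral and lets the sampled coordinates be widened without touching
  the others.\<close>

definition prod_weight :: "('n::finite \<Rightarrow> real) \<Rightarrow> real^'n \<Rightarrow> real" where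
  "prod_weight a x = (\<Prod>i\<in>UNIV. inverse (1 + (x $ i / a i)\<^sup>2))"

lemma prod_weight_pos: "prod_weight a x > 0"
  unfolding prod_weight_def by (intro prod_pos) (auto simp: add_pos_nonneg)

lemma prod_weight_nonneg: "prod_weight a x \<ge> 0"
  using prod_weight_pos[of a x] by simp

lemma continuous_on_prod_weight [continuous_intros]:
  "continuous_on A f \<Longrightarrow> continuous_on A (\<lambda>x. prod_weight a (f x))"
  unfolding prod_weight_def divide_inverse
  by (intro continuous_intros) (auto simp: add_nonneg_eq_0_iff)

lemma borel_measurable_prod_weight [measurable]: "prod_weight a \<in> borel_measurable borel"
  by (intro borel_measurable_continuous_onI continuous_intros)

lemma nn_integral_prod_weight:
  fixes w :: "real^'n::finite"
  assumes a: "\<And>i. a i > 0"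
  shows "(\<integral>\<^sup>+x. ennreal (prod_weight a (x - w)) \<partial>lborel) = ennreal (\<Prod>i\<in>UNIV. pi * a i)"
proof -
  have one: "(\<integral>\<^sup>+x. ennreal (inverse (1 + ((x - w $ i) / a i)\<^sup>2)) \<partial>lborel) = ennreal (pi * a i)" for i
  proof -
    have "(\<integral>\<^sup>+x. ennreal (inverse (1 + ((x - w $ i) / a i)\<^sup>2)) \<partial>lborel)
       = ennreal \<bar>a i\<bar> * (\<integral>\<^sup>+x. ennreal (inverse (1 + ((w $ i + a i * x - w $ i) / a i)\<^sup>2)) \<partial>lborel)"
      using a[of i] by (intro nn_integral_real_affine) auto
    also have "\<dots> = ennreal (a i) * ennreal pi"
      using a[of i] nn_integral_inverse_1_plus_square by simp
    finally show ?thesis using a[of i] by (simp add: ennreal_mult[symmetric] mult.commute)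
  qed
  have "(\<integral>\<^sup>+x. ennreal (prod_weight a (x - w)) \<partial>lborel)
     = (\<integral>\<^sup>+x. (\<Prod>i\<in>UNIV. ennreal (inverse (1 + ((x $ i - w $ i) / a i)\<^sup>2))) \<partial>lborel)"
    unfolding prod_weight_def by (subst prod_ennreal) (auto simp: add_nonneg_nonneg)
  also have "\<dots> = (\<Prod>i\<in>UNIV. \<integral>\<^sup>+x. ennreal (inverse (1 + ((x - w $ i) / a i)\<^sup>2)) \<partial>lborel)"
    by (rule nn_integral_prod_cart) measurable
  also have "\<dots> = ennreal (\<Prod>i\<in>UNIV. pi * a i)"
    unfolding one using a by (intro prod_ennreal) (simp add: less_imp_le)
  finally show ?thesis .
qed

lemma prod_weight_uminus: "prod_weight a (- x) = prod_weight a x"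
  by (simp add: prod_weight_def)

text \<open>Each of the d factors 1 + z_i^2 is at most (1 + |z|)^2, which is why decay of order 2 d
  is asked of the kernels.\<close>

lemma decay_le_prod_weight:
  fixes z :: "real^'n::finite"
  shows "1 / (1 + norm z) ^ (2 * CARD('n)) \<le> prod_weight (\<lambda>_. 1) z"
proof -
  have "1 / (1 + norm z) ^ (2 * CARD('n)) = (\<Prod>i\<in>(UNIV :: 'n set). inverse ((1 + norm z)\<^sup>2))"
    by (simp add: power_mult inverse_eq_divide power_one_over)
  also have "\<dots> \<le> (\<Prod>i\<in>UNIV. inverse (1 + (z $ i / 1)\<^sup>2))"
  proof (rule prod_mono)
    fix i :: 'n
    have "(z $ i)\<^sup>2 \<le> (norm z)\<^sup>2" using component_le_norm_cart[of z i] by (metis abs_le_square_iff abs_norm_cancel)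
    then have "1 + (z $ i)\<^sup>2 \<le> (1 + norm z)\<^sup>2"
      using norm_ge_zero[of z] by (simp add: power2_sum add_increasing2)
    then show "0 \<le> inverse ((1 + norm z)\<^sup>2) \<and> inverse ((1 + norm z)\<^sup>2) \<le> inverse (1 + (z $ i / 1)\<^sup>2)"
      by (auto intro!: le_imp_inverse_le add_pos_nonneg)
  qed
  finally show ?thesis by (simp add: prod_weight_def)
qed

text \<open>This is exp (- pi |x|^2), the Gaussian fixed by the Fourier transform with kernel
  \<open>cis (2 * pi * (s \<bullet> x))\<close>. Written as a product, it is transformed one
  coordinate at a time.\<close>

definition gauss :: "real^'n::finite \<Rightarrow> real" where
  "gauss x = (\<Prod>i\<in>UNIV. exp (- pi * (x $ i)\<^sup>2))"

lemma gauss_1d: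
  "integrable lborel (\<lambda>x. complex_of_real (exp (- pi * x\<^sup>2)) * cis (2 * pi * (s * x)))"
  "(\<integral>x. complex_of_real (exp (- pi * x\<^sup>2)) * cis (2 * pi * (s * x)) \<partial>lborel) = complex_of_real (exp (- pi * s\<^sup>2))"
proof -
  \<comment> \<open>The substitution x / c turns the standard normal density into c exp (- pi x^2),
    so the formula follows from the characteristic function of the normal distribution at t = 2 pi s
    c.\<close>
  define c where "c = 1 / sqrt (2 * pi)"
  have c: "c > 0" "c\<^sup>2 = 1 / (2 * pi)" by (auto simp: c_def power_divide)
  define t where "t = 2 * pi * s * c"
  have "t\<^sup>2 / 2 = (2 * pi)\<^sup>2 * s\<^sup>2 * c\<^sup>2 / 2" by (simp add: t_def power_mult_distrib)
  also have "\<dots> = pi * s\<^sup>2" unfolding c by (simp add: power2_eq_square)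
  finally have t: "t\<^sup>2 / 2 = pi * s\<^sup>2" .
  have "has_bochner_integral lborel (\<lambda>x. std_normal_density x *\<^sub>R iexp (t * x)) (exp (- (t\<^sup>2) / 2))"
  proof -
    have "complex_of_real (exp (- (t\<^sup>2) / 2)) = char std_normal_distribution t"
      by (simp add: char_std_normal_distribution)
    also have "\<dots> = (\<integral>x. std_normal_density x *\<^sub>R iexp (t * x) \<partial>lborel)"
      unfolding char_def by (subst integral_density) auto
    finally have "(\<integral>x. std_normal_density x *\<^sub>R iexp (t * x) \<partial>lborel) = complex_of_real (exp (- (t\<^sup>2) / 2))" ..
    moreover have "integrable lborel (\<lambda>x. std_normal_density x *\<^sub>R iexp (t * x))"
      by (rule Bochner_Integration.integrable_bound[OF integrable_normal_moment[of 1 0 0]]) auto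
    ultimately show ?thesis by (simp add: has_bochner_integral_iff)
  qed
  then have "has_bochner_integral lborel (\<lambda>x. std_normal_density (0 + (1 / c) * x) *\<^sub>R iexp (t * (0 + (1 / c) * x))) (exp (- (t\<^sup>2) / 2) /\<^sub>R \<bar>1 / c\<bar>)"
    using c by (subst (asm) lborel_has_bochner_integral_real_affine_iff[of "1 / c" _ _ 0]) (auto simp: scaleR_conv_of_real)
  moreover have "std_normal_density (0 + (1 / c) * x) *\<^sub>R iexp (t * (0 + (1 / c) * x))
     = c *\<^sub>R (complex_of_real (exp (- pi * x\<^sup>2)) * cis (2 * pi * (s * x)))" for x
  proof -
    have "iexp (t * (0 + (1 / c) * x)) = cis (2 * pi * (s * x))"
      using c by (simp add: cis_conv_exp t_def mult_ac)
    moreover have "std_normal_density (0 + (1 / c) * x) = c * exp (- pi * x\<^sup>2)"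
      by (simp add: std_normal_density_def power_divide c c_def[symmetric] power_mult_distrib)
    ultimately show ?thesis by (simp add: scaleR_conv_of_real)
  qed
  ultimately have "has_bochner_integral lborel (\<lambda>x. c *\<^sub>R (complex_of_real (exp (- pi * x\<^sup>2)) * cis (2 * pi * (s * x)))) (c *\<^sub>R complex_of_real (exp (- pi * s\<^sup>2)))"
    using c by (simp add: t scaleR_conv_of_real)
  then have "has_bochner_integral lborel (\<lambda>x. (1/c) *\<^sub>R (c *\<^sub>R (complex_of_real (exp (- pi * x\<^sup>2)) * cis (2 * pi * (s * x))))) ((1/c) *\<^sub>R (c *\<^sub>R complex_of_real (exp (- pi * s\<^sup>2))))"
    by (rule has_bochner_integral_scaleR_right)
  then have "has_bochner_integral lborel (\<lambda>x. complex_of_real (exp (- pi * x\<^sup>2)) * cis (2 * pi * (s * x))) (complex_of_real (exp (- pi * s\<^sup>2)))"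
    using c by simp
  then show "integrable lborel (\<lambda>x. complex_of_real (exp (- pi * x\<^sup>2)) * cis (2 * pi * (s * x)))"
    "(\<integral>x. complex_of_real (exp (- pi * x\<^sup>2)) * cis (2 * pi * (s * x)) \<partial>lborel) = complex_of_real (exp (- pi * s\<^sup>2))"
    by (simp_all add: has_bochner_integral_iff)
qed

lemma cis_sum: "cis (\<Sum>i\<in>A. f i) = (\<Prod>i\<in>A. cis (f i))"
  by (induction A rule: infinite_finite_induct) (auto simp: cis_mult[symmetric])

lemma gauss_fourier:
  fixes s :: "real^'n::finite"
  shows "integrable lborel (\<lambda>x. complex_of_real (gauss x) * cis (2 * pi * (s \<bullet> x)))"
    "(\<integral>x. complex_of_real (gauss x) * cis (2 * pi * (s \<bullet> x)) \<partial>lborel) = complex_of_real (gauss s)"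
proof -
  have eq: "complex_of_real (gauss x) * cis (2 * pi * (s \<bullet> x))
     = (\<Prod>i\<in>UNIV. complex_of_real (exp (- pi * (x $ i)\<^sup>2)) * cis (2 * pi * (s $ i * x $ i)))" for x
    by (simp add: gauss_def inner_vec_def sum_distrib_left cis_sum prod.distrib)
  show "integrable lborel (\<lambda>x. complex_of_real (gauss x) * cis (2 * pi * (s \<bullet> x)))"
    unfolding eq by (intro lborel_integral_prod_cart gauss_1d)
  show "(\<integral>x. complex_of_real (gauss x) * cis (2 * pi * (s \<bullet> x)) \<partial>lborel) = complex_of_real (gauss s)"
    unfolding eq lborel_integral_prod_cart(2)[OF gauss_1d(1)] gauss_1d(2) by (simp add: gauss_def)
qed

lemma gauss_nonneg: "gauss x \<ge> 0" and gauss_le_1: "gauss x \<le> 1" and gauss_0: "gauss 0 = 1"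
  by (auto simp: gauss_def intro!: prod_nonneg prod_le_1)

lemma continuous_on_gauss [continuous_intros]: "continuous_on A f \<Longrightarrow> continuous_on A (\<lambda>x. gauss (f x))"
  unfolding gauss_def by (intro continuous_intros)

lemma borel_measurable_gauss [measurable]: "gauss \<in> borel_measurable borel"
  by (intro borel_measurable_continuous_onI continuous_intros)

section \<open>Inverse Fourier transforms of bump functions\<close>

lemma
  fixes t :: "real^'n::finite"
  assumes c: "c \<noteq> 0"
  shows nn_integral_affine_cart: "f \<in> borel_measurable borel \<Longrightarrow>
      (\<integral>\<^sup>+x. f x \<partial>lborel) = ennreal (\<bar>c\<bar> ^ CARD('n)) * (\<integral>\<^sup>+x. f (t + c *\<^sub>R x) \<partial>lborel)"
    and lborel_integral_affine_cart: "(F :: real^'n \<Rightarrow> complex) \<in> borel_measurable borel \<Longrightarrow>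
      (\<integral>x. F x \<partial>lborel) = (\<bar>c\<bar> ^ CARD('n)) *\<^sub>R (\<integral>x. F (t + c *\<^sub>R x) \<partial>lborel)"
proof -
  assume [measurable]: "f \<in> borel_measurable borel"
  show "(\<integral>\<^sup>+x. f x \<partial>lborel) = ennreal (\<bar>c\<bar> ^ CARD('n)) * (\<integral>\<^sup>+x. f (t + c *\<^sub>R x) \<partial>lborel)"
    by (subst lborel_affine[OF c, of t]) (simp add: nn_integral_density nn_integral_distr nn_integral_cmult)
next
  assume [measurable]: "F \<in> borel_measurable borel"
  show "(\<integral>x. F x \<partial>lborel) = (\<bar>c\<bar> ^ CARD('n)) *\<^sub>R (\<integral>x. F (t + c *\<^sub>R x) \<partial>lborel)"
    by (subst lborel_affine[OF c, of t]) (simp add: integral_density integral_distr)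
qed

lemma integrable_affine_cart:
  fixes t :: "real^'n::finite" and F :: "real^'n \<Rightarrow> complex"
  assumes c: "c \<noteq> 0" and F: "integrable lborel F"
  shows "integrable lborel (\<lambda>x. F (t + c *\<^sub>R x))"
proof -
  have [measurable]: "F \<in> borel_measurable borel" using F by auto
  have "(\<integral>\<^sup>+x. ennreal (norm (F x)) \<partial>lborel) = ennreal (\<bar>c\<bar> ^ CARD('n)) * (\<integral>\<^sup>+x. ennreal (norm (F (t + c *\<^sub>R x))) \<partial>lborel)"
    by (rule nn_integral_affine_cart[OF c]) measurable
  then have "(\<integral>\<^sup>+x. ennreal (norm (F (t + c *\<^sub>R x))) \<partial>lborel) < \<infinity>"
    using F c by (auto simp: integrable_iff_bounded ennreal_mult_less_top)
  then show ?thesis by (auto intro: integrableI_bounded)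
qed

section \<open>Decay and differentiability of inverse transforms\<close>

definition ift :: "(real^'n::finite \<Rightarrow> real) \<Rightarrow> real^'n \<Rightarrow> complex" where
  "ift g z = (\<integral>\<xi>. complex_of_real (g \<xi>) * cis (2 * pi * (z \<bullet> \<xi>)) \<partial>lborel)"

definition fdiff :: "'a::real_vector \<Rightarrow> ('a \<Rightarrow> real) \<Rightarrow> 'a \<Rightarrow> real" where
  "fdiff v g \<xi> = g (\<xi> + v) - g \<xi>"

text \<open>G lists the iterated derivatives of \<open>G 0\<close> in the single direction i. Pure
  derivatives suffice because decay is proved one coordinate at a time. The radius 2 is that of the
  supports of \<open>\<rho>\<close> and \<open>low_cutoff \<rho>\<close>.\<close>

definition deriv_family :: "'n::finite \<Rightarrow> (nat \<Rightarrow> real^'n \<Rightarrow> real) \<Rightarrow> bool" where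
  "deriv_family i G \<longleftrightarrow>
     (\<forall>k \<xi>. ((\<lambda>s. G k (\<xi> + s *\<^sub>R axis i 1)) has_real_derivative G (Suc k) \<xi>) (at 0)) \<and>
     (\<forall>k. \<exists>B. \<forall>\<xi>. \<bar>G k \<xi>\<bar> \<le> B) \<and> (\<forall>k \<xi>. 2 < norm \<xi> \<longrightarrow> G k \<xi> = 0)"

definition bump :: "(real^'n::finite \<Rightarrow> real) \<Rightarrow> bool" where
  "bump g \<longleftrightarrow> continuous_on UNIV g \<and> (\<forall>i. \<exists>G. G 0 = g \<and> deriv_family i G)"

lemma bump_bounded:
  assumes "bump g" obtains B where "B \<ge> 0" "\<And>\<xi>. \<bar>g \<xi>\<bar> \<le> B"
proof -
  obtain G where "G 0 = g" "deriv_family undefined G" using assms by (auto simp: bump_def)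
  then obtain B where B: "\<And>\<xi>. \<bar>g \<xi>\<bar> \<le> B" unfolding deriv_family_def by metis
  moreover have "B \<ge> 0" using B[of 0] by linarith
  ultimately show ?thesis using that by blast
qed

lemma bump_support: "bump g \<Longrightarrow> 2 < norm \<xi> \<Longrightarrow> g \<xi> = 0"
  unfolding bump_def deriv_family_def by metis

lemma bump_measurable: "bump g \<Longrightarrow> g \<in> borel_measurable borel"
  by (auto simp: bump_def intro: borel_measurable_continuous_onI)

lemma integrable_bounded_support:
  fixes h :: "real^'n::finite \<Rightarrow> 'b::{banach, second_countable_topology}"
  assumes "h \<in> borel_measurable borel" "\<And>\<xi>. norm (h \<xi>) \<le> B" "\<And>\<xi>. R < norm \<xi> \<Longrightarrow> h \<xi> = 0"
  shows "integrable lborel h" and "(\<integral>\<xi>. norm (h \<xi>) \<partial>lborel) \<le> B * measure lborel (cball (0 :: real^'n) R)"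
proof -
  have fin: "emeasure lborel (cball (0 :: real^'n) R) < \<infinity>"
    by (rule emeasure_bounded_finite) simp
  then have int: "integrable lborel (\<lambda>\<xi>. B * indicator (cball (0 :: real^'n) R) \<xi>)" by simp
  have le: "norm (h \<xi>) \<le> B * indicator (cball 0 R) \<xi>" for \<xi>
    using assms(2,3)[of \<xi>] by (cases "\<xi> \<in> cball 0 R") auto
  have le': "norm (h \<xi>) \<le> norm (B * indicator (cball 0 R) \<xi> :: real)" for \<xi>
    using le[of \<xi>] by simp
  show h: "integrable lborel h"
    by (rule Bochner_Integration.integrable_bound[OF int]) (use assms(1) le' in auto)
  have "(\<integral>\<xi>. norm (h \<xi>) \<partial>lborel) \<le> (\<integral>\<xi>. B * indicator (cball (0 :: real^'n) R) \<xi> \<partial>lborel)"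
    using h int le by (intro integral_mono) auto
  also have "\<dots> = B * measure lborel (cball (0 :: real^'n) R)" by simp
  finally show "(\<integral>\<xi>. norm (h \<xi>) \<partial>lborel) \<le> B * measure lborel (cball (0 :: real^'n) R)" .
qed

lemma norm_ift_le: "norm (ift g z) \<le> (\<integral>\<xi>. norm (g \<xi>) \<partial>lborel)"
proof -
  have "norm (ift g z) \<le> (\<integral>\<xi>. norm (complex_of_real (g \<xi>) * cis (2 * pi * (z \<bullet> \<xi>))) \<partial>lborel)"
    unfolding ift_def by (rule integral_norm_bound)
  then show ?thesis by (simp add: norm_mult)
qed

lemma integrable_ift_integrand:
  assumes "integrable lborel g"
  shows "integrable lborel (\<lambda>\<xi>. complex_of_real (g \<xi>) * cis (2 * pi * (z \<bullet> \<xi>)))"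
proof -
  have [measurable]: "g \<in> borel_measurable borel" using assms by auto
  have [measurable]: "(\<lambda>\<xi>. cis (2 * pi * (z \<bullet> \<xi>))) \<in> borel_measurable borel"
    by (intro borel_measurable_continuous_onI continuous_intros)
  show ?thesis
    by (rule Bochner_Integration.integrable_bound[OF assms]) (auto simp: norm_mult)
qed

text \<open>Translation invariance of Lebesgue measure turns the translation by v into a
  modulation.\<close>

lemma ift_fdiff:
  assumes g: "integrable lborel g"
  shows "integrable lborel (fdiff v g)" "ift (fdiff v g) z = (cis (- (2 * pi * (z \<bullet> v))) - 1) * ift g z"
proof -
  let ?h = "\<lambda>\<xi>. complex_of_real (g \<xi>) * cis (2 * pi * (z \<bullet> \<xi>))"
  have [measurable]: "g \<in> borel_measurable borel" using g by auto
  have int_c: "integrable lborel (\<lambda>\<xi>. complex_of_real (g (v + 1 *\<^sub>R \<xi>)))"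
    using g by (intro integrable_affine_cart) auto
  then have gv: "integrable lborel (\<lambda>\<xi>. g (\<xi> + v))"
    by (simp add: complex_of_real_integrable_eq add.commute)
  have "fdiff v g = (\<lambda>\<xi>. g (\<xi> + v) - g \<xi>)" by (auto simp: fdiff_def)
  then show "integrable lborel (fdiff v g)" using g gv by simp
  have int_h: "integrable lborel ?h" by (rule integrable_ift_integrand[OF g])
  have eq: "complex_of_real (g (\<xi> + v)) * cis (2 * pi * (z \<bullet> \<xi>)) = cis (- (2 * pi * (z \<bullet> v))) * ?h (v + 1 *\<^sub>R \<xi>)" for \<xi>
  proof -
    have "cis (2 * pi * (z \<bullet> \<xi>)) = cis (- (2 * pi * (z \<bullet> v))) * cis (2 * pi * (z \<bullet> (v + 1 *\<^sub>R \<xi>)))"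
      unfolding cis_mult by (simp add: inner_add_right algebra_simps)
    then show ?thesis by (simp add: add.commute)
  qed
  have "ift (fdiff v g) z = (\<integral>\<xi>. complex_of_real (g (\<xi> + v)) * cis (2 * pi * (z \<bullet> \<xi>)) - ?h \<xi> \<partial>lborel)"
    unfolding ift_def fdiff_def by (intro Bochner_Integration.integral_cong) (auto simp: algebra_simps)
  also have "\<dots> = (\<integral>\<xi>. complex_of_real (g (\<xi> + v)) * cis (2 * pi * (z \<bullet> \<xi>)) \<partial>lborel) - ift g z"
    unfolding ift_def by (intro Bochner_Integration.integral_diff integrable_ift_integrand gv g)
  also have "(\<integral>\<xi>. complex_of_real (g (\<xi> + v)) * cis (2 * pi * (z \<bullet> \<xi>)) \<partial>lborel)
     = cis (- (2 * pi * (z \<bullet> v))) * (\<integral>\<xi>. ?h (v + 1 *\<^sub>R \<xi>) \<partial>lborel)"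
    unfolding eq by simp
  also have "(\<integral>\<xi>. ?h (v + 1 *\<^sub>R \<xi>) \<partial>lborel) = ift g z"
    using lborel_integral_affine_cart[of 1 ?h v] int_h by (auto simp: ift_def)
  finally show "ift (fdiff v g) z = (cis (- (2 * pi * (z \<bullet> v))) - 1) * ift g z"
    by (simp add: algebra_simps)
qed

lemma ift_fdiff_pow:
  assumes g: "integrable lborel g"
  shows "integrable lborel ((fdiff v ^^ n) g) \<and> ift ((fdiff v ^^ n) g) z = (cis (- (2 * pi * (z \<bullet> v))) - 1) ^ n * ift g z"
  by (induction n) (auto simp: g ift_fdiff)

lemma deriv_family_fdiff:
  assumes "deriv_family i G"
  shows "((\<lambda>s. (fdiff v ^^ k) (G j) (\<xi> + s *\<^sub>R axis i 1)) has_real_derivative (fdiff v ^^ k) (G (Suc j)) \<xi>) (at 0)"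
proof (induction k arbitrary: \<xi>)
  case 0
  then show ?case using assms by (auto simp: deriv_family_def)
next
  case (Suc k)
  have "((\<lambda>s. (fdiff v ^^ k) (G j) (\<xi> + v + s *\<^sub>R axis i 1) - (fdiff v ^^ k) (G j) (\<xi> + s *\<^sub>R axis i 1))
     has_real_derivative (fdiff v ^^ k) (G (Suc j)) (\<xi> + v) - (fdiff v ^^ k) (G (Suc j)) \<xi>) (at 0)"
    by (intro DERIV_diff Suc)
  then show ?case
    by (simp add: fdiff_def[of v "(fdiff v ^^ k) (G j)"] fdiff_def[of v "(fdiff v ^^ k) (G (Suc j))"] add_ac)
qed

text \<open>By the mean value inequality one difference with step t costs a factor |t| and one more
  derivative; the induction therefore moves from \<open>G j\<close> to
  \<open>G (Suc j)\<close>.\<close>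

lemma fdiff_pow_bound:
  assumes "deriv_family i G" "\<And>\<xi>. \<bar>G (j + k) \<xi>\<bar> \<le> B"
  shows "\<bar>(fdiff (t *\<^sub>R axis i 1) ^^ k) (G j) \<xi>\<bar> \<le> \<bar>t\<bar> ^ k * B"
  using assms(2)
proof (induction k arbitrary: \<xi> j)
  case 0
  then show ?case by simp
next
  case (Suc k)
  let ?v = "t *\<^sub>R axis i (1::real)"
  define F where "F = (fdiff ?v ^^ k) (G j)"
  define F' where "F' = (fdiff ?v ^^ k) (G (Suc j))"
  have D: "((\<lambda>s. F (\<xi> + s *\<^sub>R axis i 1)) has_real_derivative F' (\<xi> + s *\<^sub>R axis i 1)) (at s within UNIV)" for s
  proof -
    have "((\<lambda>r. F (\<xi> + s *\<^sub>R axis i 1 + r *\<^sub>R axis i 1)) has_real_derivative F' (\<xi> + s *\<^sub>R axis i 1)) (at 0)"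
      unfolding F_def F'_def by (rule deriv_family_fdiff[OF assms(1)])
    then have "((\<lambda>r. F (\<xi> + (r + s) *\<^sub>R axis i 1)) has_real_derivative F' (\<xi> + s *\<^sub>R axis i 1)) (at 0)"
      by (simp add: scaleR_left_distrib add_ac)
    then show ?thesis using DERIV_shift[of "\<lambda>r. F (\<xi> + r *\<^sub>R axis i 1)" _ 0 s] by simp
  qed
  have B: "norm (F' (\<xi> + s *\<^sub>R axis i 1)) \<le> \<bar>t\<bar> ^ k * B" for s
    unfolding F'_def real_norm_def by (rule Suc.IH) (use Suc.prems in simp)
  have "norm (F (\<xi> + t *\<^sub>R axis i 1) - F (\<xi> + 0 *\<^sub>R axis i 1)) \<le> (\<bar>t\<bar> ^ k * B) * norm (t - 0)"
    by (rule field_differentiable_bound[OF convex_UNIV D B]) auto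
  then show ?case by (simp add: fdiff_def[of ?v "F"] F_def[symmetric] mult_ac)
qed

lemma fdiff_pow_support:
  assumes "\<And>\<xi>. R < norm \<xi> \<Longrightarrow> g \<xi> = 0"
  shows "R + real k * norm v < norm \<xi> \<Longrightarrow> (fdiff v ^^ k) g \<xi> = 0"
proof (induction k arbitrary: \<xi>)
  case 0
  then show ?case using assms by simp
next
  case (Suc k)
  have e: "real (Suc k) * norm v = real k * norm v + norm v" by (simp add: algebra_simps)
  have "norm \<xi> \<le> norm (\<xi> + v) + norm v" using norm_triangle_ineq4[of "\<xi> + v" v] by simp
  then have "R + real k * norm v < norm (\<xi> + v)" using Suc.prems unfolding e by linarith
  moreover have "R + real k * norm v < norm \<xi>" using Suc.prems norm_ge_zero[of v] unfolding e by linarith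
  ultimately show ?case using Suc.IH by (simp add: fdiff_def)
qed

lemma bump_integrable: "bump g \<Longrightarrow> integrable lborel g"
proof -
  assume g: "bump g"
  then obtain B where "\<And>\<xi>. \<bar>g \<xi>\<bar> \<le> B" using bump_bounded by metis
  then show ?thesis
    using bump_measurable[OF g] bump_support[OF g] by (intro integrable_bounded_support(1)[of _ B 2]) auto
qed

text \<open>A difference with step \<open>1 / (2 z\<^sub>i)\<close> in direction \<open>i\<close> multiplies the transform at \<open>z\<close> by -2, so that
  finite differences replace integration by parts.\<close>

lemma ift_coord_decay:
  fixes g :: "real^'n::finite \<Rightarrow> real"
  assumes "bump g"
  shows "\<exists>C\<ge>0. \<forall>z. 1 \<le> \<bar>z $ i\<bar> \<longrightarrow> \<bar>z $ i\<bar> ^ n * norm (ift g z) \<le> C"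
proof -
  obtain G where G: "G 0 = g" "deriv_family i G" using assms by (auto simp: bump_def)
  obtain B where B: "\<And>\<xi>. \<bar>G n \<xi>\<bar> \<le> B" using G(2) unfolding deriv_family_def by metis
  have "B \<ge> 0" using B[of 0] by linarith
  define C where "C = B * measure lborel (cball (0 :: real^'n) (2 + real n))"
  have "\<bar>z $ i\<bar> ^ n * norm (ift g z) \<le> C" if z: "1 \<le> \<bar>z $ i\<bar>" for z
  proof -
    define t where "t = 1 / (2 * z $ i)"
    have t: "\<bar>t\<bar> \<le> 1" "t * z $ i = 1 / 2" using z by (auto simp: t_def abs_mult)
    define h where "h = (fdiff (t *\<^sub>R axis i 1) ^^ n) g"
    have e: "2 * pi * (z \<bullet> (t *\<^sub>R axis i 1)) = pi" using t by (simp add: inner_axis)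
    have c2: "cis (- (2 * pi * (z \<bullet> (t *\<^sub>R axis i 1)))) - 1 = -2"
      unfolding e by (simp add: complex_eq_iff)
    have h: "integrable lborel h" "ift h z = (-2) ^ n * ift g z"
      using ift_fdiff_pow[OF bump_integrable[OF assms], where v = "t *\<^sub>R axis i 1" and n = n and z = z]
      unfolding c2 by (simp_all only: h_def)
    have hb: "norm (h \<xi>) \<le> \<bar>t\<bar> ^ n * B" for \<xi>
      unfolding h_def G(1)[symmetric] real_norm_def by (rule fdiff_pow_bound[OF G(2)]) (simp add: B)
    \<comment> \<open>Since |t| is at most 1, n differences enlarge the support by at most n. The
      radius 2 + n, and with it the constant C, does not depend on z.\<close>
    have hs: "h \<xi> = 0" if "2 + real n < norm \<xi>" for \<xi>
    proof -
      have "norm (t *\<^sub>R axis i (1::real) :: real^'n) \<le> 1" using t by simp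
      then have "real n * norm (t *\<^sub>R axis i (1::real) :: real^'n) \<le> real n" using mult_left_mono by fastforce
      then show ?thesis
        unfolding h_def using that by (intro fdiff_pow_support[where R = 2] bump_support[OF assms]) auto
    qed
    have "norm (ift h z) \<le> \<bar>t\<bar> ^ n * B * measure lborel (cball (0 :: real^'n) (2 + real n))"
      by (rule order_trans[OF norm_ift_le integrable_bounded_support(2)]) (use h(1) hb hs in auto)
    then have "2 ^ n * norm (ift g z) \<le> \<bar>t\<bar> ^ n * C"
      by (simp add: h(2) norm_mult norm_power C_def mult_ac)
    then have "\<bar>z $ i\<bar> ^ n * (2 ^ n * norm (ift g z)) \<le> \<bar>z $ i\<bar> ^ n * (\<bar>t\<bar> ^ n * C)"
      by (rule mult_left_mono) simp
    also have "\<bar>z $ i\<bar> ^ n * (\<bar>t\<bar> ^ n * C) = \<bar>t * z $ i\<bar> ^ n * C"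
      by (simp add: power_mult_distrib abs_mult mult_ac)
    also have "\<dots> \<le> 1 * C"
      unfolding t using \<open>B \<ge> 0\<close> by (intro mult_right_mono) (auto simp: C_def power_le_one)
    finally have "2 ^ n * (\<bar>z $ i\<bar> ^ n * norm (ift g z)) \<le> C" by (simp add: mult_ac)
    moreover have "1 * (\<bar>z $ i\<bar> ^ n * norm (ift g z)) \<le> 2 ^ n * (\<bar>z $ i\<bar> ^ n * norm (ift g z))"
      by (intro mult_right_mono) auto
    ultimately show ?thesis by linarith
  qed
  moreover have "C \<ge> 0" using \<open>B \<ge> 0\<close> by (simp add: C_def)
  ultimately show ?thesis by blast
qed

text \<open>For |z| at most d the L1 norm of g is bound enough. For larger z some coordinate has
  modulus at least |z| / d, which exceeds 1, and \<open>ift_coord_decay\<close> applies in that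
  direction.\<close>

lemma ift_decay:
  fixes g :: "real^'n::finite \<Rightarrow> real"
  assumes "bump g"
  shows "\<exists>C>0. \<forall>z. norm (ift g z) \<le> C / (1 + norm z) ^ n"
proof -
  define d where "d = real CARD('n)"
  have d: "d \<ge> 1" using zero_less_card_finite[where 'a='n] unfolding d_def by linarith
  obtain A where A: "\<And>i. A i \<ge> 0" "\<And>i z. 1 \<le> \<bar>z $ i\<bar> \<Longrightarrow> \<bar>z $ i\<bar> ^ n * norm (ift g z) \<le> A i"
    using ift_coord_decay[OF assms, of _ n] by metis
  define I where "I = (\<integral>\<xi>. norm (g \<xi>) \<partial>lborel)"
  have I: "I \<ge> 0" by (simp add: I_def)
  \<comment> \<open>One summand for each range of z; the final 1 makes C positive.\<close>
  define C where "C = (1 + d) ^ n * I + (2 * d) ^ n * (\<Sum>i\<in>UNIV. A i) + 1"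
  have nonneg: "(1 + d) ^ n * I \<ge> 0" "(2 * d) ^ n * (\<Sum>i\<in>UNIV. A i) \<ge> 0"
    using d I A(1) by (auto intro!: mult_nonneg_nonneg sum_nonneg)
  have "(1 + norm z) ^ n * norm (ift g z) \<le> C" for z
  proof (cases "norm z \<le> d")
    case True
    have "(1 + norm z) ^ n * norm (ift g z) \<le> (1 + d) ^ n * I"
      using True norm_ift_le[of g z] d by (intro mult_mono power_mono) (auto simp: I_def)
    then show ?thesis using nonneg by (simp add: C_def)
  next
    case False
    have "\<exists>i. norm z / d \<le> \<bar>z $ i\<bar>"
    proof (rule ccontr)
      assume "\<nexists>i. norm z / d \<le> \<bar>z $ i\<bar>"
      then have "(\<Sum>i\<in>UNIV. \<bar>z $ i\<bar>) < (\<Sum>i\<in>(UNIV :: 'n set). norm z / d)"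
        by (intro sum_strict_mono) (auto simp: not_le)
      also have "\<dots> = norm z" using d by (simp add: d_def)
      finally show False using norm_le_l1_cart[of z] by linarith
    qed
    then obtain i where i: "norm z / d \<le> \<bar>z $ i\<bar>" by blast
    have "1 \<le> norm z / d" using False d by simp
    then have zi: "1 \<le> \<bar>z $ i\<bar>" using i by linarith
    have "1 + norm z \<le> 2 * norm z" using False d by simp
    also have "norm z \<le> d * \<bar>z $ i\<bar>" using i d by (simp add: field_simps)
    finally have "1 + norm z \<le> 2 * d * \<bar>z $ i\<bar>" by simp
    then have "(1 + norm z) ^ n * norm (ift g z) \<le> (2 * d * \<bar>z $ i\<bar>) ^ n * norm (ift g z)"
      by (intro mult_right_mono power_mono) auto
    also have "\<dots> = (2 * d) ^ n * (\<bar>z $ i\<bar> ^ n * norm (ift g z))" by (simp add: power_mult_distrib)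
    also have "\<dots> \<le> (2 * d) ^ n * A i" using A(2)[OF zi] d by (intro mult_left_mono) auto
    also have "\<dots> \<le> (2 * d) ^ n * (\<Sum>i\<in>UNIV. A i)"
      using d A(1) by (intro mult_left_mono member_le_sum) auto
    finally show ?thesis using nonneg by (simp add: C_def)
  qed
  then have "norm (ift g z) \<le> C / (1 + norm z) ^ n" for z
    by (subst pos_le_divide_eq) (auto simp: mult.commute add_pos_nonneg)
  moreover have "C > 0" using nonneg by (simp add: C_def)
  ultimately show ?thesis by blast
qed

text \<open>The derivatives of \<open>ift g\<close> are inverse transforms of coordinate multiples
  of g, so the decay estimate must apply to these as well.\<close>

lemma bump_coord_mult:
  fixes g :: "real^'n::finite \<Rightarrow> real"
  assumes "bump g"
  shows "bump (\<lambda>\<xi>. \<xi> $ j * g \<xi>)"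
  unfolding bump_def
proof (intro conjI allI)
  show "continuous_on UNIV (\<lambda>\<xi>. \<xi> $ j * g \<xi>)"
    using assms by (auto simp: bump_def intro!: continuous_intros)
  fix i
  obtain G where G: "G 0 = g" "deriv_family i G" using assms by (auto simp: bump_def)
  define e where "e = (if i = j then 1 else 0 :: real)"
  \<comment> \<open>Leibniz' rule: the coordinate has derivative e in direction i and vanishing
    higher derivatives, so only two terms survive.\<close>
  define H where "H k \<xi> = \<xi> $ j * G k \<xi> + (case k of 0 \<Rightarrow> 0 | Suc l \<Rightarrow> real k * e * G l \<xi>)" for k \<xi>
  have ax: "(axis i 1 :: real^'n) $ j = e" by (simp add: e_def axis_def)
  have "deriv_family i H"
    unfolding deriv_family_def
  proof (intro conjI allI impI)
    have D: "((\<lambda>s. G k (\<xi> + s *\<^sub>R axis i 1)) has_real_derivative G (Suc k) \<xi>) (at 0)" for k \<xi>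
      using G(2) by (auto simp: deriv_family_def)
    fix k \<xi>
    have "((\<lambda>s. (\<xi> $ j + s * e) * G k (\<xi> + s *\<^sub>R axis i 1)) has_real_derivative
        (\<xi> $ j + 0 * e) * G (Suc k) \<xi> + e * G k (\<xi> + 0 *\<^sub>R axis i 1)) (at 0)"
      by (auto intro!: derivative_eq_intros D)
    then have D1: "((\<lambda>s. (\<xi> + s *\<^sub>R axis i 1) $ j * G k (\<xi> + s *\<^sub>R axis i 1)) has_real_derivative
        \<xi> $ j * G (Suc k) \<xi> + e * G k \<xi>) (at 0)"
      by (simp add: ax)
    show "((\<lambda>s. H k (\<xi> + s *\<^sub>R axis i 1)) has_real_derivative H (Suc k) \<xi>) (at 0)"
    proof (cases k)
      case 0
      then show ?thesis using D1 by (simp add: H_def)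
    next
      case (Suc l)
      have "((\<lambda>s. (\<xi> + s *\<^sub>R axis i 1) $ j * G k (\<xi> + s *\<^sub>R axis i 1) + real k * e * G l (\<xi> + s *\<^sub>R axis i 1))
         has_real_derivative (\<xi> $ j * G (Suc k) \<xi> + e * G k \<xi>) + real k * e * G k \<xi>) (at 0)"
        using D[of l \<xi>] Suc by (intro DERIV_add D1 DERIV_cmult) simp
      then show ?thesis by (simp add: H_def Suc algebra_simps)
    qed
  next
    fix k \<xi> assume "2 < norm (\<xi> :: real^'n)"
    then have "G l \<xi> = 0" for l using G(2) by (auto simp: deriv_family_def)
    then show "H k \<xi> = 0" by (simp add: H_def split: nat.split)
  next
    fix k
    have "\<exists>B. \<forall>\<xi>. \<bar>G l \<xi>\<bar> \<le> B" for l using G(2) by (auto simp: deriv_family_def)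
    then obtain A where A: "\<And>l \<xi>. \<bar>G l \<xi>\<bar> \<le> A l" by metis
    have A0: "A l \<ge> 0" for l using A[of l 0] by linarith
    have 1: "\<bar>\<xi> $ j * G k \<xi>\<bar> \<le> 2 * A k" for \<xi> :: "real^'n"
    proof (cases "2 < norm \<xi>")
      case True
      then have "G k \<xi> = 0" using G(2) by (auto simp: deriv_family_def)
      then show ?thesis using A0[of k] by simp
    next
      case False
      then have "\<bar>\<xi> $ j\<bar> \<le> 2" using component_le_norm_cart[of \<xi> j] by linarith
      then show ?thesis using A[of k \<xi>] A0[of k] unfolding abs_mult by (intro mult_mono) auto
    qed
    show "\<exists>B. \<forall>\<xi>. \<bar>H k \<xi>\<bar> \<le> B"
    proof (cases k)
      case 0
      then show ?thesis using 1 by (auto simp: H_def intro!: exI[of _ "2 * A k"])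
    next
      case (Suc l)
      have "\<bar>real k * e * G l \<xi>\<bar> \<le> real k * 1 * A l" for \<xi>
        unfolding abs_mult using A by (intro mult_mono) (auto simp: e_def)
      moreover have "H k \<xi> = \<xi> $ j * G k \<xi> + real k * e * G l \<xi>" for \<xi> by (simp add: H_def Suc)
      ultimately have "\<bar>H k \<xi>\<bar> \<le> 2 * A k + real k * 1 * A l" for \<xi>
        using 1 by (metis abs_triangle_ineq add_mono order_trans)
      then show ?thesis by blast
    qed
  qed
  then show "\<exists>G. G 0 = (\<lambda>\<xi>. \<xi> $ j * g \<xi>) \<and> deriv_family i G"
    by (intro exI[of _ H]) (auto simp: H_def G(1))
qed

lemma cis_quadratic: "norm (cis x - 1 - \<i> * complex_of_real x) \<le> x\<^sup>2 / 2"
  using iexp_approx1[of x 1] by (simp add: cis_conv_exp power2_eq_square diff_diff_eq)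

text \<open>Differentiation under the integral by an explicit remainder: g vanishes outside radius
  2, so the phase changes by at most 4 pi |h| |s - t|, and the second-order bound for
  \<open>cis\<close> leaves an error of order (s - t)^2.\<close>

lemma ift_line_derivative:
  fixes g :: "real^'n::finite \<Rightarrow> real"
  assumes "bump g"
  shows "((\<lambda>s. ift g (z + s *\<^sub>R h)) has_vector_derivative
      (\<Sum>j\<in>UNIV. (2 * pi * h $ j) *\<^sub>R (\<i> * ift (\<lambda>\<xi>. \<xi> $ j * g \<xi>) (z + t *\<^sub>R h)))) (at t)"
proof -
  define D where "D = (\<Sum>j\<in>UNIV. (2 * pi * h $ j) *\<^sub>R (\<i> * ift (\<lambda>\<xi>. \<xi> $ j * g \<xi>) (z + t *\<^sub>R h)))"
  define I where "I = (\<integral>\<xi>. norm (g \<xi>) \<partial>lborel)"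
  define C where "C = (4 * pi * norm h)\<^sup>2 / 2 * I"
  let ?e = "\<lambda>\<xi>. complex_of_real (g \<xi>) * cis (2 * pi * ((z + t *\<^sub>R h) \<bullet> \<xi>))"
  have int_g: "integrable lborel g" by (rule bump_integrable[OF assms])
  have int_j: "integrable lborel (\<lambda>\<xi>. complex_of_real (\<xi> $ j * g \<xi>) * cis (2 * pi * (w \<bullet> \<xi>)))" for j w
    by (intro integrable_ift_integrand bump_integrable bump_coord_mult assms)
  have int_e: "integrable lborel (\<lambda>\<xi>. complex_of_real (g \<xi>) * cis (2 * pi * (w \<bullet> \<xi>)))" for w
    by (intro integrable_ift_integrand int_g)
  have D_int: "integrable lborel (\<lambda>\<xi>. \<i> * complex_of_real (2 * pi * (h \<bullet> \<xi>)) * ?e \<xi>)"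
    "D = (\<integral>\<xi>. \<i> * complex_of_real (2 * pi * (h \<bullet> \<xi>)) * ?e \<xi> \<partial>lborel)"
  proof -
    have eq: "\<i> * complex_of_real (2 * pi * (h \<bullet> \<xi>)) * ?e \<xi> =
       (\<Sum>j\<in>UNIV. (2 * pi * h $ j) *\<^sub>R (\<i> * (complex_of_real (\<xi> $ j * g \<xi>) * cis (2 * pi * ((z + t *\<^sub>R h) \<bullet> \<xi>)))))" for \<xi>
      by (simp add: inner_vec_def sum_distrib_left sum_distrib_right scaleR_conv_of_real mult_ac)
    show "integrable lborel (\<lambda>\<xi>. \<i> * complex_of_real (2 * pi * (h \<bullet> \<xi>)) * ?e \<xi>)"
      unfolding eq by (intro Bochner_Integration.integrable_sum integrable_scaleR_right integrable_mult_right int_j)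
    show "D = (\<integral>\<xi>. \<i> * complex_of_real (2 * pi * (h \<bullet> \<xi>)) * ?e \<xi> \<partial>lborel)"
      unfolding eq D_def ift_def
      by (subst Bochner_Integration.integral_sum, intro integrable_scaleR_right integrable_mult_right int_j, simp)
  qed
  have quad: "norm (ift g (z + s *\<^sub>R h) - ift g (z + t *\<^sub>R h) - (s - t) *\<^sub>R D) \<le> C * (s - t)\<^sup>2" for s
  proof -
    let ?f = "\<lambda>\<xi>. complex_of_real (g \<xi>) * cis (2 * pi * ((z + s *\<^sub>R h) \<bullet> \<xi>)) - ?e \<xi> - (s - t) *\<^sub>R (\<i> * complex_of_real (2 * pi * (h \<bullet> \<xi>)) * ?e \<xi>)"
    have eq: "ift g (z + s *\<^sub>R h) - ift g (z + t *\<^sub>R h) - (s - t) *\<^sub>R D = (\<integral>\<xi>. ?f \<xi> \<partial>lborel)"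
      unfolding ift_def D_int(2) using int_e D_int(1) by simp
    have le: "norm (\<integral>\<xi>. ?f \<xi> \<partial>lborel) \<le> (\<integral>\<xi>. (4 * pi * norm h)\<^sup>2 / 2 * (s - t)\<^sup>2 * norm (g \<xi>) \<partial>lborel)"
    proof (rule Bochner_Integration.integral_norm_bound_integral)
      show "integrable lborel ?f"
        by (intro Bochner_Integration.integrable_diff int_e integrable_scaleR_right D_int(1))
      show "integrable lborel (\<lambda>\<xi>. (4 * pi * norm h)\<^sup>2 / 2 * (s - t)\<^sup>2 * norm (g \<xi>))"
        using int_g by simp
      fix \<xi>
      show "norm (?f \<xi>) \<le> (4 * pi * norm h)\<^sup>2 / 2 * (s - t)\<^sup>2 * norm (g \<xi>)"
      proof (cases "2 < norm \<xi>")
        case True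
        then show ?thesis using bump_support[OF assms] by simp
      next
        case False
        define x where "x = 2 * pi * ((s - t) * (h \<bullet> \<xi>))"
        have "cis (2 * pi * ((z + s *\<^sub>R h) \<bullet> \<xi>)) = cis (2 * pi * ((z + t *\<^sub>R h) \<bullet> \<xi>)) * cis x"
          unfolding cis_mult x_def by (simp add: inner_add_left algebra_simps)
        then have "?f \<xi> = ?e \<xi> * (cis x - 1 - \<i> * complex_of_real x)"
          by (simp add: x_def algebra_simps scaleR_conv_of_real)
        then have "norm (?f \<xi>) = norm (g \<xi>) * norm (cis x - 1 - \<i> * complex_of_real x)"
          by (simp add: norm_mult)
        also have "\<dots> \<le> norm (g \<xi>) * (x\<^sup>2 / 2)"
          by (intro mult_left_mono cis_quadratic) auto
        also have "\<dots> \<le> norm (g \<xi>) * (((4 * pi * norm h) * (s - t))\<^sup>2 / 2)"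
        proof (intro mult_left_mono divide_right_mono)
          have "\<bar>h \<bullet> \<xi>\<bar> \<le> norm h * 2"
            using False by (intro order_trans[OF Cauchy_Schwarz_ineq2] mult_left_mono) auto
          then have "\<bar>s - t\<bar> * \<bar>h \<bullet> \<xi>\<bar> \<le> \<bar>s - t\<bar> * (norm h * 2)" by (rule mult_left_mono) simp
          then have "2 * pi * (\<bar>s - t\<bar> * \<bar>h \<bullet> \<xi>\<bar>) \<le> 2 * pi * (\<bar>s - t\<bar> * (norm h * 2))"
            by (rule mult_left_mono) simp
          then have "\<bar>x\<bar> \<le> \<bar>(4 * pi * norm h) * (s - t)\<bar>"
            by (simp add: x_def abs_mult)
          then show "x\<^sup>2 \<le> ((4 * pi * norm h) * (s - t))\<^sup>2" by (simp add: abs_le_square_iff)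
        qed auto
        also have "norm (g \<xi>) * (((4 * pi * norm h) * (s - t))\<^sup>2 / 2) = (4 * pi * norm h)\<^sup>2 / 2 * (s - t)\<^sup>2 * norm (g \<xi>)"
          by (simp add: power_mult_distrib)
        finally show ?thesis .
      qed
    qed
    have C_eq: "(\<integral>\<xi>. (4 * pi * norm h)\<^sup>2 / 2 * (s - t)\<^sup>2 * norm (g \<xi>) \<partial>lborel) = C * (s - t)\<^sup>2"
      unfolding C_def I_def Bochner_Integration.integral_mult_right_zero by (simp only: mult_ac)
    show ?thesis using le unfolding C_eq eq .
  qed
  have "((\<lambda>s. ift g (z + s *\<^sub>R h)) has_derivative (\<lambda>r. r *\<^sub>R D)) (at t)"
  proof (rule has_derivativeI_sandwich[of 1 _ _ _ _ "\<lambda>s. C * \<bar>s - t\<bar>"])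
    show "bounded_linear (\<lambda>r. r *\<^sub>R D)" by (rule bounded_linear_scaleR_left)
    show "((\<lambda>s. C * \<bar>s - t\<bar>) \<longlongrightarrow> 0) (at t)"
      by (auto intro!: tendsto_eq_intros)
    fix s assume "s \<noteq> t"
    then have "norm (s - t) > 0" by simp
    then show "norm (ift g (z + s *\<^sub>R h) - ift g (z + t *\<^sub>R h) - (s - t) *\<^sub>R D) / norm (s - t) \<le> C * \<bar>s - t\<bar>"
      using quad[of s] by (simp add: pos_divide_le_eq power2_eq_square)
  qed simp
  then show ?thesis by (simp add: has_vector_derivative_def D_def)
qed

text \<open>Mean value inequality on the segment from z to z + h. The derivative decays at z + t h
  rather than at z; as |h| is at most H, the quantities 1 + |z| and 1 + |z + t h| differ by a factor
  of at most 1 + H, whence (1 + H) ^ n in the constant. For negative H the claim is vacuous.\<close>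

lemma ift_difference_decay:
  fixes g :: "real^'n::finite \<Rightarrow> real"
  assumes "bump g"
  shows "\<exists>C>0. \<forall>z h. norm h \<le> H \<longrightarrow> norm (ift g (z + h) - ift g z) \<le> C * norm h / (1 + norm z) ^ n"
proof (cases "H \<ge> 0")
  case False
  then have "\<not> norm h \<le> H" for h :: "real^'n" using norm_ge_zero[of h] by linarith
  then show ?thesis by (intro exI[of _ 1]) auto
next
  case True
  have "\<exists>C>0. \<forall>z. norm (ift (\<lambda>\<xi>. \<xi> $ j * g \<xi>) z) \<le> C / (1 + norm z) ^ n" for j
    by (intro ift_decay bump_coord_mult assms)
  then obtain A where A: "\<And>j. A j > 0" "\<And>j z. norm (ift (\<lambda>\<xi>. \<xi> $ j * g \<xi>) z) \<le> A j / (1 + norm z) ^ n"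
    by metis
  define C where "C = (1 + H) ^ n * (\<Sum>j\<in>UNIV. 2 * pi * A j)"
  have "C > 0" using A(1) True unfolding C_def by (intro mult_pos_pos sum_pos) auto
  moreover have "norm (ift g (z + h) - ift g z) \<le> C * norm h / (1 + norm z) ^ n" if h: "norm h \<le> H" for z h
  proof -
    define F where "F t = ift g (z + t *\<^sub>R h)" for t
    define D where "D t = (\<Sum>j\<in>UNIV. (2 * pi * h $ j) *\<^sub>R (\<i> * ift (\<lambda>\<xi>. \<xi> $ j * g \<xi>) (z + t *\<^sub>R h)))" for t
    have der: "(F has_derivative (\<lambda>r. r *\<^sub>R D t)) (at t within {0..1})" for t
      using ift_line_derivative[OF assms, of z h t] unfolding F_def D_def
      by (auto simp: has_vector_derivative_def intro: has_derivative_at_withinI)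
    have bound: "onorm (\<lambda>r. r *\<^sub>R D t) \<le> C * norm h / (1 + norm z) ^ n" if "t \<in> {0..1}" for t
    proof -
      have "norm (t *\<^sub>R h) \<le> H" using that h mult_left_le_one_le[of "norm h" t] by auto
      moreover have "norm z \<le> norm (z + t *\<^sub>R h) + norm (t *\<^sub>R h)"
        using norm_triangle_ineq4[of "z + t *\<^sub>R h" "t *\<^sub>R h"] by simp
      ultimately have "1 + norm z \<le> (1 + norm (z + t *\<^sub>R h)) + H" by linarith
      also have "\<dots> \<le> (1 + H) * (1 + norm (z + t *\<^sub>R h))" using True by (simp add: algebra_simps)
      finally have "(1 + norm z) ^ n \<le> (1 + H) ^ n * (1 + norm (z + t *\<^sub>R h)) ^ n"
        unfolding power_mult_distrib[symmetric] by (rule power_mono) auto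
      moreover have pos: "0 < (1 + norm w) ^ n" for w :: "real^'n" by (simp add: add_pos_nonneg)
      ultimately have w: "1 / (1 + norm (z + t *\<^sub>R h)) ^ n \<le> (1 + H) ^ n / (1 + norm z) ^ n"
        by (simp only: pos_le_divide_eq[OF pos] times_divide_eq_left mult_1 pos_divide_le_eq[OF pos])
      have "norm (D t) \<le> (\<Sum>j\<in>UNIV. 2 * pi * norm h * (A j * ((1 + H) ^ n / (1 + norm z) ^ n)))"
        unfolding D_def
      proof (rule sum_norm_le)
        fix j
        have "norm ((2 * pi * h $ j) *\<^sub>R (\<i> * ift (\<lambda>\<xi>. \<xi> $ j * g \<xi>) (z + t *\<^sub>R h)))
           = 2 * pi * \<bar>h $ j\<bar> * norm (ift (\<lambda>\<xi>. \<xi> $ j * g \<xi>) (z + t *\<^sub>R h))"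
          by (simp add: norm_mult abs_mult)
        also have "\<dots> \<le> 2 * pi * norm h * (A j * ((1 + H) ^ n / (1 + norm z) ^ n))"
        proof (intro mult_mono)
          show "\<bar>h $ j\<bar> \<le> norm h" by (rule component_le_norm_cart)
          have "norm (ift (\<lambda>\<xi>. \<xi> $ j * g \<xi>) (z + t *\<^sub>R h)) \<le> A j * (1 / (1 + norm (z + t *\<^sub>R h)) ^ n)"
            using A(2)[of j "z + t *\<^sub>R h"] by simp
          also have "\<dots> \<le> A j * ((1 + H) ^ n / (1 + norm z) ^ n)"
            using A(1)[of j] by (intro mult_left_mono w) auto
          finally show "norm (ift (\<lambda>\<xi>. \<xi> $ j * g \<xi>) (z + t *\<^sub>R h)) \<le> A j * ((1 + H) ^ n / (1 + norm z) ^ n)" .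
        qed auto
        finally show "norm ((2 * pi * h $ j) *\<^sub>R (\<i> * ift (\<lambda>\<xi>. \<xi> $ j * g \<xi>) (z + t *\<^sub>R h)))
           \<le> 2 * pi * norm h * (A j * ((1 + H) ^ n / (1 + norm z) ^ n))" .
      qed
      also have "\<dots> = C * norm h / (1 + norm z) ^ n"
        by (simp add: C_def sum_distrib_left sum_distrib_right sum_divide_distrib mult_ac)
      finally have D: "norm (D t) \<le> C * norm h / (1 + norm z) ^ n" .
      show ?thesis
      proof (rule onorm_le)
        fix r :: real
        have "norm (r *\<^sub>R D t) = norm (D t) * norm r" by simp
        also have "\<dots> \<le> C * norm h / (1 + norm z) ^ n * norm r" by (rule mult_right_mono[OF D]) simp
        finally show "norm (r *\<^sub>R D t) \<le> C * norm h / (1 + norm z) ^ n * norm r" .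
      qed
    qed
    have "norm (F 1 - F 0) \<le> C * norm h / (1 + norm z) ^ n * norm (1 - 0 :: real)"
      by (rule differentiable_bound[of "{0..1}" F "\<lambda>t r. r *\<^sub>R D t"]) (use der bound in auto)
    then show ?thesis by (simp add: F_def)
  qed
  ultimately show ?thesis by blast
qed

lemma borel_measurable_cis [measurable]: "cis \<in> borel_measurable borel"
  by (intro borel_measurable_continuous_onI continuous_intros)

lemma continuous_on_ift:
  assumes "bump g"
  shows "continuous_on UNIV (ift g)"
proof -
  obtain C where C: "C > 0" "\<And>z h. norm h \<le> 1 \<Longrightarrow> norm (ift g (z + h) - ift g z) \<le> C * norm h / (1 + norm z) ^ 0"
    using ift_difference_decay[OF assms, of 1 0] by blast
  have "\<exists>d>0. \<forall>y. dist y x < d \<longrightarrow> dist (ift g y) (ift g x) < e" if "e > 0" for x e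
  proof (intro exI[of _ "min 1 (e / C)"] conjI allI impI)
    fix y assume y: "dist y x < min 1 (e / C)"
    have "dist (ift g y) (ift g x) \<le> C * norm (y - x)"
      using C(2)[of "y - x" x] y by (simp add: dist_norm)
    also have "\<dots> < e" using y C(1) by (simp add: dist_norm pos_less_divide_eq mult.commute)
    finally show "dist (ift g y) (ift g x) < e" .
  qed (use that C(1) in auto)
  then show ?thesis by (auto simp: continuous_on_iff)
qed

lemma borel_measurable_ift: "bump g \<Longrightarrow> ift g \<in> borel_measurable borel"
  by (intro borel_measurable_continuous_onI continuous_on_ift)

lemma integrable_prod_weight: "integrable lborel (prod_weight (\<lambda>_. 1) :: real^'n::finite \<Rightarrow> real)"
proof (rule integrableI_nonneg)
  show "(\<integral>\<^sup>+x. ennreal (prod_weight (\<lambda>_. 1) x) \<partial>(lborel :: (real^'n) measure)) < \<infinity>"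
    using nn_integral_prod_weight[of "\<lambda>_. 1" "0 :: real^'n"] by simp
qed (auto simp: prod_weight_nonneg)

lemma ift_le_prod_weight:
  fixes g :: "real^'n::finite \<Rightarrow> real"
  assumes "bump g"
  shows "\<exists>C>0. \<forall>z. norm (ift g z) \<le> C * prod_weight (\<lambda>_. 1) z"
proof -
  obtain C where C: "C > 0" "\<And>z. norm (ift g z) \<le> C / (1 + norm z) ^ (2 * CARD('n))"
    using ift_decay[OF assms] by blast
  have "norm (ift g z) \<le> C * prod_weight (\<lambda>_. 1) z" for z
  proof -
    have "norm (ift g z) \<le> C * (1 / (1 + norm z) ^ (2 * CARD('n)))" using C(2)[of z] by simp
    also have "\<dots> \<le> C * prod_weight (\<lambda>_. 1) z"
      using C(1) by (intro mult_left_mono decay_le_prod_weight) auto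
    finally show ?thesis .
  qed
  with C(1) show ?thesis by blast
qed

lemma integrable_ift:
  fixes g :: "real^'n::finite \<Rightarrow> real"
  assumes "bump g"
  shows "integrable lborel (ift g)"
proof -
  obtain C where C: "\<And>z. norm (ift g z) \<le> C * prod_weight (\<lambda>_. 1) z" "C > 0"
    using ift_le_prod_weight[OF assms] by blast
  have "integrable lborel (\<lambda>z :: real^'n. C * prod_weight (\<lambda>_. 1) z)"
    by (intro integrable_mult_right integrable_prod_weight)
  from this show ?thesis
    by (rule Bochner_Integration.integrable_bound) (use borel_measurable_ift[OF assms] C in \<open>auto simp: abs_mult prod_weight_nonneg intro!: always_eventually\<close>)
qed

section \<open>Fourier inversion\<close>

text \<open>Supplies the absolute integrability for Fubini's theorem whenever a kernel is expanded
  as a Fourier integral.\<close>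

lemma integrable_pair_product_bound:
  fixes F :: "(real^'n::finite) \<times> (real^'n) \<Rightarrow> complex"
  assumes [measurable]: "F \<in> borel_measurable (lborel \<Otimes>\<^sub>M lborel)"
    and u: "integrable lborel u" and v: "integrable lborel v"
    and le: "\<And>x y. norm (F (x, y)) \<le> u x * v y"
  shows "integrable (lborel \<Otimes>\<^sub>M lborel) F"
proof (rule integrableI_bounded)
  have [measurable]: "u \<in> borel_measurable borel" "v \<in> borel_measurable borel" using u v by auto
  have fin: "(\<integral>\<^sup>+x. ennreal \<bar>u x\<bar> \<partial>lborel) < \<infinity>" "(\<integral>\<^sup>+y. ennreal \<bar>v y\<bar> \<partial>lborel) < \<infinity>"
    using u v by (auto simp: integrable_iff_bounded)
  have "(\<integral>\<^sup>+p. ennreal (norm (F p)) \<partial>(lborel \<Otimes>\<^sub>M lborel)) \<le> (\<integral>\<^sup>+p. ennreal \<bar>u (fst p)\<bar> * ennreal \<bar>v (snd p)\<bar> \<partial>(lborel \<Otimes>\<^sub>M lborel))"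
  proof (rule nn_integral_mono)
    fix p :: "(real^'n) \<times> (real^'n)"
    have "norm (F p) \<le> \<bar>u (fst p)\<bar> * \<bar>v (snd p)\<bar>"
      using le[of "fst p" "snd p"] abs_ge_self[of "u (fst p) * v (snd p)"] by (simp add: abs_mult)
    then show "ennreal (norm (F p)) \<le> ennreal \<bar>u (fst p)\<bar> * ennreal \<bar>v (snd p)\<bar>"
      by (simp add: ennreal_mult[symmetric] ennreal_leI)
  qed
  also have "\<dots> = (\<integral>\<^sup>+x. \<integral>\<^sup>+y. ennreal \<bar>u x\<bar> * ennreal \<bar>v y\<bar> \<partial>lborel \<partial>lborel)"
    by (subst lborel.nn_integral_fst[symmetric]) auto
  also have "\<dots> = (\<integral>\<^sup>+x. ennreal \<bar>u x\<bar> \<partial>lborel) * (\<integral>\<^sup>+y. ennreal \<bar>v y\<bar> \<partial>lborel)"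
    by (simp add: nn_integral_cmult nn_integral_multc)
  also have "\<dots> < \<infinity>" using fin by (simp add: ennreal_mult_less_top)
  finally show "(\<integral>\<^sup>+p. ennreal (norm (F p)) \<partial>(lborel \<Otimes>\<^sub>M lborel)) < \<infinity>" .
qed simp

lemma integrable_gauss: "integrable lborel (gauss :: real^'n::finite \<Rightarrow> real)"
  and integral_gauss: "(\<integral>x. gauss (x :: real^'n) \<partial>lborel) = 1"
proof -
  have "integrable lborel (\<lambda>x :: real^'n. complex_of_real (gauss x))"
    and int: "(\<integral>x. complex_of_real (gauss (x :: real^'n)) \<partial>lborel) = 1"
    using gauss_fourier[of "0 :: real^'n"] by (simp_all add: gauss_0)
  then show "integrable lborel (gauss :: real^'n \<Rightarrow> real)" by (simp add: complex_of_real_integrable_eq)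
  have "complex_of_real (\<integral>x. gauss (x :: real^'n) \<partial>lborel) = 1" using int by simp
  then show "(\<integral>x. gauss (x :: real^'n) \<partial>lborel) = 1" by (simp only: of_real_eq_1_iff)
qed

lemma integrable_gauss_scale:
  fixes w :: "real^'n::finite"
  assumes "c \<noteq> 0"
  shows "integrable lborel (\<lambda>x. gauss (w + c *\<^sub>R x))"
proof -
  have "integrable lborel (\<lambda>x. complex_of_real (gauss (w + c *\<^sub>R x)))"
    by (intro integrable_affine_cart assms) (simp add: complex_of_real_integrable_eq integrable_gauss)
  then show ?thesis by (simp add: complex_of_real_integrable_eq)
qed

lemma gauss_fourier_scale:
  fixes s :: "real^'n::finite"
  assumes "\<epsilon> > 0"
  shows "(\<integral>w. complex_of_real (gauss (\<epsilon> *\<^sub>R w)) * cis (2 * pi * (s \<bullet> w)) \<partial>lborel)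
    = (1 / \<epsilon>) ^ CARD('n) *\<^sub>R complex_of_real (gauss ((1 / \<epsilon>) *\<^sub>R s))"
proof -
  let ?F = "\<lambda>w. complex_of_real (gauss (\<epsilon> *\<^sub>R w)) * cis (2 * pi * (s \<bullet> w))"
  have "(\<integral>w. ?F w \<partial>lborel) = \<bar>1 / \<epsilon>\<bar> ^ CARD('n) *\<^sub>R (\<integral>x. ?F (0 + (1 / \<epsilon>) *\<^sub>R x) \<partial>lborel)"
    using assms by (intro lborel_integral_affine_cart) auto
  also have "(\<integral>x. ?F (0 + (1 / \<epsilon>) *\<^sub>R x) \<partial>lborel) = complex_of_real (gauss ((1 / \<epsilon>) *\<^sub>R s))"
    using gauss_fourier(2)[of "(1 / \<epsilon>) *\<^sub>R s"] assms by simp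
  finally show ?thesis using assms by simp
qed

text \<open>The Gaussian factor makes the double integral absolutely convergent. After the exchange,
  the integral over w is a Gaussian of width \<open>\<epsilon>\<close> around \<open>\<xi>\<close>,
  and rescaling gives an average of g near \<open>\<xi>\<close>.\<close>

lemma ift_gauss_regularised:
  fixes g :: "real^'n::finite \<Rightarrow> real"
  assumes g: "bump g" and \<epsilon>: "\<epsilon> > 0"
  shows "(\<integral>w. ift g w * cis (- (2 * pi * (\<xi> \<bullet> w))) * complex_of_real (gauss (\<epsilon> *\<^sub>R w)) \<partial>lborel)
     = (\<integral>\<zeta>. complex_of_real (g (\<xi> + \<epsilon> *\<^sub>R \<zeta>) * gauss \<zeta>) \<partial>lborel)"
proof -
  have [measurable]: "g \<in> borel_measurable borel" by (rule bump_measurable[OF g])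
  define F where "F w \<eta> = complex_of_real (g \<eta>) * cis (2 * pi * (w \<bullet> \<eta>)) * (cis (- (2 * pi * (\<xi> \<bullet> w))) * complex_of_real (gauss (\<epsilon> *\<^sub>R w)))" for w \<eta>
  have F_meas: "case_prod F \<in> borel_measurable (lborel \<Otimes>\<^sub>M lborel)"
    unfolding F_def by measurable
  have "integrable lborel (\<lambda>w :: real^'n. gauss (0 + \<epsilon> *\<^sub>R w))" using \<epsilon> by (intro integrable_gauss_scale) auto
  then have ig: "integrable lborel (\<lambda>w :: real^'n. gauss (\<epsilon> *\<^sub>R w))" by simp
  have F_int: "integrable (lborel \<Otimes>\<^sub>M lborel) (case_prod F)"
    by (rule integrable_pair_product_bound[OF F_meas ig, of "\<lambda>\<eta>. \<bar>g \<eta>\<bar>"])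
      (use bump_integrable[OF g] in \<open>auto simp: F_def norm_mult gauss_nonneg\<close>)
  have "(\<integral>w. ift g w * cis (- (2 * pi * (\<xi> \<bullet> w))) * complex_of_real (gauss (\<epsilon> *\<^sub>R w)) \<partial>lborel) = (\<integral>w. \<integral>\<eta>. F w \<eta> \<partial>lborel \<partial>lborel)"
    unfolding F_def ift_def Bochner_Integration.integral_mult_left_zero by (simp only: mult.assoc)
  also have "\<dots> = (\<integral>\<eta>. \<integral>w. F w \<eta> \<partial>lborel \<partial>lborel)"
    by (rule lborel_pair.Fubini_integral[OF F_int, symmetric])
  also have "\<dots> = (\<integral>\<eta>. (1 / \<epsilon>) ^ CARD('n) *\<^sub>R complex_of_real (g \<eta> * gauss ((1 / \<epsilon>) *\<^sub>R (\<eta> - \<xi>))) \<partial>lborel)"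
  proof (rule Bochner_Integration.integral_cong[OF refl])
    fix \<eta>
    have "F w \<eta> = complex_of_real (g \<eta>) * (complex_of_real (gauss (\<epsilon> *\<^sub>R w)) * cis (2 * pi * ((\<eta> - \<xi>) \<bullet> w)))" for w
    proof -
      have "cis (2 * pi * ((\<eta> - \<xi>) \<bullet> w)) = cis (2 * pi * (w \<bullet> \<eta>)) * cis (- (2 * pi * (\<xi> \<bullet> w)))"
        unfolding cis_mult by (simp add: inner_diff_left inner_commute[of w] algebra_simps)
      then show ?thesis by (simp add: F_def)
    qed
    then have "(\<integral>w. F w \<eta> \<partial>lborel) = complex_of_real (g \<eta>) * (\<integral>w. complex_of_real (gauss (\<epsilon> *\<^sub>R w)) * cis (2 * pi * ((\<eta> - \<xi>) \<bullet> w)) \<partial>lborel)"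
      by simp
    then show "(\<integral>w. F w \<eta> \<partial>lborel) = (1 / \<epsilon>) ^ CARD('n) *\<^sub>R complex_of_real (g \<eta> * gauss ((1 / \<epsilon>) *\<^sub>R (\<eta> - \<xi>)))"
      unfolding gauss_fourier_scale[OF \<epsilon>] by (simp add: scaleR_conv_of_real)
  qed
  also have "\<dots> = \<bar>\<epsilon>\<bar> ^ CARD('n) *\<^sub>R (\<integral>\<zeta>. (1 / \<epsilon>) ^ CARD('n) *\<^sub>R complex_of_real (g (\<xi> + \<epsilon> *\<^sub>R \<zeta>) * gauss ((1 / \<epsilon>) *\<^sub>R (\<xi> + \<epsilon> *\<^sub>R \<zeta> - \<xi>))) \<partial>lborel)"
    using \<epsilon> by (intro lborel_integral_affine_cart) auto
  also have "\<dots> = (\<integral>\<zeta>. complex_of_real (g (\<xi> + \<epsilon> *\<^sub>R \<zeta>) * gauss \<zeta>) \<partial>lborel)"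
    using \<epsilon> by (simp add: power_one_over)
  finally show ?thesis .
qed

text \<open>Both sides of \<open>ift_gauss_regularised\<close> are followed as the width tends to 0:
  the left by dominated convergence, as \<open>ift g\<close> is integrable, and the right by
  continuity and boundedness of g.\<close>

lemma fourier_inversion:
  fixes g :: "real^'n::finite \<Rightarrow> real"
  assumes g: "bump g"
  shows "(\<integral>w. ift g w * cis (- (2 * pi * (\<xi> \<bullet> w))) \<partial>lborel) = complex_of_real (g \<xi>)"
proof (rule LIMSEQ_unique)
  have [measurable]: "g \<in> borel_measurable borel" "ift g \<in> borel_measurable borel"
    using bump_measurable[OF g] borel_measurable_ift[OF g] by auto
  have contg: "isCont g x" for x using g by (simp add: bump_def continuous_on_eq_continuous_at)
  have contG: "isCont (gauss :: real^'n \<Rightarrow> real) x" for x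
    using continuous_on_gauss[OF continuous_on_id, where A = "UNIV :: (real^'n) set"]
    by (simp add: continuous_on_eq_continuous_at)
  obtain B where B: "\<And>\<xi>. \<bar>g \<xi>\<bar> \<le> B" using bump_bounded[OF g] by metis
  define \<epsilon> where "\<epsilon> n = 1 / real (Suc n)" for n
  have \<epsilon>: "\<epsilon> n > 0" for n by (simp add: \<epsilon>_def)
  have lim: "(\<lambda>n. \<epsilon> n *\<^sub>R w) \<longlonglongrightarrow> 0" for w :: "real^'n"
    using tendsto_scaleR[OF LIMSEQ_Suc[OF lim_1_over_n] tendsto_const[of w]] by (simp add: \<epsilon>_def)
  have "(\<lambda>n. \<integral>w. ift g w * cis (- (2 * pi * (\<xi> \<bullet> w))) * complex_of_real (gauss (\<epsilon> n *\<^sub>R w)) \<partial>lborel)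
     \<longlonglongrightarrow> (\<integral>w. ift g w * cis (- (2 * pi * (\<xi> \<bullet> w))) \<partial>lborel)"
  proof (rule integral_dominated_convergence[where w = "\<lambda>w. norm (ift g w)"])
    show "integrable lborel (\<lambda>w. norm (ift g w))" using integrable_ift[OF g] by (rule integrable_norm)
    show "AE w in lborel. (\<lambda>n. ift g w * cis (- (2 * pi * (\<xi> \<bullet> w))) * complex_of_real (gauss (\<epsilon> n *\<^sub>R w)))
       \<longlonglongrightarrow> ift g w * cis (- (2 * pi * (\<xi> \<bullet> w)))"
    proof (rule AE_I2)
      fix w :: "real^'n"
      have "(\<lambda>n. gauss (\<epsilon> n *\<^sub>R w)) \<longlonglongrightarrow> gauss (0 :: real^'n)" by (rule isCont_tendsto_compose[OF contG lim])
      then have "(\<lambda>n. ift g w * cis (- (2 * pi * (\<xi> \<bullet> w))) * complex_of_real (gauss (\<epsilon> n *\<^sub>R w)))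
       \<longlonglongrightarrow> ift g w * cis (- (2 * pi * (\<xi> \<bullet> w))) * complex_of_real (gauss (0 :: real^'n))"
        by (intro tendsto_intros)
      then show "(\<lambda>n. ift g w * cis (- (2 * pi * (\<xi> \<bullet> w))) * complex_of_real (gauss (\<epsilon> n *\<^sub>R w)))
       \<longlonglongrightarrow> ift g w * cis (- (2 * pi * (\<xi> \<bullet> w)))" by (simp add: gauss_0)
    qed
    show "AE w in lborel. norm (ift g w * cis (- (2 * pi * (\<xi> \<bullet> w))) * complex_of_real (gauss (\<epsilon> n *\<^sub>R w))) \<le> norm (ift g w)" for n
      by (rule AE_I2) (simp add: norm_mult gauss_nonneg gauss_le_1 mult_left_le)
  qed measurable
  then show "(\<lambda>n. \<integral>\<zeta>. complex_of_real (g (\<xi> + \<epsilon> n *\<^sub>R \<zeta>) * gauss \<zeta>) \<partial>lborel)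
     \<longlonglongrightarrow> (\<integral>w. ift g w * cis (- (2 * pi * (\<xi> \<bullet> w))) \<partial>lborel)"
    unfolding ift_gauss_regularised[OF g \<epsilon>] .
  have "(\<lambda>n. \<integral>\<zeta>. complex_of_real (g (\<xi> + \<epsilon> n *\<^sub>R \<zeta>) * gauss \<zeta>) \<partial>lborel)
     \<longlonglongrightarrow> (\<integral>\<zeta>. complex_of_real (g \<xi> * gauss (\<zeta> :: real^'n)) \<partial>lborel)"
  proof (rule integral_dominated_convergence[where w = "\<lambda>\<zeta>. B * gauss \<zeta>"])
    show "integrable lborel (\<lambda>\<zeta> :: real^'n. B * gauss \<zeta>)"
      by (intro integrable_mult_right integrable_gauss)
    show "AE \<zeta> in lborel. (\<lambda>n. complex_of_real (g (\<xi> + \<epsilon> n *\<^sub>R \<zeta>) * gauss \<zeta>)) \<longlonglongrightarrow> complex_of_real (g \<xi> * gauss \<zeta>)"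
    proof (rule AE_I2)
      fix \<zeta>
      have "(\<lambda>n. \<xi> + \<epsilon> n *\<^sub>R \<zeta>) \<longlonglongrightarrow> \<xi> + 0" by (intro tendsto_add tendsto_const lim)
      then have "(\<lambda>n. g (\<xi> + \<epsilon> n *\<^sub>R \<zeta>)) \<longlonglongrightarrow> g \<xi>" using isCont_tendsto_compose[OF contg] by force
      then show "(\<lambda>n. complex_of_real (g (\<xi> + \<epsilon> n *\<^sub>R \<zeta>) * gauss \<zeta>)) \<longlonglongrightarrow> complex_of_real (g \<xi> * gauss \<zeta>)"
        by (intro tendsto_intros)
    qed
    show "AE \<zeta> in lborel. norm (complex_of_real (g (\<xi> + \<epsilon> n *\<^sub>R \<zeta>) * gauss \<zeta>)) \<le> B * gauss \<zeta>" for n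
      by (rule AE_I2) (simp add: abs_mult gauss_nonneg B mult_right_mono del: of_real_mult)
  qed measurable
  then show "(\<lambda>n. \<integral>\<zeta>. complex_of_real (g (\<xi> + \<epsilon> n *\<^sub>R \<zeta>) * gauss \<zeta>) \<partial>lborel) \<longlonglongrightarrow> complex_of_real (g \<xi>)"
    by (simp add: integral_gauss)
qed

section \<open>The smooth low-frequency cutoff\<close>

text \<open>Only the dyadic terms j = 0 and j = -1 can be nonzero when 1/2 < |\<open>\<xi>\<close>|
  and |\<open>\<xi>\<close>| is at most 1; beyond norm 1 the term at 2 \<open>\<xi>\<close>
  vanishes.\<close>

lemma dyadic_bump_sum_two:
  fixes \<rho> :: "real^'n::finite \<Rightarrow> real"
  assumes "dyadic_bump \<rho>" "1 / 2 < norm \<xi>"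
  shows "\<rho> \<xi> + \<rho> (2 *\<^sub>R \<xi>) = (if norm \<xi> \<le> 1 then 1 else \<rho> \<xi>)"
proof (cases "norm \<xi> \<le> 1")
  case True
  have supp: "\<rho> y \<noteq> 0 \<Longrightarrow> 1/2 < norm y \<and> norm y < 2" for y
    using assms by (auto simp: dyadic_bump_def)
  let ?f = "\<lambda>j::int. \<rho> ((2 powr (- real_of_int j)) *\<^sub>R \<xi>)"
  have "\<xi> \<noteq> 0" using assms(2) by auto
  then have 1: "(?f has_sum 1) UNIV" using assms by (auto simp: dyadic_bump_def)
  \<comment> \<open>For j at least 1 the argument has norm at most 1/2, and for j at most -2 it has
    norm at least 2; both lie outside the open annulus of the support.\<close>
  have zero: "?f j = 0" if "j \<notin> {-1, 0}" for j
  proof (rule ccontr)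
    assume "?f j \<noteq> 0"
    then have s: "1/2 < 2 powr (- real_of_int j) * norm \<xi>" "2 powr (- real_of_int j) * norm \<xi> < 2"
      using supp by fastforce+
    show False
    proof (cases "j \<ge> 1")
      case True
      then have "2 powr (- real_of_int j) \<le> 2 powr (- 1)" by (intro powr_mono) auto
      then have "2 powr (- real_of_int j) * norm \<xi> \<le> (1 / 2) * 1"
        using \<open>norm \<xi> \<le> 1\<close> by (intro mult_mono) (auto simp: powr_minus_divide)
      then show False using s by simp
    next
      case False
      then have "j \<le> - 2" using that by auto
      then have "2 powr 2 \<le> 2 powr (- real_of_int j)" by (intro powr_mono) auto
      then have "4 * (1 / 2) \<le> 2 powr (- real_of_int j) * norm \<xi>"
        using assms(2) by (intro mult_mono) auto
      then show False using s by simp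
    qed
  qed
  have "(?f has_sum 1) {-1, 0}"
    using has_sum_cong_neutral[of "{-1, 0}" UNIV ?f ?f 1] zero 1 by auto
  moreover have "(?f has_sum (\<Sum>j\<in>{-1, 0}. ?f j)) {-1, 0}" by (rule has_sum_finite) simp
  ultimately have "(\<Sum>j\<in>{-1, 0}. ?f j) = 1" using has_sum_unique by blast
  then show ?thesis using True by simp
next
  case False
  then have "\<not> norm (2 *\<^sub>R \<xi>) < 2" by simp
  then have "\<rho> (2 *\<^sub>R \<xi>) = 0" using assms(1) unfolding dyadic_bump_def by blast
  then show ?thesis using False by simp
qed

text \<open>The sum of \<open>\<rho> (2\<^sup>-\<^sup>j \<xi>)\<close> over \<open>j \<le> 0\<close>, extended by its limit 1 to the origin.\<close>

definition low_cutoff :: "(real^'n::finite \<Rightarrow> real) \<Rightarrow> real^'n \<Rightarrow> real" where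
  "low_cutoff \<rho> \<xi> = (if norm \<xi> \<le> 1 then 1 else \<rho> \<xi>)"

text \<open>The telescoping identity on the frequency side, which later makes every block a
  difference of two mollifications. Only 1 < |\<open>\<xi>\<close>| up to 2 needs the partition of
  unity, applied at \<open>\<xi>\<close> / 2.\<close>

lemma low_cutoff_half_diff:
  fixes \<rho> :: "real^'n::finite \<Rightarrow> real"
  assumes "dyadic_bump \<rho>"
  shows "low_cutoff \<rho> ((1 / 2) *\<^sub>R \<xi>) - low_cutoff \<rho> \<xi> = \<rho> ((1 / 2) *\<^sub>R \<xi>)"
proof -
  have supp: "\<rho> y \<noteq> 0 \<Longrightarrow> 1/2 < norm y \<and> norm y < 2" for y
    using assms by (auto simp: dyadic_bump_def)
  consider "norm \<xi> \<le> 1" | "1 < norm \<xi>" "norm \<xi> \<le> 2" | "2 < norm \<xi>" by linarith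
  then show ?thesis
  proof cases
    case 1
    then have "\<rho> ((1 / 2) *\<^sub>R \<xi>) = 0" using supp[of "(1 / 2) *\<^sub>R \<xi>"] by auto
    with 1 show ?thesis by (simp add: low_cutoff_def)
  next
    case 2
    then show ?thesis using dyadic_bump_sum_two[OF assms, of "(1 / 2) *\<^sub>R \<xi>"] by (simp add: low_cutoff_def)
  next
    case 3
    then have "\<rho> \<xi> = 0" using supp[of \<xi>] by auto
    with 3 show ?thesis by (simp add: low_cutoff_def)
  qed
qed

text \<open>On the support of \<open>\<rho>\<close> the norm is below 2, so the halved argument lies
  where the cutoff is 1.\<close>

lemma low_cutoff_reproduces:
  fixes \<rho> :: "real^'n::finite \<Rightarrow> real"
  assumes "dyadic_bump \<rho>"
  shows "\<rho> \<xi> * low_cutoff \<rho> ((1 / 2) *\<^sub>R \<xi>) = \<rho> \<xi>"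
  using assms by (cases "\<rho> \<xi> = 0") (auto simp: low_cutoff_def dyadic_bump_def)

lemma deriv_family_locally:
  fixes F G :: "'a::real_normed_vector \<Rightarrow> real"
  assumes "((\<lambda>s. G (\<xi> + s *\<^sub>R v)) has_real_derivative D) (at 0)"
    and "open U" "\<xi> \<in> U" "\<And>y. y \<in> U \<Longrightarrow> F y = G y"
  shows "((\<lambda>s. F (\<xi> + s *\<^sub>R v)) has_real_derivative D) (at 0)"
proof -
  have "open ((\<lambda>s. \<xi> + s *\<^sub>R v) -` U)"
    by (intro continuous_open_vimage assms(2)) (auto intro!: continuous_intros)
  then have "\<forall>\<^sub>F s in nhds 0. s \<in> (\<lambda>s. \<xi> + s *\<^sub>R v) -` U"
    using assms(3) by (intro eventually_nhds_in_open) auto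
  then have "\<forall>\<^sub>F s in nhds 0. F (\<xi> + s *\<^sub>R v) = G (\<xi> + s *\<^sub>R v)"
    by eventually_elim (use assms(4) in auto)
  then have "((\<lambda>s. F (\<xi> + s *\<^sub>R v)) has_real_derivative D) (at 0) \<longleftrightarrow> ((\<lambda>s. G (\<xi> + s *\<^sub>R v)) has_real_derivative D) (at 0)"
    by (intro DERIV_cong_ev) auto
  with assms(1) show ?thesis by simp
qed

text \<open>Vanishing outside radius 2 passes to the derivatives because the exterior is open; the
  bounds then follow from compactness of the ball.\<close>

lemma smooth_deriv_family:
  fixes \<rho> :: "real^'n::finite \<Rightarrow> real"
  assumes "smooth_fun \<rho>" and supp: "\<And>y. \<rho> y \<noteq> 0 \<Longrightarrow> norm y < 2"
  shows "deriv_family i (\<lambda>k. pderivs (replicate k i) \<rho>)"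
proof -
  define R where "R k = pderivs (replicate k i) \<rho>" for k
  have diff: "R k differentiable (at x)" for k x using assms(1) by (auto simp: smooth_fun_def R_def)
  have D: "((\<lambda>s. R k (\<xi> + s *\<^sub>R axis i 1)) has_real_derivative R (Suc k) \<xi>) (at 0)" for k \<xi>
  proof -
    let ?L = "frechet_derivative (R k) (at \<xi>)"
    have L: "(R k has_derivative ?L) (at (\<xi> + 0 *\<^sub>R axis i (1::real)))"
      using diff[of k \<xi>] by (simp add: frechet_derivative_works)
    have "((\<lambda>s. \<xi> + s *\<^sub>R axis i (1::real)) has_derivative (\<lambda>s. s *\<^sub>R axis i 1)) (at 0)"
      by (auto intro!: derivative_eq_intros)
    then have "((\<lambda>s. R k (\<xi> + s *\<^sub>R axis i 1)) has_derivative (\<lambda>s. ?L (s *\<^sub>R axis i 1))) (at 0)"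
      by (rule has_derivative_compose) (rule L)
    moreover have "?L (s *\<^sub>R axis i 1) = R (Suc k) \<xi> * s" for s
      using linear_scale[OF has_derivative_linear[OF L], of s "axis i 1"] by (simp add: R_def)
    ultimately show ?thesis by (simp add: has_field_derivative_def)
  qed
  have Rsupp: "R k \<xi> = 0" if "2 < norm \<xi>" for k \<xi>
    using that
  proof (induction k arbitrary: \<xi>)
    case 0
    then show ?case using supp[of \<xi>] by (auto simp: R_def)
  next
    case (Suc k)
    have "open {y :: real^'n. 2 < norm y}" by (intro open_Collect_less continuous_intros)
    then have "((\<lambda>s. R k (\<xi> + s *\<^sub>R axis i 1)) has_real_derivative 0) (at 0)"
      using Suc by - (rule deriv_family_locally[of "\<lambda>_. 0" \<xi> _ 0 "{y. 2 < norm y}"], auto)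
    with D[of k \<xi>] show ?case by (rule DERIV_unique)
  qed
  have Rbound: "\<exists>B. \<forall>\<xi>. \<bar>R k \<xi>\<bar> \<le> B" for k
  proof -
    have "continuous_on (cball 0 2) (R k)"
      by (intro continuous_at_imp_continuous_on ballI differentiable_imp_continuous_within diff)
    then have "bounded (R k ` cball 0 2)"
      by (intro compact_imp_bounded compact_continuous_image) auto
    then obtain B where B: "\<forall>y\<in>R k ` cball 0 2. norm y \<le> B" unfolding bounded_iff by blast
    have "\<bar>R k \<xi>\<bar> \<le> \<bar>B\<bar>" for \<xi>
    proof (cases "2 < norm \<xi>")
      case False
      then have "norm (R k \<xi>) \<le> B" using B by simp
      then show ?thesis by simp
    qed (simp add: Rsupp)
    then show ?thesis by blast
  qed
  show ?thesis unfolding deriv_family_def R_def[symmetric] using D Rbound Rsupp by blast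
qed

text \<open>The case distinction in \<open>low_cutoff\<close> suggests a break at norm 1, but
  outside norm 1/2 the function equals \<open>\<rho>\<close> plus its dilate by 2, and inside norm 1
  it is constant. These two open regions cover the space.\<close>

lemma bump_low_cutoff:
  fixes \<rho> :: "real^'n::finite \<Rightarrow> real"
  assumes \<rho>: "dyadic_bump \<rho>"
  shows "bump (low_cutoff \<rho>)"
  unfolding bump_def
proof (intro conjI allI)
  have sm: "smooth_fun \<rho>" and supp: "\<And>y. \<rho> y \<noteq> 0 \<Longrightarrow> 1 / 2 < norm y \<and> norm y < 2"
    using \<rho> by (auto simp: dyadic_bump_def)
  have outer: "low_cutoff \<rho> y = \<rho> y + \<rho> (2 *\<^sub>R y)" if "1 / 2 < norm y" for y
    using dyadic_bump_sum_two[OF \<rho> that] by (simp add: low_cutoff_def)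
  have open_out: "open {y :: real^'n. 1 / 2 < norm y}" by (intro open_Collect_less continuous_intros)
  have cover: "x \<in> ball 0 1 \<or> 1 / 2 < norm x" for x :: "real^'n" by auto
  have "\<And>x. \<rho> differentiable (at x)" using sm unfolding smooth_fun_def by (metis pderivs.simps(1))
  then have cont\<rho>: "continuous_on UNIV \<rho>"
    by (intro continuous_at_imp_continuous_on ballI differentiable_imp_continuous_within)
  have cont2: "continuous_on UNIV (\<lambda>y. \<rho> (2 *\<^sub>R y))"
    by (rule continuous_on_compose2[OF cont\<rho>]) (auto intro!: continuous_intros)
  have c_out: "continuous_on {y. 1 / 2 < norm y} (low_cutoff \<rho>)"
    using continuous_on_subset[OF cont\<rho>] continuous_on_subset[OF cont2]
    by (subst continuous_on_cong[OF refl outer]) (auto intro!: continuous_on_add)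
  have c_in: "continuous_on (ball 0 1) (low_cutoff \<rho>)"
    by (subst continuous_on_cong[OF refl, of _ _ "\<lambda>_. 1"]) (auto simp: low_cutoff_def)
  have "continuous_on (ball 0 1 \<union> {y. 1 / 2 < norm y}) (low_cutoff \<rho>)"
    by (rule continuous_on_open_Un[OF _ open_out c_in c_out]) simp
  moreover have "ball 0 1 \<union> {y :: real^'n. 1 / 2 < norm y} = UNIV" using cover by auto
  ultimately show "continuous_on UNIV (low_cutoff \<rho>)" by simp
  fix i
  define R where "R k = pderivs (replicate k i) \<rho>" for k
  have R: "deriv_family i R" unfolding R_def using sm supp by (intro smooth_deriv_family) auto
  have RD: "((\<lambda>s. R k (\<xi> + s *\<^sub>R axis i 1)) has_real_derivative R (Suc k) \<xi>) (at 0)" for k \<xi>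
    using R by (auto simp: deriv_family_def)
  \<comment> \<open>The derivatives of the outer description; the chain rule gives the factor 2 ^
    k.\<close>
  define Q where "Q k \<xi> = R k \<xi> + 2 ^ k * R k (2 *\<^sub>R \<xi>)" for k \<xi>
  have QD: "((\<lambda>s. Q k (\<xi> + s *\<^sub>R axis i 1)) has_real_derivative Q (Suc k) \<xi>) (at 0)" for k \<xi>
  proof -
    have "((\<lambda>s. R k (2 *\<^sub>R \<xi> + (2 * s) *\<^sub>R axis i 1)) has_real_derivative R (Suc k) (2 *\<^sub>R \<xi>) * 2) (at 0)"
    proof (rule DERIV_chain2[where f = "\<lambda>s. R k (2 *\<^sub>R \<xi> + s *\<^sub>R axis i 1)" and g = "\<lambda>s. 2 * s"])
      show "((\<lambda>s. R k (2 *\<^sub>R \<xi> + s *\<^sub>R axis i 1)) has_real_derivative R (Suc k) (2 *\<^sub>R \<xi>)) (at (2 * 0))"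
        using RD[of k "2 *\<^sub>R \<xi>"] by simp
    qed (auto intro!: derivative_eq_intros)
    then have "((\<lambda>s. R k (2 *\<^sub>R (\<xi> + s *\<^sub>R axis i 1))) has_real_derivative R (Suc k) (2 *\<^sub>R \<xi>) * 2) (at 0)"
      by (simp add: scaleR_right_distrib)
    from DERIV_add[OF RD[of k \<xi>] DERIV_cmult[OF this, of "2 ^ k"]] show ?thesis
      by (simp add: Q_def mult_ac)
  qed
  have Q_ann: "Q k \<xi> = (if k = 0 then 1 else 0)" if "1 / 2 < norm \<xi>" "norm \<xi> < 1" for k \<xi>
    using that
  proof (induction k arbitrary: \<xi>)
    case 0
    then show ?case using outer[of \<xi>] by (simp add: Q_def R_def low_cutoff_def)
  next
    case (Suc k)
    have "open {y :: real^'n. 1 / 2 < norm y \<and> norm y < 1}"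
      by (intro open_Collect_conj open_Collect_less continuous_intros)
    then have "((\<lambda>s. Q k (\<xi> + s *\<^sub>R axis i 1)) has_real_derivative 0) (at 0)"
      using Suc by - (rule deriv_family_locally[of "\<lambda>_. if k = 0 then 1 else 0" \<xi> _ 0 "{y. 1 / 2 < norm y \<and> norm y < 1}"], auto)
    with QD[of k \<xi>] have "Q (Suc k) \<xi> = 0" by (rule DERIV_unique)
    then show ?case by simp
  qed
  \<comment> \<open>The inner and outer derivatives are glued at norm 3/4, an arbitrary radius
    inside the annulus between 1/2 and 1 where they agree by \<open>Q_ann\<close>.\<close>
  define P where "P k \<xi> = (if norm \<xi> \<le> 3 / 4 then (if k = 0 then 1 else 0) else Q k \<xi>)" for k \<xi>
  have P_in: "P k \<xi> = (if k = 0 then 1 else 0)" if "norm \<xi> < 1" for k \<xi>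
    using that Q_ann[of \<xi> k] by (auto simp: P_def)
  have P_out: "P k \<xi> = Q k \<xi>" if "1 / 2 < norm \<xi>" for k \<xi>
    using that Q_ann[of \<xi> k] by (auto simp: P_def)
  have "deriv_family i P"
    unfolding deriv_family_def
  proof (intro conjI allI impI)
    fix k \<xi>
    show "((\<lambda>s. P k (\<xi> + s *\<^sub>R axis i 1)) has_real_derivative P (Suc k) \<xi>) (at 0)"
    proof (cases "norm \<xi> < 1")
      case True
      have "((\<lambda>s. P k (\<xi> + s *\<^sub>R axis i 1)) has_real_derivative 0) (at 0)"
        using True P_in by - (rule deriv_family_locally[of "\<lambda>_. if k = 0 then 1 else 0" \<xi> _ 0 "ball 0 1"], auto)
      then show ?thesis using P_in[OF True] by simp
    next
      case False
      then have "1 / 2 < norm \<xi>" by simp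
      then show ?thesis
        unfolding P_out[OF \<open>1 / 2 < norm \<xi>\<close>] using P_out
        by - (rule deriv_family_locally[OF QD open_out], auto)
    qed
  next
    fix k \<xi> assume "2 < norm (\<xi> :: real^'n)"
    then show "P k \<xi> = 0" using R by (auto simp: P_def Q_def deriv_family_def)
  next
    fix k
    obtain B where B: "\<And>\<xi>. \<bar>R k \<xi>\<bar> \<le> B" using R unfolding deriv_family_def by metis
    have "\<bar>Q k \<xi>\<bar> \<le> B + 2 ^ k * B" for \<xi>
    proof -
      have "\<bar>Q k \<xi>\<bar> \<le> \<bar>R k \<xi>\<bar> + \<bar>2 ^ k * R k (2 *\<^sub>R \<xi>)\<bar>" unfolding Q_def by (rule abs_triangle_ineq)
      also have "\<dots> \<le> B + 2 ^ k * B" unfolding abs_mult using B by (intro add_mono mult_mono) auto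
      finally show ?thesis .
    qed
    then have "\<bar>Q k \<xi>\<bar> \<le> \<bar>B + 2 ^ k * B\<bar>" for \<xi> by (meson abs_ge_self order_trans)
    then have "\<bar>P k \<xi>\<bar> \<le> 1 + \<bar>B + 2 ^ k * B\<bar>" for \<xi> by (auto simp: P_def add_increasing)
    then show "\<exists>B. \<forall>\<xi>. \<bar>P k \<xi>\<bar> \<le> B" by blast
  qed
  moreover have "P 0 = low_cutoff \<rho>"
  proof
    fix x show "P 0 x = low_cutoff \<rho> x"
      using outer[of x] by (cases "norm x \<le> 3 / 4") (simp_all add: P_def Q_def R_def, simp add: low_cutoff_def)
  qed
  ultimately show "\<exists>G. G 0 = low_cutoff \<rho> \<and> deriv_family i G" by blast
qed

section \<open>Littlewood-Paley blocks as differences of mollifications\<close>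

lemma integrable_scale_cart:
  fixes g :: "real^'n::finite \<Rightarrow> real"
  assumes "integrable lborel g" "c \<noteq> 0"
  shows "integrable lborel (\<lambda>\<xi>. g (c *\<^sub>R \<xi>))"
proof -
  have "integrable lborel (\<lambda>\<xi>. complex_of_real (g (0 + c *\<^sub>R \<xi>)))"
    using assms by (intro integrable_affine_cart) (auto simp: complex_of_real_integrable_eq)
  then show ?thesis by (simp add: complex_of_real_integrable_eq)
qed

lemma ift_scale:
  fixes g :: "real^'n::finite \<Rightarrow> real"
  assumes "g \<in> borel_measurable borel" "r > 0"
  shows "ift (\<lambda>\<xi>. g ((1 / r) *\<^sub>R \<xi>)) z = complex_of_real (r ^ CARD('n)) * ift g (r *\<^sub>R z)"
proof -
  have [measurable]: "g \<in> borel_measurable borel" by fact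
  have "ift (\<lambda>\<xi>. g ((1 / r) *\<^sub>R \<xi>)) z = \<bar>r\<bar> ^ CARD('n) *\<^sub>R
     (\<integral>\<xi>. complex_of_real (g ((1 / r) *\<^sub>R (0 + r *\<^sub>R \<xi>))) * cis (2 * pi * (z \<bullet> (0 + r *\<^sub>R \<xi>))) \<partial>lborel)"
    unfolding ift_def using assms(2) by (intro lborel_integral_affine_cart) auto
  then show ?thesis using assms(2) by (simp add: ift_def scaleR_conv_of_real[where 'a = complex])
qed

text \<open>An approximate identity at spatial scale 1 / r. The parameter r is the cutoff frequency,
  and the powers of r preserve the integral, which is 1.\<close>

definition mollifier :: "(real^'n::finite \<Rightarrow> real) \<Rightarrow> real \<Rightarrow> real^'n \<Rightarrow> complex" where
  "mollifier \<rho> r z = complex_of_real (r ^ CARD('n)) * ift (low_cutoff \<rho>) (r *\<^sub>R z)"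

definition smoothing :: "(real^'n::finite \<Rightarrow> real) \<Rightarrow> real \<Rightarrow> (real^'n \<Rightarrow> complex) \<Rightarrow> real^'n \<Rightarrow> complex" where
  "smoothing \<rho> r f x = (\<integral>y. f y * mollifier \<rho> r (x - y) \<partial>lborel)"

lemma lp_kernel_eq_mollifier_diff:
  fixes \<rho> :: "real^'n::finite \<Rightarrow> real"
  assumes \<rho>: "dyadic_bump \<rho>"
  shows "lp_kernel \<rho> j z = mollifier \<rho> (2 powr real_of_int j) z - mollifier \<rho> (2 powr (real_of_int j - 1)) z"
proof -
  define r where "r = 2 powr (real_of_int j)"
  have r: "r > 0" "2 powr (real_of_int j - 1) = r / 2" "2 powr (- real_of_int j) = 1 / r"
    by (auto simp: r_def powr_diff powr_minus_divide)
  have meas: "low_cutoff \<rho> \<in> borel_measurable borel" by (rule bump_measurable[OF bump_low_cutoff[OF \<rho>]])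
  have int: "integrable lborel (\<lambda>\<xi>. low_cutoff \<rho> ((1 / s) *\<^sub>R \<xi>))" if "s > 0" for s
    using that by (intro integrable_scale_cart bump_integrable bump_low_cutoff \<rho>) auto
  have eq: "\<rho> ((1 / r) *\<^sub>R \<xi>) = low_cutoff \<rho> ((1 / r) *\<^sub>R \<xi>) - low_cutoff \<rho> ((1 / (r / 2)) *\<^sub>R \<xi>)" for \<xi>
    using low_cutoff_half_diff[OF \<rho>, of "(2 / r) *\<^sub>R \<xi>"] by simp
  have "lp_kernel \<rho> j z = (\<integral>\<xi>. complex_of_real (low_cutoff \<rho> ((1 / r) *\<^sub>R \<xi>)) * cis (2 * pi * (z \<bullet> \<xi>))
       - complex_of_real (low_cutoff \<rho> ((1 / (r / 2)) *\<^sub>R \<xi>)) * cis (2 * pi * (z \<bullet> \<xi>)) \<partial>lborel)"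
    unfolding lp_kernel_def r(3) eq by (simp only: of_real_diff left_diff_distrib)
  also have "\<dots> = ift (\<lambda>\<xi>. low_cutoff \<rho> ((1 / r) *\<^sub>R \<xi>)) z - ift (\<lambda>\<xi>. low_cutoff \<rho> ((1 / (r / 2)) *\<^sub>R \<xi>)) z"
    unfolding ift_def using r(1)
    by (intro Bochner_Integration.integral_diff integrable_ift_integrand int) auto
  also have "\<dots> = mollifier \<rho> r z - mollifier \<rho> (r / 2) z"
    using r(1) by (subst (1 2) ift_scale[OF meas]) (auto simp: mollifier_def)
  finally show ?thesis by (simp only: r(2) r_def[symmetric])
qed

lemma prod_weight_scale: "r > 0 \<Longrightarrow> prod_weight (\<lambda>_. 1) (r *\<^sub>R z) = prod_weight (\<lambda>_. 1 / r) z"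
  by (simp add: prod_weight_def mult.commute)

lemma mollifier_bound:
  fixes \<rho> :: "real^'n::finite \<Rightarrow> real"
  assumes \<rho>: "dyadic_bump \<rho>"
  shows "\<exists>C>0. \<forall>r>0. \<forall>z. norm (mollifier \<rho> r z) \<le> C * r ^ CARD('n) * prod_weight (\<lambda>_. 1 / r) z"
proof -
  obtain C where C: "C > 0" "\<And>z. norm (ift (low_cutoff \<rho>) z) \<le> C * prod_weight (\<lambda>_. 1) z"
    using ift_le_prod_weight[OF bump_low_cutoff[OF \<rho>]] by blast
  have "norm (mollifier \<rho> r z) \<le> C * r ^ CARD('n) * prod_weight (\<lambda>_. 1 / r) z" if "r > 0" for r z
  proof -
    have "norm (mollifier \<rho> r z) = r ^ CARD('n) * norm (ift (low_cutoff \<rho>) (r *\<^sub>R z))"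
      using that by (simp add: mollifier_def norm_mult norm_power)
    also have "\<dots> \<le> r ^ CARD('n) * (C * prod_weight (\<lambda>_. 1) (r *\<^sub>R z))"
      using that by (intro mult_left_mono C) auto
    finally show ?thesis using that by (simp add: prod_weight_scale mult_ac)
  qed
  with C(1) show ?thesis by blast
qed

text \<open>The shift enters only through r |h|, its size relative to the width 1 / r of the kernel;
  this produces the gain r b at low frequencies.\<close>

lemma mollifier_difference_bound:
  fixes \<rho> :: "real^'n::finite \<Rightarrow> real"
  assumes \<rho>: "dyadic_bump \<rho>"
  shows "\<exists>C>0. \<forall>r>0. \<forall>z h. r * norm h \<le> H \<longrightarrow>
     norm (mollifier \<rho> r (z + h) - mollifier \<rho> r z) \<le> C * (r * norm h) * r ^ CARD('n) * prod_weight (\<lambda>_. 1 / r) z"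
proof -
  obtain C where C: "C > 0" "\<And>z h. norm h \<le> H \<Longrightarrow>
      norm (ift (low_cutoff \<rho>) (z + h) - ift (low_cutoff \<rho>) z) \<le> C * norm h / (1 + norm z) ^ (2 * CARD('n))"
    using ift_difference_decay[OF bump_low_cutoff[OF \<rho>], of H "2 * CARD('n)"] by blast
  have "norm (mollifier \<rho> r (z + h) - mollifier \<rho> r z) \<le> C * (r * norm h) * r ^ CARD('n) * prod_weight (\<lambda>_. 1 / r) z"
    if r: "r > 0" and h: "r * norm h \<le> H" for r z h
  proof -
    have "norm (mollifier \<rho> r (z + h) - mollifier \<rho> r z)
      = r ^ CARD('n) * norm (ift (low_cutoff \<rho>) (r *\<^sub>R z + r *\<^sub>R h) - ift (low_cutoff \<rho>) (r *\<^sub>R z))"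
      using r by (simp add: mollifier_def scaleR_right_distrib right_diff_distrib[symmetric] norm_mult norm_power)
    also have "\<dots> \<le> r ^ CARD('n) * (C * norm (r *\<^sub>R h) * (1 / (1 + norm (r *\<^sub>R z)) ^ (2 * CARD('n))))"
      using r h C(2)[of "r *\<^sub>R h" "r *\<^sub>R z"] by (intro mult_left_mono) auto
    also have "\<dots> \<le> r ^ CARD('n) * (C * norm (r *\<^sub>R h) * prod_weight (\<lambda>_. 1) (r *\<^sub>R z))"
      using r C(1) by (intro mult_left_mono decay_le_prod_weight) auto
    finally show ?thesis using r by (simp add: prod_weight_scale mult_ac)
  qed
  with C(1) show ?thesis by blast
qed

lemma continuous_on_mollifier:
  assumes "dyadic_bump \<rho>"
  shows "continuous_on UNIV (mollifier \<rho> r)"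
  unfolding mollifier_def
  by (intro continuous_intros continuous_on_compose2[OF continuous_on_ift[OF bump_low_cutoff[OF assms]]]) auto

lemma borel_measurable_mollifier: "dyadic_bump \<rho> \<Longrightarrow> mollifier \<rho> r \<in> borel_measurable borel"
  by (intro borel_measurable_continuous_onI continuous_on_mollifier)

lemma integrable_mollifier:
  fixes \<rho> :: "real^'n::finite \<Rightarrow> real"
  assumes "dyadic_bump \<rho>" "r > 0"
  shows "integrable lborel (mollifier \<rho> r)"
proof -
  have "integrable lborel (\<lambda>z. ift (low_cutoff \<rho>) (0 + r *\<^sub>R z))"
    using assms by (intro integrable_affine_cart integrable_ift bump_low_cutoff) auto
  then have "integrable lborel (\<lambda>z. complex_of_real (r ^ CARD('n)) * ift (low_cutoff \<rho>) (0 + r *\<^sub>R z))"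
    by (rule integrable_mult_right)
  moreover have "mollifier \<rho> r = (\<lambda>z. complex_of_real (r ^ CARD('n)) * ift (low_cutoff \<rho>) (0 + r *\<^sub>R z))"
    by (simp add: fun_eq_iff mollifier_def)
  ultimately show ?thesis by simp
qed

lemma fourier_mollifier:
  fixes \<rho> :: "real^'n::finite \<Rightarrow> real"
  assumes \<rho>: "dyadic_bump \<rho>" and r: "r > 0"
  shows "(\<integral>w. mollifier \<rho> r w * cis (- (2 * pi * (\<xi> \<bullet> w))) \<partial>lborel) = complex_of_real (low_cutoff \<rho> ((1 / r) *\<^sub>R \<xi>))"
proof -
  have [measurable]: "ift (low_cutoff \<rho>) \<in> borel_measurable borel"
    by (intro borel_measurable_ift bump_low_cutoff \<rho>)
  have "complex_of_real (low_cutoff \<rho> ((1 / r) *\<^sub>R \<xi>))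
     = (\<integral>w. ift (low_cutoff \<rho>) w * cis (- (2 * pi * (((1 / r) *\<^sub>R \<xi>) \<bullet> w))) \<partial>lborel)"
    by (rule fourier_inversion[OF bump_low_cutoff[OF \<rho>], symmetric])
  also have "\<dots> = \<bar>r\<bar> ^ CARD('n) *\<^sub>R (\<integral>w. ift (low_cutoff \<rho>) (0 + r *\<^sub>R w) * cis (- (2 * pi * (((1 / r) *\<^sub>R \<xi>) \<bullet> (0 + r *\<^sub>R w)))) \<partial>lborel)"
    using r by (intro lborel_integral_affine_cart) auto
  also have "\<dots> = (\<integral>w. mollifier \<rho> r w * cis (- (2 * pi * (\<xi> \<bullet> w))) \<partial>lborel)"
    using r by (simp add: mollifier_def scaleR_conv_of_real[where 'a = complex] mult.assoc)
  finally show ?thesis ..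
qed

lemma integral_mollifier:
  fixes \<rho> :: "real^'n::finite \<Rightarrow> real"
  assumes "dyadic_bump \<rho>" "r > 0"
  shows "(\<integral>w. mollifier \<rho> r w \<partial>lborel) = 1"
  using fourier_mollifier[OF assms, of 0] by (simp add: low_cutoff_def)

text \<open>Convolution with the mollifier of twice the block frequency multiplies the symbol by a
  cutoff equal to 1 on its support. Expanding only \<open>lp_kernel\<close> as a Fourier integral
  reduces this to the transform of the mollifier.\<close>

lemma lp_kernel_reproducing:
  fixes \<rho> :: "real^'n::finite \<Rightarrow> real"
  assumes \<rho>: "dyadic_bump \<rho>"
  shows "(\<integral>w. lp_kernel \<rho> j (z - w) * mollifier \<rho> (2 powr (real_of_int j + 1)) w \<partial>lborel) = lp_kernel \<rho> j z"
proof -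
  define r where "r = 2 powr (real_of_int j)"
  have r: "r > 0" "2 powr (real_of_int j + 1) = 2 * r" "2 powr (- real_of_int j) = 1 / r"
    by (auto simp: r_def powr_add powr_minus_divide)
  define g where "g \<xi> = \<rho> ((1 / r) *\<^sub>R \<xi>)" for \<xi>
  define K where "K = mollifier \<rho> (2 * r)"
  have K_int: "integrable lborel K" unfolding K_def using r \<rho> by (intro integrable_mollifier) auto
  have [measurable]: "K \<in> borel_measurable borel" using K_int by auto
  have g_eq: "g \<xi> = low_cutoff \<rho> ((1 / r) *\<^sub>R \<xi>) - low_cutoff \<rho> ((2 / r) *\<^sub>R \<xi>)" for \<xi>
    using low_cutoff_half_diff[OF \<rho>, of "(2 / r) *\<^sub>R \<xi>"] by (simp add: g_def)
  have g_int: "integrable lborel g"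
    unfolding g_eq using r(1)
    by (intro Bochner_Integration.integrable_diff integrable_scale_cart bump_integrable bump_low_cutoff \<rho>) auto
  have [measurable]: "g \<in> borel_measurable borel" using g_int by auto
  have kern: "lp_kernel \<rho> j z = (\<integral>\<xi>. complex_of_real (g \<xi>) * cis (2 * pi * (z \<bullet> \<xi>)) \<partial>lborel)" for z
    by (simp add: lp_kernel_def r g_def)
  define F where "F w \<xi> = complex_of_real (g \<xi>) * cis (2 * pi * ((z - w) \<bullet> \<xi>)) * K w" for w \<xi>
  have F_int: "integrable (lborel \<Otimes>\<^sub>M lborel) (case_prod F)"
  proof (rule integrable_pair_product_bound[of _ "\<lambda>w. norm (K w)" "\<lambda>\<xi>. norm (g \<xi>)"])
    show "case_prod F \<in> borel_measurable (lborel \<Otimes>\<^sub>M lborel)" unfolding F_def by measurable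
  qed (use K_int g_int in \<open>auto simp: F_def norm_mult\<close>)
  have "(\<integral>w. lp_kernel \<rho> j (z - w) * K w \<partial>lborel) = (\<integral>w. \<integral>\<xi>. F w \<xi> \<partial>lborel \<partial>lborel)"
    unfolding kern F_def by simp
  also have "\<dots> = (\<integral>\<xi>. \<integral>w. F w \<xi> \<partial>lborel \<partial>lborel)"
    by (rule lborel_pair.Fubini_integral[OF F_int, symmetric])
  also have "\<dots> = (\<integral>\<xi>. complex_of_real (g \<xi>) * cis (2 * pi * (z \<bullet> \<xi>)) \<partial>lborel)"
  proof (rule Bochner_Integration.integral_cong[OF refl])
    fix \<xi>
    have "F w \<xi> = complex_of_real (g \<xi>) * cis (2 * pi * (z \<bullet> \<xi>)) * (K w * cis (- (2 * pi * (\<xi> \<bullet> w))))" for w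
    proof -
      have "cis (2 * pi * ((z - w) \<bullet> \<xi>)) = cis (2 * pi * (z \<bullet> \<xi>)) * cis (- (2 * pi * (\<xi> \<bullet> w)))"
        unfolding cis_mult by (simp add: inner_diff_left inner_commute[of w] algebra_simps)
      then show ?thesis by (simp add: F_def)
    qed
    then have "(\<integral>w. F w \<xi> \<partial>lborel) = complex_of_real (g \<xi>) * cis (2 * pi * (z \<bullet> \<xi>)) * complex_of_real (low_cutoff \<rho> ((1 / (2 * r)) *\<^sub>R \<xi>))"
      using fourier_mollifier[OF \<rho>, of "2 * r" \<xi>] r(1) by (simp add: K_def)
    also have "\<dots> = complex_of_real (g \<xi> * low_cutoff \<rho> ((1 / (2 * r)) *\<^sub>R \<xi>)) * cis (2 * pi * (z \<bullet> \<xi>))"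
      by simp
    also have "g \<xi> * low_cutoff \<rho> ((1 / (2 * r)) *\<^sub>R \<xi>) = g \<xi>"
      using low_cutoff_reproduces[OF \<rho>, of "(1 / r) *\<^sub>R \<xi>"] by (simp add: g_def)
    finally show "(\<integral>w. F w \<xi> \<partial>lborel) = complex_of_real (g \<xi>) * cis (2 * pi * (z \<bullet> \<xi>))" .
  qed
  finally show ?thesis by (simp add: kern K_def r)
qed

lemma prod_weight_le_1: "prod_weight a x \<le> 1"
  unfolding prod_weight_def
  by (intro prod_le_1) (auto simp: field_simps add_pos_nonneg)

abbreviation Lp_power :: "real \<Rightarrow> (real^'n::finite \<Rightarrow> complex) \<Rightarrow> ennreal" where
  "Lp_power p f \<equiv> (\<integral>\<^sup>+x. ennreal (norm (f x) powr p) \<partial>lborel)"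

text \<open>The elementary bound \<open>|f| \<le> 1 + |f| powr p\<close> makes Hoelder's inequality unnecessary for
  the absolute convergence of convolutions.\<close>

lemma Lp_prod_weight_bound:
  fixes f :: "real^'n::finite \<Rightarrow> complex"
  assumes [measurable]: "f \<in> borel_measurable borel" and p: "1 \<le> p" and a: "\<And>i. a i > 0"
  shows "(\<integral>\<^sup>+y. ennreal (norm (f y) * prod_weight a (x - y)) \<partial>lborel)
     \<le> ennreal (\<Prod>i\<in>UNIV. pi * a i) + (Lp_power p f)"
proof -
  have "(\<integral>\<^sup>+y. ennreal (norm (f y) * prod_weight a (x - y)) \<partial>lborel)
     \<le> (\<integral>\<^sup>+y. ennreal (prod_weight a (y - x)) + ennreal (norm (f y) powr p) \<partial>lborel)"
  proof (rule nn_integral_mono)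
    fix y
    have w: "prod_weight a (x - y) = prod_weight a (y - x)"
      using prod_weight_uminus[of a "y - x"] by simp
    have "norm (f y) * prod_weight a (y - x) \<le> prod_weight a (y - x) + norm (f y) powr p"
    proof (cases "norm (f y) \<le> 1")
      case True
      then have "norm (f y) * prod_weight a (y - x) \<le> 1 * prod_weight a (y - x)"
        by (intro mult_right_mono prod_weight_nonneg) auto
      then show ?thesis by (simp add: add_increasing2)
    next
      case False
      then have "norm (f y) powr 1 \<le> norm (f y) powr p" using p by (intro powr_mono) auto
      then have "norm (f y) \<le> norm (f y) powr p" using False by simp
      moreover have "norm (f y) * prod_weight a (y - x) \<le> norm (f y) * 1"
        by (intro mult_left_mono prod_weight_le_1) auto
      ultimately show ?thesis using prod_weight_nonneg[of a "y - x"] by linarith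
    qed
    then show "ennreal (norm (f y) * prod_weight a (x - y)) \<le> ennreal (prod_weight a (y - x)) + ennreal (norm (f y) powr p)"
      unfolding w by (subst ennreal_plus[symmetric]) (auto intro: ennreal_leI prod_weight_nonneg)
  qed
  also have "\<dots> = (\<integral>\<^sup>+y. ennreal (prod_weight a (y - x)) \<partial>lborel) + (Lp_power p f)"
    by (rule nn_integral_add) auto
  finally show ?thesis by (simp only: nn_integral_prod_weight[OF a])
qed

lemma in_Lp_measurable: "in_Lp p f \<Longrightarrow> f \<in> borel_measurable borel"
  by (simp add: in_Lp_def)

lemma in_Lp_finite: "in_Lp p f \<Longrightarrow> (Lp_power p f) < \<infinity>"
  by (simp add: in_Lp_def)

text \<open>The bound is uniform in x; \<open>lp_block_reproducing\<close> depends on this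
  uniformity for its use of Fubini's theorem.\<close>

lemma mollifier_abs_convergence:
  fixes f :: "real^'n::finite \<Rightarrow> complex"
  assumes \<rho>: "dyadic_bump \<rho>" and r: "r > 0" and f: "in_Lp p f" and p: "1 \<le> p"
  shows "\<exists>C. \<forall>x. (\<integral>\<^sup>+y. ennreal (norm (f y * mollifier \<rho> r (x - y))) \<partial>lborel) \<le> ennreal C"
proof -
  have [measurable]: "f \<in> borel_measurable borel" by (rule in_Lp_measurable[OF f])
  obtain A where A: "A > 0" "\<And>r z. r > 0 \<Longrightarrow> norm (mollifier \<rho> r z) \<le> A * r ^ CARD('n) * prod_weight (\<lambda>_. 1 / r) z"
    using mollifier_bound[OF \<rho>] by blast
  define B where "B = A * r ^ CARD('n)"
  have B: "B \<ge> 0" using A r by (simp add: B_def)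
  define T where "T = ennreal (\<Prod>i\<in>(UNIV :: 'n set). pi * (1 / r)) + (Lp_power p f)"
  have "T < \<infinity>" using in_Lp_finite[OF f] by (auto simp: T_def)
  have "(\<integral>\<^sup>+y. ennreal (norm (f y * mollifier \<rho> r (x - y))) \<partial>lborel) \<le> ennreal B * T" for x
  proof -
    have "(\<integral>\<^sup>+y. ennreal (norm (f y * mollifier \<rho> r (x - y))) \<partial>lborel)
       \<le> (\<integral>\<^sup>+y. ennreal B * ennreal (norm (f y) * prod_weight (\<lambda>_. 1 / r) (x - y)) \<partial>lborel)"
    proof (rule nn_integral_mono)
      fix y
      have "norm (f y * mollifier \<rho> r (x - y)) \<le> norm (f y) * (B * prod_weight (\<lambda>_. 1 / r) (x - y))"
        unfolding norm_mult B_def using A(2)[OF r] by (intro mult_left_mono) auto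
      then show "ennreal (norm (f y * mollifier \<rho> r (x - y))) \<le> ennreal B * ennreal (norm (f y) * prod_weight (\<lambda>_. 1 / r) (x - y))"
        using B by (subst ennreal_mult[symmetric]) (auto intro!: ennreal_leI mult_nonneg_nonneg prod_weight_nonneg simp: mult_ac)
    qed
    also have "\<dots> = ennreal B * (\<integral>\<^sup>+y. ennreal (norm (f y) * prod_weight (\<lambda>_. 1 / r) (x - y)) \<partial>lborel)"
      by (rule nn_integral_cmult) measurable
    also have "\<dots> \<le> ennreal B * T"
      unfolding T_def using r p by (intro mult_left_mono Lp_prod_weight_bound) auto
    finally show ?thesis .
  qed
  moreover have "ennreal B * T = ennreal (enn2real (ennreal B * T))"
    using \<open>T < \<infinity>\<close> by (subst ennreal_enn2real) (auto simp: ennreal_mult_less_top)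
  ultimately show ?thesis by metis
qed

lemma measurable_mollifier_conv [measurable (raw)]:
  fixes h :: "'a \<Rightarrow> real^'n::finite"
  assumes "dyadic_bump \<rho>" "h \<in> borel_measurable M"
  shows "(\<lambda>x. mollifier \<rho> r (h x)) \<in> borel_measurable M"
  using measurable_compose[OF assms(2) borel_measurable_mollifier[OF assms(1)]] .

lemma integrable_mollifier_conv:
  fixes f :: "real^'n::finite \<Rightarrow> complex"
  assumes \<rho>: "dyadic_bump \<rho>" and r: "r > 0" and f: "in_Lp p f" and p: "1 \<le> p"
  shows "integrable lborel (\<lambda>y. f y * mollifier \<rho> r (x - y))"
proof (rule integrableI_bounded)
  have [measurable]: "f \<in> borel_measurable borel" by (rule in_Lp_measurable[OF f])
  show "(\<lambda>y. f y * mollifier \<rho> r (x - y)) \<in> borel_measurable lborel" using \<rho> by measurable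
  obtain C where C: "\<And>x. (\<integral>\<^sup>+y. ennreal (norm (f y * mollifier \<rho> r (x - y))) \<partial>lborel) \<le> ennreal C"
    using mollifier_abs_convergence[OF assms] by blast
  show "(\<integral>\<^sup>+y. ennreal (norm (f y * mollifier \<rho> r (x - y))) \<partial>lborel) < \<infinity>"
    using C[of x] ennreal_less_top[of C] by (metis infinity_ennreal_def le_less_trans)
qed

lemma borel_measurable_smoothing:
  fixes f :: "real^'n::finite \<Rightarrow> complex"
  assumes \<rho>: "dyadic_bump \<rho>" and [measurable]: "f \<in> borel_measurable borel"
  shows "smoothing \<rho> r f \<in> borel_measurable borel"
proof -
  have "(\<lambda>x. \<integral>y. f y * mollifier \<rho> r (x - y) \<partial>lborel) \<in> borel_measurable borel"
    by (rule lborel.borel_measurable_lebesgue_integral) (use \<rho> in measurable)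
  then show ?thesis by (simp add: smoothing_def[abs_def])
qed

text \<open>In telescoped form: raising the cutoff frequency from 2^(j-1) to 2^j adds exactly the
  block j.\<close>

lemma lp_block_eq_smoothing_diff:
  fixes f :: "real^'n::finite \<Rightarrow> complex"
  assumes \<rho>: "dyadic_bump \<rho>" and f: "in_Lp p f" and p: "1 \<le> p"
  shows "lp_block \<rho> j f x = smoothing \<rho> (2 powr real_of_int j) f x - smoothing \<rho> (2 powr (real_of_int j - 1)) f x"
proof -
  have "lp_block \<rho> j f x = (\<integral>y. f y * mollifier \<rho> (2 powr real_of_int j) (x - y) - f y * mollifier \<rho> (2 powr (real_of_int j - 1)) (x - y) \<partial>lborel)"
    unfolding lp_block_def lp_kernel_eq_mollifier_diff[OF \<rho>] by (simp only: right_diff_distrib)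
  also have "\<dots> = smoothing \<rho> (2 powr real_of_int j) f x - smoothing \<rho> (2 powr (real_of_int j - 1)) f x"
    unfolding smoothing_def by (intro Bochner_Integration.integral_diff integrable_mollifier_conv[OF \<rho> _ f p]) auto
  finally show ?thesis .
qed

lemma borel_measurable_lp_block:
  fixes f :: "real^'n::finite \<Rightarrow> complex"
  assumes \<rho>: "dyadic_bump \<rho>" and f: "in_Lp p f" and p: "1 \<le> p"
  shows "lp_block \<rho> j f \<in> borel_measurable borel"
proof -
  have [measurable]: "smoothing \<rho> r f \<in> borel_measurable borel" for r
    by (rule borel_measurable_smoothing[OF \<rho> in_Lp_measurable[OF f]])
  have "lp_block \<rho> j f = (\<lambda>x. smoothing \<rho> (2 powr real_of_int j) f x - smoothing \<rho> (2 powr (real_of_int j - 1)) f x)"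
    using lp_block_eq_smoothing_diff[OF assms] by auto
  then show ?thesis by simp
qed

text \<open>Associativity of convolution together with \<open>lp_kernel_reproducing\<close>. It
  allows the sampling estimate for mollifications to be applied to the block itself, with the norm
  of the block instead of that of f on the right.\<close>

lemma lp_block_reproducing:
  fixes f :: "real^'n::finite \<Rightarrow> complex"
  assumes \<rho>: "dyadic_bump \<rho>" and f: "in_Lp p f" and p: "1 \<le> p"
  shows "smoothing \<rho> (2 powr (real_of_int j + 1)) (lp_block \<rho> j f) x = lp_block \<rho> j f x"
proof -
  have [measurable]: "f \<in> borel_measurable borel" by (rule in_Lp_measurable[OF f])
  define s where "s = 2 powr real_of_int j"
  define t where "t = 2 powr (real_of_int j - 1)"
  define K where "K = mollifier \<rho> (2 powr (real_of_int j + 1))"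
  have K_int: "integrable lborel K" unfolding K_def by (intro integrable_mollifier \<rho>) auto
  have [measurable]: "K \<in> borel_measurable borel" using K_int by auto
  have kern: "lp_kernel \<rho> j z = mollifier \<rho> s z - mollifier \<rho> t z" for z
    unfolding s_def t_def by (rule lp_kernel_eq_mollifier_diff[OF \<rho>])
  have [measurable]: "(\<lambda>z. lp_kernel \<rho> j z) \<in> borel_measurable borel"
    unfolding kern using \<rho> by measurable
  have meas2: "(\<lambda>z. lp_kernel \<rho> j (h z)) \<in> borel_measurable M" if "h \<in> borel_measurable M" for h M
    using measurable_compose[OF that, of "lp_kernel \<rho> j"] by simp
  have "s > 0" "t > 0" by (auto simp: s_def t_def)
  obtain Cs where Cs: "\<And>x. (\<integral>\<^sup>+y. ennreal (norm (f y * mollifier \<rho> s (x - y))) \<partial>lborel) \<le> ennreal Cs"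
    using mollifier_abs_convergence[OF \<rho> \<open>s > 0\<close> f p] by blast
  obtain Ct where Ct: "\<And>x. (\<integral>\<^sup>+y. ennreal (norm (f y * mollifier \<rho> t (x - y))) \<partial>lborel) \<le> ennreal Ct"
    using mollifier_abs_convergence[OF \<rho> \<open>t > 0\<close> f p] by blast
  have C: "(\<integral>\<^sup>+y. ennreal (norm (f y * lp_kernel \<rho> j (x - y))) \<partial>lborel) \<le> ennreal Cs + ennreal Ct" for x
  proof -
    have "(\<integral>\<^sup>+y. ennreal (norm (f y * lp_kernel \<rho> j (x - y))) \<partial>lborel) \<le>
      (\<integral>\<^sup>+y. ennreal (norm (f y * mollifier \<rho> s (x - y))) + ennreal (norm (f y * mollifier \<rho> t (x - y))) \<partial>lborel)"
      unfolding kern right_diff_distrib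
      by (intro nn_integral_mono) (auto simp: ennreal_plus[symmetric] simp del: ennreal_plus intro!: ennreal_leI norm_triangle_ineq4)
    also have "\<dots> = (\<integral>\<^sup>+y. ennreal (norm (f y * mollifier \<rho> s (x - y))) \<partial>lborel) + (\<integral>\<^sup>+y. ennreal (norm (f y * mollifier \<rho> t (x - y))) \<partial>lborel)"
      by (rule nn_integral_add) (use \<rho> in measurable)
    also have "\<dots> \<le> ennreal Cs + ennreal Ct" by (intro add_mono Cs Ct)
    finally show ?thesis .
  qed
  define F where "F w y = f y * lp_kernel \<rho> j (w - y) * K (x - w)" for w y
  have F_meas: "case_prod F \<in> borel_measurable (lborel \<Otimes>\<^sub>M lborel)"
    unfolding F_def split_beta' by (intro borel_measurable_times meas2) measurable
  have F_int: "integrable (lborel \<Otimes>\<^sub>M lborel) (case_prod F)"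
  proof (rule integrableI_bounded[OF F_meas])
    have "integrable lborel (\<lambda>w. K (x + (-1) *\<^sub>R w))" by (intro integrable_affine_cart K_int) auto
    then have Kx: "(\<integral>\<^sup>+w. ennreal (norm (K (x - w))) \<partial>lborel) < \<infinity>" by (simp add: integrable_iff_bounded)
    have "(\<integral>\<^sup>+q. ennreal (norm (case_prod F q)) \<partial>(lborel \<Otimes>\<^sub>M lborel)) = (\<integral>\<^sup>+w. \<integral>\<^sup>+y. ennreal (norm (F w y)) \<partial>lborel \<partial>lborel)"
      using F_meas by (subst lborel.nn_integral_fst[symmetric]) auto
    also have "\<dots> = (\<integral>\<^sup>+w. (\<integral>\<^sup>+y. ennreal (norm (f y * lp_kernel \<rho> j (w - y))) \<partial>lborel) * ennreal (norm (K (x - w))) \<partial>lborel)"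
    proof (rule nn_integral_cong)
      fix w
      have "(\<lambda>y. lp_kernel \<rho> j (w - y)) \<in> borel_measurable lborel" by (rule meas2) measurable
      then show "(\<integral>\<^sup>+y. ennreal (norm (F w y)) \<partial>lborel) = (\<integral>\<^sup>+y. ennreal (norm (f y * lp_kernel \<rho> j (w - y))) \<partial>lborel) * ennreal (norm (K (x - w)))"
        by (subst nn_integral_multc[symmetric]) (auto simp: F_def norm_mult ennreal_mult)
    qed
    also have "\<dots> \<le> (\<integral>\<^sup>+w. (ennreal Cs + ennreal Ct) * ennreal (norm (K (x - w))) \<partial>lborel)"
      by (intro nn_integral_mono mult_right_mono C) auto
    also have "\<dots> = (ennreal Cs + ennreal Ct) * (\<integral>\<^sup>+w. ennreal (norm (K (x - w))) \<partial>lborel)"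
      by (rule nn_integral_cmult) measurable
    also have "\<dots> < \<infinity>" using Kx by (auto simp: ennreal_mult_less_top)
    finally show "(\<integral>\<^sup>+q. ennreal (norm (case_prod F q)) \<partial>(lborel \<Otimes>\<^sub>M lborel)) < \<infinity>" .
  qed
  have "smoothing \<rho> (2 powr (real_of_int j + 1)) (lp_block \<rho> j f) x = (\<integral>w. \<integral>y. F w y \<partial>lborel \<partial>lborel)"
    unfolding smoothing_def lp_block_def F_def K_def[symmetric] by simp
  also have "\<dots> = (\<integral>y. \<integral>w. F w y \<partial>lborel \<partial>lborel)"
    by (rule lborel_pair.Fubini_integral[OF F_int, symmetric])
  also have "\<dots> = (\<integral>y. f y * lp_kernel \<rho> j (x - y) \<partial>lborel)"
  proof (rule Bochner_Integration.integral_cong[OF refl])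
    fix y
    \<comment> \<open>Measurability for the substitution w to x - w, which brings the inner
      convolution into the form of \<open>lp_kernel_reproducing\<close> at x - y.\<close>
    have m: "(\<lambda>w. lp_kernel \<rho> j (w - y) * K (x - w)) \<in> borel_measurable borel"
      by (intro borel_measurable_times meas2) measurable
    have "(\<integral>w. lp_kernel \<rho> j (w - y) * K (x - w) \<partial>lborel) = (\<integral>w. lp_kernel \<rho> j (x - y - w) * K w \<partial>lborel)"
      using lborel_integral_affine_cart[OF _ m, of "-1" x] by (simp add: algebra_simps)
    also have "\<dots> = lp_kernel \<rho> j (x - y)" unfolding K_def by (rule lp_kernel_reproducing[OF \<rho>])
    finally show "(\<integral>w. F w y \<partial>lborel) = f y * lp_kernel \<rho> j (x - y)"
      by (simp add: F_def mult.assoc)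
  qed
  finally show ?thesis by (simp add: lp_block_def)
qed

text \<open>Of the decay order 3 d + 1, the part 2 d yields a weight of fixed scale 1, and the part
  d + 1, evaluated at |r z| at least r \<open>\<delta>\<close>, beats the factor r ^ d and leaves 1
  / r.\<close>

lemma mollifier_tail_bound:
  fixes \<rho> :: "real^'n::finite \<Rightarrow> real"
  assumes \<rho>: "dyadic_bump \<rho>" and \<delta>: "\<delta> > 0"
  shows "\<exists>C>0. \<forall>r\<ge>1. \<forall>z. \<delta> \<le> norm z \<longrightarrow> norm (mollifier \<rho> r z) \<le> C / r * prod_weight (\<lambda>_. 1) z"
proof -
  define d where "d = CARD('n)"
  obtain A where A: "A > 0" "\<And>z. norm (ift (low_cutoff \<rho>) z) \<le> A / (1 + norm z) ^ (2 * d + (d + 1))"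
    using ift_decay[OF bump_low_cutoff[OF \<rho>]] by blast
  have "norm (mollifier \<rho> r z) \<le> (A / \<delta> ^ (d + 1)) / r * prod_weight (\<lambda>_. 1) z" if r: "r \<ge> 1" and z: "\<delta> \<le> norm z" for r z
  proof -
    have "norm z \<le> r * norm z" using r mult_right_mono[of 1 r "norm z"] by simp
    then have 1: "(1 + norm z) ^ (2 * d) \<le> (1 + r * norm z) ^ (2 * d)" by (intro power_mono) auto
    have "r * \<delta> \<le> r * norm z" using r z by (intro mult_left_mono) auto
    then have "r * \<delta> \<le> 1 + r * norm z" by linarith
    then have 2: "(r * \<delta>) ^ (d + 1) \<le> (1 + r * norm z) ^ (d + 1)" using r \<delta> by (intro power_mono) auto
    have pos: "0 < (1 + norm z) ^ (2 * d) * (r * \<delta>) ^ (d + 1)" using r \<delta> by (intro mult_pos_pos zero_less_power) (auto simp: add_pos_nonneg)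
    have "norm (mollifier \<rho> r z) = r ^ d * norm (ift (low_cutoff \<rho>) (r *\<^sub>R z))"
      using r by (simp add: mollifier_def norm_mult norm_power d_def)
    also have "\<dots> \<le> r ^ d * (A / ((1 + r * norm z) ^ (2 * d) * (1 + r * norm z) ^ (d + 1)))"
    proof (rule mult_left_mono)
      have "norm (r *\<^sub>R z) = r * norm z" using r by simp
      then show "norm (ift (low_cutoff \<rho>) (r *\<^sub>R z)) \<le> A / ((1 + r * norm z) ^ (2 * d) * (1 + r * norm z) ^ (d + 1))"
        using A(2)[of "r *\<^sub>R z"] by (simp only: power_add[symmetric])
    qed (use r in simp)
    also have "\<dots> \<le> r ^ d * (A / ((1 + norm z) ^ (2 * d) * (r * \<delta>) ^ (d + 1)))"
      using r \<delta> A(1) pos 1 2 by (intro mult_left_mono divide_left_mono mult_mono mult_pos_pos zero_less_power) (auto simp: add_pos_nonneg)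
    also have "\<dots> = (A / \<delta> ^ (d + 1)) / r * (1 / (1 + norm z) ^ (2 * d))"
      using r \<delta> by (simp add: power_mult_distrib)
    also have "\<dots> \<le> (A / \<delta> ^ (d + 1)) / r * prod_weight (\<lambda>_. 1) z"
      unfolding d_def using r \<delta> A(1) by (intro mult_left_mono decay_le_prod_weight) auto
    finally show ?thesis .
  qed
  moreover have "A / \<delta> ^ (d + 1) > 0" using A(1) \<delta> by simp
  ultimately show ?thesis by blast
qed

text \<open>Near x the continuity of f is played against the bounded L1 norm of the kernel; away
  from x the tail bound gives 1 / r times a finite integral. Convergence holds at every point, as
  sampling on null sets demands.\<close>

lemma smoothing_tendsto:
  fixes f :: "real^'n::finite \<Rightarrow> complex"
  assumes \<rho>: "dyadic_bump \<rho>" and f: "in_Lp p f" and p: "1 \<le> p" and cont: "continuous_on UNIV f"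
  shows "((\<lambda>r. smoothing \<rho> r f x) \<longlongrightarrow> f x) at_top"
proof (rule tendstoI)
  fix e :: real assume "e > 0"
  have [measurable]: "f \<in> borel_measurable borel" by (rule in_Lp_measurable[OF f])
  obtain A where A: "A > 0" "\<And>r z. r > 0 \<Longrightarrow> norm (mollifier \<rho> r z) \<le> A * r ^ CARD('n) * prod_weight (\<lambda>_. 1 / r) z"
    using mollifier_bound[OF \<rho>] by blast
  \<comment> \<open>A bound for the L1 norm of the mollifier, the same for all r;
    \<open>\<epsilon>\<close> is chosen so that the near part contributes at most e / 2.\<close>
  define I where "I = A * pi ^ CARD('n)"
  have I: "I > 0" using A by (simp add: I_def)
  define \<epsilon> where "\<epsilon> = e / (2 * I)"
  have \<epsilon>: "\<epsilon> > 0" "\<epsilon> * I = e / 2" using I \<open>e > 0\<close> by (auto simp: \<epsilon>_def)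
  obtain \<delta> where \<delta>: "\<delta> > 0" "\<And>y. dist y x < \<delta> \<Longrightarrow> dist (f y) (f x) < \<epsilon>"
    using cont \<epsilon>(1) unfolding continuous_on_iff by (metis UNIV_I)
  obtain C where C: "C > 0" "\<And>r z. r \<ge> 1 \<Longrightarrow> \<delta> \<le> norm z \<Longrightarrow> norm (mollifier \<rho> r z) \<le> C / r * prod_weight (\<lambda>_. 1) z"
    using mollifier_tail_bound[OF \<rho> \<delta>(1)] by blast
  \<comment> \<open>The far part, up to the factor C / r. The weight has the fixed scale 1, so T
    does not depend on r.\<close>
  define T where "T = (\<integral>\<^sup>+y. ennreal ((norm (f y) + norm (f x)) * prod_weight (\<lambda>_. 1) (x - y)) \<partial>lborel)"
  have refl: "prod_weight a (x - y) = prod_weight a (y - x)" for a y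
    using prod_weight_uminus[of a "y - x"] by simp
  have "T = (\<integral>\<^sup>+y. ennreal (norm (f y) * prod_weight (\<lambda>_. 1) (x - y)) + ennreal (norm (f x)) * ennreal (prod_weight (\<lambda>_. 1) (y - x)) \<partial>lborel)"
    unfolding T_def refl
    by (intro nn_integral_cong) (simp add: distrib_right prod_weight_nonneg ennreal_mult[symmetric])
  also have "\<dots> = (\<integral>\<^sup>+y. ennreal (norm (f y) * prod_weight (\<lambda>_. 1) (x - y)) \<partial>lborel) + ennreal (norm (f x)) * (\<integral>\<^sup>+y. ennreal (prod_weight (\<lambda>_. 1) (y - x)) \<partial>lborel)"
    by (subst nn_integral_add) (auto simp: nn_integral_cmult)
  also have "\<dots> < \<infinity>"
    using Lp_prod_weight_bound[of f p "\<lambda>_. 1" x] in_Lp_finite[OF f] p nn_integral_prod_weight[of "\<lambda>_. 1" x]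
    by (auto simp: ennreal_mult[symmetric] ennreal_mult_less_top less_top[symmetric] top_unique)
  finally obtain t where t: "T = ennreal t" "t \<ge> 0" by (cases T) auto
  have main: "norm (smoothing \<rho> r f x - f x) \<le> e / 2 + C * t / r" if r: "r \<ge> 1" for r
  proof -
    have r0: "r > 0" using r by simp
    have mint: "integrable lborel (\<lambda>y. mollifier \<rho> r (x + (-1) *\<^sub>R y))"
      using r0 by (intro integrable_affine_cart integrable_mollifier \<rho>) auto
    have "(\<integral>y. mollifier \<rho> r (x - y) \<partial>lborel) = 1"
      using lborel_integral_affine_cart[OF _ borel_measurable_mollifier[OF \<rho>], of "-1" r x] integral_mollifier[OF \<rho> r0] by simp
    then have "f x = (\<integral>y. f x * mollifier \<rho> r (x - y) \<partial>lborel)" by simp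
    then have "smoothing \<rho> r f x - f x = (\<integral>y. f y * mollifier \<rho> r (x - y) \<partial>lborel) - (\<integral>y. f x * mollifier \<rho> r (x - y) \<partial>lborel)"
      by (simp add: smoothing_def)
    also have "\<dots> = (\<integral>y. f y * mollifier \<rho> r (x - y) - f x * mollifier \<rho> r (x - y) \<partial>lborel)"
      using mint by (intro Bochner_Integration.integral_diff[symmetric] integrable_mollifier_conv[OF \<rho> r0 f p]) simp
    finally have eq: "smoothing \<rho> r f x - f x = (\<integral>y. f y * mollifier \<rho> r (x - y) - f x * mollifier \<rho> r (x - y) \<partial>lborel)" .
    have "integrable lborel (\<lambda>y. f y * mollifier \<rho> r (x - y) - f x * mollifier \<rho> r (x - y))"
      using mint by (intro Bochner_Integration.integrable_diff integrable_mollifier_conv[OF \<rho> r0 f p]) simp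
    then have "ennreal (norm (smoothing \<rho> r f x - f x)) \<le> (\<integral>\<^sup>+y. norm (f y * mollifier \<rho> r (x - y) - f x * mollifier \<rho> r (x - y)) \<partial>lborel)"
      unfolding eq by (rule integral_norm_bound_ennreal)
    also have "\<dots> \<le> (\<integral>\<^sup>+y. ennreal (\<epsilon> * A * r ^ CARD('n)) * ennreal (prod_weight (\<lambda>_. 1 / r) (y - x))
        + ennreal (C / r) * ennreal ((norm (f y) + norm (f x)) * prod_weight (\<lambda>_. 1) (x - y)) \<partial>lborel)"
    proof (rule nn_integral_mono)
      fix y
      have n: "norm (f y * mollifier \<rho> r (x - y) - f x * mollifier \<rho> r (x - y)) = norm (f y - f x) * norm (mollifier \<rho> r (x - y))"
        by (simp add: left_diff_distrib[symmetric] norm_mult)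
      have p1: "0 \<le> \<epsilon> * A * r ^ CARD('n) * prod_weight (\<lambda>_. 1 / r) (y - x)"
        using \<epsilon> A r0 by (intro mult_nonneg_nonneg prod_weight_nonneg) auto
      have p2: "0 \<le> (C / r) * ((norm (f y) + norm (f x)) * prod_weight (\<lambda>_. 1) (x - y))"
        using C r0 by (intro mult_nonneg_nonneg prod_weight_nonneg) auto
      have "norm (f y * mollifier \<rho> r (x - y) - f x * mollifier \<rho> r (x - y)) \<le> \<epsilon> * A * r ^ CARD('n) * prod_weight (\<lambda>_. 1 / r) (y - x)
         + (C / r) * ((norm (f y) + norm (f x)) * prod_weight (\<lambda>_. 1) (x - y))"
      proof (cases "dist y x < \<delta>")
        case True
        have "norm (f y - f x) * norm (mollifier \<rho> r (x - y)) \<le> \<epsilon> * (A * r ^ CARD('n) * prod_weight (\<lambda>_. 1 / r) (x - y))"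
          using \<delta>(2)[OF True] \<epsilon>(1) A(2)[OF r0] by (intro mult_mono) (auto simp: dist_norm)
        then show ?thesis using p2 unfolding n refl by (simp add: mult.assoc)
      next
        case False
        then have "\<delta> \<le> norm (x - y)" by (simp add: dist_norm norm_minus_commute)
        then have "norm (f y - f x) * norm (mollifier \<rho> r (x - y)) \<le> (norm (f y) + norm (f x)) * (C / r * prod_weight (\<lambda>_. 1) (x - y))"
          using C(2)[OF r] by (intro mult_mono norm_triangle_ineq4) auto
        then show ?thesis using p1 unfolding n by (simp add: mult_ac)
      qed
      then have "ennreal (norm (f y * mollifier \<rho> r (x - y) - f x * mollifier \<rho> r (x - y))) \<le>
          ennreal (\<epsilon> * A * r ^ CARD('n) * prod_weight (\<lambda>_. 1 / r) (y - x)) + ennreal ((C / r) * ((norm (f y) + norm (f x)) * prod_weight (\<lambda>_. 1) (x - y)))"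
        unfolding ennreal_plus[OF p1 p2, symmetric] by (rule ennreal_leI)
      moreover have "ennreal (\<epsilon> * A * r ^ CARD('n) * prod_weight (\<lambda>_. 1 / r) (y - x)) = ennreal (\<epsilon> * A * r ^ CARD('n)) * ennreal (prod_weight (\<lambda>_. 1 / r) (y - x))"
        using \<epsilon> A r0 by (intro ennreal_mult prod_weight_nonneg mult_nonneg_nonneg) auto
      moreover have "ennreal ((C / r) * ((norm (f y) + norm (f x)) * prod_weight (\<lambda>_. 1) (x - y))) = ennreal (C / r) * ennreal ((norm (f y) + norm (f x)) * prod_weight (\<lambda>_. 1) (x - y))"
        using C r0 by (intro ennreal_mult prod_weight_nonneg mult_nonneg_nonneg) auto
      ultimately show "ennreal (norm (f y * mollifier \<rho> r (x - y) - f x * mollifier \<rho> r (x - y))) \<le>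
          ennreal (\<epsilon> * A * r ^ CARD('n)) * ennreal (prod_weight (\<lambda>_. 1 / r) (y - x))
        + ennreal (C / r) * ennreal ((norm (f y) + norm (f x)) * prod_weight (\<lambda>_. 1) (x - y))" by simp
    qed
    also have "\<dots> = ennreal (\<epsilon> * A * r ^ CARD('n)) * (\<integral>\<^sup>+y. ennreal (prod_weight (\<lambda>_. 1 / r) (y - x)) \<partial>lborel) + ennreal (C / r) * T"
      unfolding T_def by (subst nn_integral_add) (auto simp: nn_integral_cmult)
    also have "\<dots> = ennreal (\<epsilon> * A * r ^ CARD('n)) * ennreal (\<Prod>i\<in>(UNIV :: 'n set). pi * (1 / r)) + ennreal (C / r) * ennreal t"
      using r0 by (simp add: nn_integral_prod_weight t)
    also have "\<dots> = ennreal (e / 2 + C * t / r)"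
    proof -
      have "\<epsilon> * A * r ^ CARD('n) * (\<Prod>i\<in>(UNIV :: 'n set). pi * (1 / r)) = e / 2"
        using r0 \<epsilon>(2) by (simp add: I_def power_divide mult.assoc)
      then have "ennreal (\<epsilon> * A * r ^ CARD('n)) * ennreal (\<Prod>i\<in>(UNIV :: 'n set). pi * (1 / r)) = ennreal (e / 2)"
        using \<epsilon> A r0 by (subst ennreal_mult[symmetric]) (auto intro!: prod_nonneg)
      moreover have "ennreal (C / r) * ennreal t = ennreal (C * t / r)"
        using C t r0 by (subst ennreal_mult[symmetric]) auto
      ultimately show ?thesis using C t r0 \<open>e > 0\<close> by (simp add: ennreal_plus[symmetric] del: ennreal_plus)
    qed
    finally show ?thesis using C t r0 \<open>e > 0\<close> by (subst (asm) ennreal_le_iff) auto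
  qed
  have "\<forall>\<^sub>F r in at_top. r \<ge> max 1 (4 * C * t / e)" by (rule eventually_ge_at_top)
  then show "\<forall>\<^sub>F r in at_top. dist (smoothing \<rho> r f x) (f x) < e"
  proof eventually_elim
    case (elim r)
    then have "r \<ge> 1" "C * t / r \<le> e / 4"
      using \<open>e > 0\<close> by (auto simp: field_simps)
    then have "norm (smoothing \<rho> r f x - f x) \<le> e / 2 + e / 4" using main[of r] by linarith
    then show ?case using \<open>e > 0\<close> by (simp add: dist_norm)
  qed
qed

section \<open>Sampling on the cells of a cube cover\<close>

text \<open>The covering hypothesis restated for cylinders in the full space: every point lies in at
  least 1 and at most D cells. Countability makes the counting measure on E sigma-finite.\<close>

definition cube_cover :: "'n::finite set \<Rightarrow> (real^'n) set \<Rightarrow> real \<Rightarrow> nat \<Rightarrow> bool" where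
  "cube_cover S E b D \<longleftrightarrow> countable E \<and>
     (\<forall>x. finite {e \<in> E. x \<in> cylinder S e b} \<and> 1 \<le> card {e \<in> E. x \<in> cylinder S e b} \<and> card {e \<in> E. x \<in> cylinder S e b} \<le> D)"

text \<open>Using pairs (e, x) lets cells overlap: each x is weighted by the number of cells that
  contain it, and no disjoint partition is chosen.\<close>

abbreviation cell_measure :: "(real^'n::finite) set \<Rightarrow> ((real^'n) \<times> (real^'n)) measure" where
  "cell_measure E \<equiv> count_space E \<Otimes>\<^sub>M lborel"

abbreviation cell_integral :: "'n::finite set \<Rightarrow> (real^'n) set \<Rightarrow> real \<Rightarrow> (real^'n \<Rightarrow> real^'n \<Rightarrow> ennreal) \<Rightarrow> ennreal" where
  "cell_integral S E b F \<equiv> (\<integral>\<^sup>+(e, x). F e x * indicator (cylinder S e b) x \<partial>cell_measure E)"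

lemma pair_sigma_finite_cell: "countable E \<Longrightarrow> pair_sigma_finite (count_space E) (lborel :: (real^'n::finite) measure)"
  by (intro pair_sigma_finite.intro sigma_finite_measure_count_space_countable lborel.sigma_finite_measure_axioms)

lemma sigma_finite_cell:
  assumes "countable E" shows "sigma_finite_measure (cell_measure E)"
proof -
  interpret pair_sigma_finite "count_space E" "lborel :: (real^'n) measure" by (rule pair_sigma_finite_cell[OF assms])
  show ?thesis by unfold_locales
qed

lemma measurable_cell:
  "countable E \<Longrightarrow> (\<And>e. e \<in> E \<Longrightarrow> (\<lambda>x. F e x) \<in> borel \<rightarrow>\<^sub>M N) \<Longrightarrow> (\<lambda>(e, x). F e x) \<in> cell_measure E \<rightarrow>\<^sub>M N"
  by (rule measurable_pair_measure_countable1) auto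

lemma measurable_cell_pair:
  fixes F :: "(real^'n::finite) \<Rightarrow> (real^'n) \<Rightarrow> 'c::topological_space \<Rightarrow> 'd::topological_space"
  assumes "countable E" "\<And>e. e \<in> E \<Longrightarrow> (\<lambda>(x, y). F e x y) \<in> borel \<Otimes>\<^sub>M N \<rightarrow>\<^sub>M borel"
  shows "(\<lambda>((e, x), y). F e x y) \<in> borel_measurable (cell_measure E \<Otimes>\<^sub>M N)"
proof -
  have meas: "(\<lambda>q. F e (snd (fst q)) (snd q)) \<in> borel_measurable (cell_measure E \<Otimes>\<^sub>M N)" if "e \<in> E" for e
  proof -
    have "(\<lambda>q. (snd (fst q), snd q)) \<in> cell_measure E \<Otimes>\<^sub>M N \<rightarrow>\<^sub>M borel \<Otimes>\<^sub>M N" by measurable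
    from measurable_compose[OF this assms(2)[OF that]] show ?thesis by simp
  qed
  have "(\<lambda>q. F (fst (fst q)) (snd (fst q)) (snd q)) \<in> borel_measurable (cell_measure E \<Otimes>\<^sub>M N)"
    by (rule measurable_compose_countable'[where I = E and f = "\<lambda>e q. F e (snd (fst q)) (snd q)" and g = "\<lambda>q. fst (fst q)", OF meas _ assms(1)]) measurable
  then show ?thesis by (simp add: split_beta')
qed

lemma nn_integral_cell_multiplicity:
  assumes E: "cube_cover S E b D" and [measurable]: "h \<in> borel_measurable borel"
  shows "(cell_integral S E b (\<lambda>e x. h x))
     = (\<integral>\<^sup>+x. h x * of_nat (card {e \<in> E. x \<in> cylinder S e b}) \<partial>lborel)"
proof -
  have cE: "countable E" using E by (simp add: cube_cover_def)
  interpret pair_sigma_finite "count_space E" "lborel :: (real^'a) measure" by (rule pair_sigma_finite_cell[OF cE])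
  have meas: "(\<lambda>(e, x). h x * indicator (cylinder S e b) x) \<in> borel_measurable (cell_measure E)"
    by (rule measurable_cell[OF cE]) measurable
  have "(cell_integral S E b (\<lambda>e x. h x))
     = (\<integral>\<^sup>+x. \<integral>\<^sup>+e. h x * indicator (cylinder S e b) x \<partial>count_space E \<partial>lborel)"
    using nn_integral_snd[OF meas] by simp
  also have "\<dots> = (\<integral>\<^sup>+x. h x * of_nat (card {e \<in> E. x \<in> cylinder S e b}) \<partial>lborel)"
  proof (rule nn_integral_cong)
    fix x
    have fin: "finite {e \<in> E. x \<in> cylinder S e b}" using E by (simp add: cube_cover_def)
    have "(\<integral>\<^sup>+e. h x * indicator (cylinder S e b) x \<partial>count_space E) = h x * (\<integral>\<^sup>+e. indicator {e \<in> E. x \<in> cylinder S e b} e \<partial>count_space E)"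
      by (subst nn_integral_cmult[symmetric]) (auto intro!: nn_integral_cong simp: indicator_def)
    also have "(\<integral>\<^sup>+e. indicator {e \<in> E. x \<in> cylinder S e b} e \<partial>count_space E) = emeasure (count_space E) {e \<in> E. x \<in> cylinder S e b}"
      by (rule nn_integral_indicator) auto
    also have "\<dots> = of_nat (card {e \<in> E. x \<in> cylinder S e b})"
      using fin by (intro emeasure_count_space_finite) auto
    finally show "(\<integral>\<^sup>+e. h x * indicator (cylinder S e b) x \<partial>count_space E) = h x * of_nat (card {e \<in> E. x \<in> cylinder S e b})" .
  qed
  finally show ?thesis .
qed

lemma
  assumes E: "cube_cover S E b D" and h[measurable]: "h \<in> borel_measurable borel"
  shows nn_integral_cell_le: "(cell_integral S E b (\<lambda>e x. h x)) \<le> of_nat D * (\<integral>\<^sup>+x. h x \<partial>lborel)"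
    and nn_integral_cell_ge: "(\<integral>\<^sup>+x. h x \<partial>lborel) \<le> (cell_integral S E b (\<lambda>e x. h x))"
proof -
  have "(\<integral>\<^sup>+x. h x * of_nat (card {e \<in> E. x \<in> cylinder S e b}) \<partial>lborel) \<le> (\<integral>\<^sup>+x. of_nat D * h x \<partial>lborel)"
  proof (rule nn_integral_mono)
    fix x
    have "card {e \<in> E. x \<in> cylinder S e b} \<le> D" using E by (simp add: cube_cover_def)
    then have "(of_nat (card {e \<in> E. x \<in> cylinder S e b}) :: ennreal) \<le> of_nat D" by (rule of_nat_mono)
    then show "h x * of_nat (card {e \<in> E. x \<in> cylinder S e b}) \<le> of_nat D * h x"
      unfolding mult.commute[of "of_nat D"] by (rule mult_left_mono) simp
  qed
  also have "\<dots> = of_nat D * (\<integral>\<^sup>+x. h x \<partial>lborel)" by (rule nn_integral_cmult) simp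
  finally show "(cell_integral S E b (\<lambda>e x. h x)) \<le> of_nat D * (\<integral>\<^sup>+x. h x \<partial>lborel)"
    unfolding nn_integral_cell_multiplicity[OF E h] .
  have "(\<integral>\<^sup>+x. h x * 1 \<partial>lborel) \<le> (\<integral>\<^sup>+x. h x * of_nat (card {e \<in> E. x \<in> cylinder S e b}) \<partial>lborel)"
  proof (intro nn_integral_mono mult_left_mono)
    fix x
    have "1 \<le> card {e \<in> E. x \<in> cylinder S e b}" using E by (simp add: cube_cover_def)
    then have "(of_nat 1 :: ennreal) \<le> of_nat (card {e \<in> E. x \<in> cylinder S e b})" by (rule of_nat_mono)
    then show "(1 :: ennreal) \<le> of_nat (card {e \<in> E. x \<in> cylinder S e b})" by simp
  qed simp
  then show "(\<integral>\<^sup>+x. h x \<partial>lborel) \<le> (cell_integral S E b (\<lambda>e x. h x))"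
    unfolding nn_integral_cell_multiplicity[OF E h] by simp
qed

text \<open>At a sampling point the weight of scale \<open>1 / r\<close> is dominated by the weight at an arbitrary
  point of the cell, once the scale in the sampled directions is at least the cell size \<open>b\<close>.\<close>

lemma prod_weight_graft_le:
  fixes S :: "'n::finite set"
  assumes r: "r > 0" and b: "b > 0" and x: "x \<in> cylinder S e b"
  shows "prod_weight (\<lambda>_. 1 / r) (graft S e x - w) \<le> 3 ^ CARD('n) * prod_weight (\<lambda>i. if i \<in> S then max b (1 / r) else 1 / r) (x - w)"
proof -
  define a where "a = max b (1 / r)"
  have a: "a > 0" "b / a \<le> 1" "1 \<le> r * a"
    using r b by (auto simp: a_def field_simps max_def)
  have "prod_weight (\<lambda>_. 1 / r) (graft S e x - w) \<le> (\<Prod>i\<in>UNIV. 3 * inverse (1 + ((x - w) $ i / (if i \<in> S then a else 1 / r))\<^sup>2))"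
    unfolding prod_weight_def
  proof (rule prod_mono)
    fix i
    have "inverse (1 + ((graft S e x - w) $ i / (1 / r))\<^sup>2) \<le> 3 * inverse (1 + ((x - w) $ i / (if i \<in> S then a else 1 / r))\<^sup>2)"
    proof (cases "i \<in> S")
      case True
      \<comment> \<open>The scaled distance of the sampling point from w. Since the widened scale a
        is at least b and at least 1 / r, moving to x changes the scaled distance to at most 1 +
        u.\<close>
      define u where "u = r * \<bar>e $ i - w $ i\<bar>"
      have u: "u \<ge> 0" using r by (simp add: u_def)
      have "\<bar>x $ i - e $ i\<bar> \<le> b" using x True by (auto simp: cylinder_def)
      then have "\<bar>x $ i - w $ i\<bar> \<le> b + \<bar>e $ i - w $ i\<bar>" by linarith
      then have "\<bar>x $ i - w $ i\<bar> / a \<le> b / a + \<bar>e $ i - w $ i\<bar> / a"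
        using a by (simp add: add_divide_distrib[symmetric] divide_right_mono)
      also have "\<bar>e $ i - w $ i\<bar> / a \<le> u"
        using a mult_right_mono[OF a(3), of "\<bar>e $ i - w $ i\<bar>"] by (simp add: u_def field_simps)
      finally have "\<bar>x $ i - w $ i\<bar> / a \<le> 1 + u" using a(2) by linarith
      then have "((x $ i - w $ i) / a)\<^sup>2 \<le> (1 + u)\<^sup>2"
        using a u by (intro abs_le_square_iff[THEN iffD1]) simp
      also have "\<dots> \<le> 2 + 2 * u\<^sup>2" using sum_squares_bound[of 1 u] by (simp add: power2_sum)
      finally have le2: "((x $ i - w $ i) / a)\<^sup>2 \<le> 2 + 2 * u\<^sup>2" .
      \<comment> \<open>The factor 3 per coordinate arises here.\<close>
      have gen: "1 + X \<le> 3 * (1 + Y)" if "X \<le> 2 + 2 * Y" "0 \<le> Y" for X Y :: real using that by simp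
      have "1 + ((x $ i - w $ i) / a)\<^sup>2 \<le> 3 * (1 + u\<^sup>2)" by (rule gen[OF le2]) simp
      then have "inverse (3 * (1 + u\<^sup>2)) \<le> inverse (1 + ((x $ i - w $ i) / a)\<^sup>2)"
        by (intro le_imp_inverse_le) (auto simp: add_pos_nonneg)
      moreover have "inverse (1 + u\<^sup>2) = 3 * inverse (3 * (1 + u\<^sup>2))"
        by (simp only: inverse_mult_distrib) simp
      ultimately have "inverse (1 + u\<^sup>2) \<le> 3 * inverse (1 + ((x $ i - w $ i) / a)\<^sup>2)" by linarith
      moreover have "((graft S e x - w) $ i / (1 / r))\<^sup>2 = u\<^sup>2"
        using True by (simp add: u_def power_mult_distrib mult.commute)
      ultimately show ?thesis using True by simp
    next
      case False
      have "0 \<le> inverse (1 + ((x - w) $ i / (1 / r))\<^sup>2)" by (simp add: add_nonneg_nonneg)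
      then show ?thesis using False by simp
    qed
    then show "0 \<le> inverse (1 + ((graft S e x - w) $ i / (1 / r))\<^sup>2) \<and>
        inverse (1 + ((graft S e x - w) $ i / (1 / r))\<^sup>2) \<le> 3 * inverse (1 + ((x - w) $ i / (if i \<in> S then a else 1 / r))\<^sup>2)"
      by (simp add: add_nonneg_nonneg)
  qed
  then show ?thesis unfolding a_def[symmetric] by (simp add: prod.distrib prod_weight_def)
qed

text \<open>Widening each sampled coordinate from 1 / r to max b (1 / r) multiplies the integral by
  max 1 (r b), once for every element of S. After the p-th root this is the exponent m / p of the
  theorem.\<close>

lemma nn_integral_cell_weight:
  fixes S :: "'n::finite set"
  assumes E: "cube_cover S E b D" and r: "r > 0" and b: "b > 0"
  shows "(cell_integral S E b (\<lambda>e x. ennreal (r ^ CARD('n) * prod_weight (\<lambda>_. 1 / r) (graft S e x - w))))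
     \<le> ennreal (D * (3 * pi) ^ CARD('n) * max 1 (r * b) ^ card S)"
proof -
  define a where "a i = (if i \<in> S then max b (1 / r) else 1 / r)" for i
  have a: "a i > 0" for i using r b by (auto simp: a_def)
  define c where "c = r ^ CARD('n) * 3 ^ CARD('n)"
  have c: "c \<ge> 0" using r by (simp add: c_def)
  have "(cell_integral S E b (\<lambda>e x. ennreal (r ^ CARD('n) * prod_weight (\<lambda>_. 1 / r) (graft S e x - w))))
     \<le> (cell_integral S E b (\<lambda>e x. ennreal (c * prod_weight a (x - w))))"
  proof (rule nn_integral_mono, clarify)
    fix e x
    have "r ^ CARD('n) * prod_weight (\<lambda>_. 1 / r) (graft S e x - w) \<le> c * prod_weight a (x - w)" if "x \<in> cylinder S e b"
      unfolding c_def a_def mult.assoc using r by (intro mult_left_mono prod_weight_graft_le[OF r b that]) auto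
    then show "ennreal (r ^ CARD('n) * prod_weight (\<lambda>_. 1 / r) (graft S e x - w)) * indicator (cylinder S e b) x
       \<le> ennreal (c * prod_weight a (x - w)) * indicator (cylinder S e b) x"
      by (cases "x \<in> cylinder S e b") (auto intro: ennreal_leI)
  qed
  also have "\<dots> \<le> of_nat D * (\<integral>\<^sup>+x. ennreal (c * prod_weight a (x - w)) \<partial>lborel)"
    by (rule nn_integral_cell_le[OF E]) measurable
  also have "(\<integral>\<^sup>+x. ennreal (c * prod_weight a (x - w)) \<partial>lborel) = ennreal c * ennreal (\<Prod>i\<in>UNIV. pi * a i)"
    using c nn_integral_prod_weight[OF a, where w = w] by (simp add: ennreal_mult prod_weight_nonneg nn_integral_cmult)
  also have "of_nat D * (ennreal c * ennreal (\<Prod>i\<in>UNIV. pi * a i)) = ennreal (D * (c * (\<Prod>i\<in>UNIV. pi * a i)))"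
    using a c by (simp add: ennreal_mult ennreal_of_nat_eq_real_of_nat prod_nonneg less_imp_le)
  also have "c * (\<Prod>i\<in>UNIV. pi * a i) = (\<Prod>i\<in>UNIV. (3 * pi) * (if i \<in> S then max 1 (r * b) else 1))"
  proof -
    have "c * (\<Prod>i\<in>UNIV. pi * a i) = (\<Prod>i\<in>(UNIV :: 'n set). (r * 3) * (pi * a i))"
      by (simp add: prod.distrib c_def)
    also have "\<dots> = (\<Prod>i\<in>UNIV. (3 * pi) * (if i \<in> S then max 1 (r * b) else 1))"
    proof (rule prod.cong[OF refl])
      fix i :: 'n
      have ra: "r * a i = (if i \<in> S then max 1 (r * b) else 1)"
        using r by (auto simp: a_def max_def field_simps)
      have "(r * 3) * (pi * a i) = (3 * pi) * (r * a i)" by (simp only: mult_ac)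
      then show "(r * 3) * (pi * a i) = (3 * pi) * (if i \<in> S then max 1 (r * b) else 1)"
        unfolding ra .
    qed
    finally show ?thesis .
  qed
  also have "\<dots> = (3 * pi) ^ CARD('n) * max 1 (r * b) ^ card S"
    by (simp only: prod.distrib prod_split_card) simp
  finally show ?thesis by (simp add: mult.assoc)
qed

lemma nn_integral_reflected_weight:
  fixes z :: "real^'n::finite"
  assumes "r > 0"
  shows "(\<integral>\<^sup>+y. ennreal (r ^ CARD('n) * prod_weight (\<lambda>_. 1 / r) (z - y)) \<partial>lborel) = ennreal (pi ^ CARD('n))"
proof -
  have refl: "prod_weight a (z - y) = prod_weight a (y - z)" for a y
    using prod_weight_uminus[of a "y - z"] by simp
  have "(\<integral>\<^sup>+y. ennreal (r ^ CARD('n) * prod_weight (\<lambda>_. 1 / r) (z - y)) \<partial>lborel)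
     = ennreal (r ^ CARD('n)) * ennreal (\<Prod>i\<in>(UNIV :: 'n set). pi * (1 / r))"
    unfolding refl using assms nn_integral_prod_weight[of "\<lambda>_. 1 / r" z]
    by (simp add: ennreal_mult prod_weight_nonneg nn_integral_cmult)
  also have "\<dots> = ennreal (pi ^ CARD('n))"
    using assms by (simp add: ennreal_mult[symmetric] power_divide)
  finally show ?thesis .
qed

lemma pair_vec_borel_measurable:
  fixes F :: "(real^'n::finite) \<times> (real^'n) \<Rightarrow> real"
  assumes "continuous_on UNIV F"
  shows "F \<in> borel_measurable (borel \<Otimes>\<^sub>M lborel)"
proof -
  have "sets (borel \<Otimes>\<^sub>M lborel) = sets (borel \<Otimes>\<^sub>M borel :: ((real^'n) \<times> (real^'n)) measure)"
    by (rule sets_pair_measure_cong) simp_all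
  also have "\<dots> = sets borel" by (simp only: borel_prod)
  finally show ?thesis
    using borel_measurable_continuous_onI[OF assms] measurable_cong_sets[OF _ refl] by blast
qed

text \<open>The Schur test with the pair (e, x) as first variable. The indicator of the cell is
  moved into the kernel and into U, so the bounds on k and U are required only for x in the cell of
  e.\<close>

lemma cell_Schur:
  fixes k :: "real^'n::finite \<Rightarrow> real^'n \<Rightarrow> real^'n \<Rightarrow> real" and f :: "real^'n \<Rightarrow> complex"
    and U :: "real^'n \<Rightarrow> real^'n \<Rightarrow> real"
  assumes cE: "countable E" and p: "1 \<le> p" and f: "f \<in> borel_measurable borel"
    and kcont: "\<And>e. continuous_on UNIV (\<lambda>(x, y). k e x y)" and k0: "\<And>e x y. 0 \<le> k e x y"
    and U0: "\<And>e x. 0 \<le> U e x" and pos: "0 < K1" "0 \<le> K2"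
    and K1: "\<And>e x. x \<in> cylinder S e b \<Longrightarrow> (\<integral>\<^sup>+y. ennreal (k e x y) \<partial>lborel) \<le> ennreal K1"
    and K2: "\<And>y. (cell_integral S E b (\<lambda>e x. ennreal (k e x y))) \<le> ennreal K2"
    and U: "\<And>e x. x \<in> cylinder S e b \<Longrightarrow> ennreal (U e x) \<le> (\<integral>\<^sup>+y. ennreal (norm (f y) * k e x y) \<partial>lborel)"
  shows "(cell_integral S E b (\<lambda>e x. ennreal (U e x powr p)))
      \<le> ennreal (K1 powr (p - 1) * K2) * (Lp_power p f)"
proof -
  have [measurable]: "f \<in> borel_measurable borel" by fact
  define ind where "ind e x = (indicator (cylinder S e b) x :: real)" for e x
  define k' where "k' q y = ind (fst q) (snd q) * k (fst q) (snd q) y" for q y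
  define U' where "U' q = ind (fst q) (snd q) * U (fst q) (snd q)" for q
  have k'_meas: "(\<lambda>(q, y). k' q y) \<in> borel_measurable (cell_measure E \<Otimes>\<^sub>M lborel)"
  proof -
    have "(\<lambda>((e, x), y). ind e x * k e x y) \<in> borel_measurable (cell_measure E \<Otimes>\<^sub>M lborel)"
    proof (rule measurable_cell_pair[OF cE])
      fix e
      have [measurable]: "(\<lambda>q. k e (fst q) (snd q)) \<in> borel_measurable (borel \<Otimes>\<^sub>M lborel)"
        using pair_vec_borel_measurable[OF kcont[of e]] by (simp add: split_beta')
      show "(\<lambda>(x, y). ind e x * k e x y) \<in> borel_measurable (borel \<Otimes>\<^sub>M lborel)"
        unfolding split_beta' ind_def by measurable
    qed
    then show ?thesis by (simp add: k'_def split_beta')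
  qed
  have "(\<integral>\<^sup>+q. ennreal (U' q powr p) \<partial>cell_measure E) \<le> ennreal (K1 powr (p - 1) * K2) * (Lp_power p f)"
  proof (rule Schur_test[OF sigma_finite_cell[OF cE] lborel.sigma_finite_measure_axioms p k'_meas])
    show "0 \<le> k' q y" for q y by (simp add: k'_def ind_def k0)
    show "0 \<le> U' q" for q by (simp add: U'_def ind_def U0)
    show "(\<integral>\<^sup>+y. ennreal (k' q y) \<partial>lborel) \<le> ennreal K1" for q
      using K1[of "snd q" "fst q"] by (cases "snd q \<in> cylinder S (fst q) b") (auto simp: k'_def ind_def)
    show "(\<integral>\<^sup>+q. ennreal (k' q y) \<partial>cell_measure E) \<le> ennreal K2" for y
    proof -
      have "(\<integral>\<^sup>+q. ennreal (k' q y) \<partial>cell_measure E) = (cell_integral S E b (\<lambda>e x. ennreal (k e x y)))"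
        by (intro nn_integral_cong) (auto simp: k'_def ind_def indicator_def)
      then show ?thesis using K2[of y] by simp
    qed
    show "ennreal (U' q) \<le> (\<integral>\<^sup>+y. ennreal (norm (f y) * k' q y) \<partial>lborel)" for q
      using U[of "snd q" "fst q"] by (cases "snd q \<in> cylinder S (fst q) b") (auto simp: U'_def k'_def ind_def)
  qed (use pos in auto)
  moreover have "(\<integral>\<^sup>+q. ennreal (U' q powr p) \<partial>cell_measure E) = (cell_integral S E b (\<lambda>e x. ennreal (U e x powr p)))"
    using p by (intro nn_integral_cong) (auto simp: U'_def ind_def indicator_def)
  ultimately show ?thesis by simp
qed

lemma continuous_on_mollifier_compose [continuous_intros]:
  "dyadic_bump \<rho> \<Longrightarrow> continuous_on A h \<Longrightarrow> continuous_on A (\<lambda>x. mollifier \<rho> r (h x))"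
  by (rule continuous_on_compose2[OF continuous_on_mollifier]) auto

lemma norm_smoothing_le:
  assumes "dyadic_bump \<rho>" "r > 0" "in_Lp p f" "1 \<le> p"
  shows "ennreal (norm (smoothing \<rho> r f x)) \<le> (\<integral>\<^sup>+y. ennreal (norm (f y) * norm (mollifier \<rho> r (x - y))) \<partial>lborel)"
  using integral_norm_bound_ennreal[OF integrable_mollifier_conv[OF assms, of x]] by (simp add: smoothing_def norm_mult)

text \<open>In the Schur test the integral over y is independent of r, because the sampled kernel is
  a translate; only the integral over the cells, from \<open>nn_integral_cell_weight\<close>, grows
  with r b.\<close>

lemma sampled_smoothing_bound:
  fixes \<rho> :: "real^'n::finite \<Rightarrow> real"
  assumes \<rho>: "dyadic_bump \<rho>" and p: "1 \<le> p"
  shows "\<exists>C>0. \<forall>S E b r (f :: real^'n \<Rightarrow> complex). cube_cover S E b D \<and> b > 0 \<and> r > 0 \<and> in_Lp p f \<longrightarrow>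
     (cell_integral S E b (\<lambda>e x. ennreal (norm (smoothing \<rho> r f (graft S e x)) powr p)))
      \<le> ennreal (C * max 1 (r * b) ^ card S) * (Lp_power p f)"
proof -
  obtain A where A: "A > 0" "\<And>r z. r > 0 \<Longrightarrow> norm (mollifier \<rho> r z) \<le> A * r ^ CARD('n) * prod_weight (\<lambda>_. 1 / r) z"
    using mollifier_bound[OF \<rho>] by blast
  define K where "K = A * pi ^ CARD('n)"
  have K: "K > 0" using A by (simp add: K_def)
  define C where "C = K powr (p - 1) * (A * (D * (3 * pi) ^ CARD('n)))"
  have C0: "C \<ge> 0" using A by (simp add: C_def)
  have main: "(cell_integral S E b (\<lambda>e x. ennreal (norm (smoothing \<rho> r f (graft S e x)) powr p)))
      \<le> ennreal (C * max 1 (r * b) ^ card S) * (Lp_power p f)"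
    if E: "cube_cover S E b D" and b: "b > 0" and r: "r > 0" and f: "in_Lp p f"
    for S E b r and f :: "real^'n \<Rightarrow> complex"
  proof -
    define K2 where "K2 = A * (D * (3 * pi) ^ CARD('n) * max 1 (r * b) ^ card S)"
    have "(cell_integral S E b (\<lambda>e x. ennreal (norm (smoothing \<rho> r f (graft S e x)) powr p)))
        \<le> ennreal (K powr (p - 1) * K2) * (Lp_power p f)"
    proof (rule cell_Schur[where k = "\<lambda>e x y. norm (mollifier \<rho> r (graft S e x - y))"])
      show "countable E" using E by (simp add: cube_cover_def)
      show "continuous_on UNIV (\<lambda>(x, y). norm (mollifier \<rho> r (graft S e x - y)))" for e
        unfolding split_beta' by (intro continuous_intros \<rho>)
      show "(\<integral>\<^sup>+y. ennreal (norm (mollifier \<rho> r (graft S e x - y))) \<partial>lborel) \<le> ennreal K" for e x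
      proof -
        have "(\<integral>\<^sup>+y. ennreal (norm (mollifier \<rho> r (graft S e x - y))) \<partial>lborel)
          \<le> (\<integral>\<^sup>+y. ennreal A * ennreal (r ^ CARD('n) * prod_weight (\<lambda>_. 1 / r) (graft S e x - y)) \<partial>lborel)"
          using A(1) A(2)[OF r] r
          by (intro nn_integral_mono) (auto simp: ennreal_mult[symmetric] prod_weight_nonneg mult.assoc intro!: ennreal_leI)
        also have "\<dots> = ennreal K"
          using A r by (simp add: nn_integral_cmult nn_integral_reflected_weight K_def ennreal_mult)
        finally show ?thesis .
      qed
      show "(cell_integral S E b (\<lambda>e x. ennreal (norm (mollifier \<rho> r (graft S e x - y))))) \<le> ennreal K2" for y
      proof -
        have cE: "countable E" using E by (simp add: cube_cover_def)
        have meas: "(\<lambda>(e, x). ennreal (r ^ CARD('n) * prod_weight (\<lambda>_. 1 / r) (graft S e x - y)) * indicator (cylinder S e b) x) \<in> borel_measurable (cell_measure E)"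
          by (rule measurable_cell[OF cE]) measurable
        have "(cell_integral S E b (\<lambda>e x. ennreal (norm (mollifier \<rho> r (graft S e x - y)))))
          \<le> (\<integral>\<^sup>+q. ennreal A * (case q of (e, x) \<Rightarrow> ennreal (r ^ CARD('n) * prod_weight (\<lambda>_. 1 / r) (graft S e x - y)) * indicator (cylinder S e b) x) \<partial>cell_measure E)"
          using A(1) A(2)[OF r] r
          by (intro nn_integral_mono)
            (auto simp: ennreal_mult[symmetric] prod_weight_nonneg mult.assoc indicator_def intro!: ennreal_leI)
        also have "\<dots> = ennreal A * (cell_integral S E b (\<lambda>e x. ennreal (r ^ CARD('n) * prod_weight (\<lambda>_. 1 / r) (graft S e x - y))))"
          by (rule nn_integral_cmult[OF meas])
        also have "\<dots> \<le> ennreal A * ennreal (D * (3 * pi) ^ CARD('n) * max 1 (r * b) ^ card S)"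
          by (intro mult_left_mono nn_integral_cell_weight[OF E r b]) simp
        also have "\<dots> = ennreal K2" using A by (simp add: K2_def ennreal_mult)
        finally show ?thesis .
      qed
      show "0 \<le> K2" using A by (simp add: K2_def)
    qed (use p K in \<open>auto intro: norm_smoothing_le[OF \<rho> r f p] in_Lp_measurable[OF f]\<close>)
    then show ?thesis by (simp add: C_def K2_def mult_ac)
  qed
  \<comment> \<open>C vanishes when D = 0, so C + 1 is the positive constant delivered.\<close>
  have "C * max 1 (r * b) ^ k \<le> (C + 1) * max 1 (r * b) ^ k" for r b :: real and k by (intro mult_right_mono) auto
  then have le: "ennreal (C * max 1 (r * b) ^ k) * I \<le> ennreal ((C + 1) * max 1 (r * b) ^ k) * I" for r b :: real and k I
    by (intro mult_right_mono ennreal_leI) auto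
  show ?thesis
  proof (intro exI[of _ "C + 1"] conjI allI impI)
    fix S :: "'n set" and E :: "(real^'n) set" and b r :: real and f :: "real^'n \<Rightarrow> complex"
    assume "cube_cover S E b D \<and> b > 0 \<and> r > 0 \<and> in_Lp p f"
    then show "(cell_integral S E b (\<lambda>e x. ennreal (norm (smoothing \<rho> r f (graft S e x)) powr p)))
      \<le> ennreal ((C + 1) * max 1 (r * b) ^ card S) * (Lp_power p f)"
      by (intro order_trans[OF main le]) auto
  qed (use C0 in simp)
qed

lemma norm_graft_diff_le:
  fixes S :: "'n::finite set"
  assumes "x \<in> cylinder S e b" "b > 0"
  shows "norm (graft S e x - x) \<le> real CARD('n) * b"
proof -
  have "dist (graft S e x) x \<le> real CARD('n) * b"
  proof (rule dist_le_card_mult)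
    fix i show "\<bar>graft S e x $ i - x $ i\<bar> \<le> b"
      using assms by (cases "i \<in> S") (auto simp: cylinder_def abs_minus_commute)
  qed
  then show ?thesis by (simp add: dist_norm)
qed

text \<open>Both Schur integrals of the kernel difference are of order r b, so their combination is
  of order (r b) powr p and the oscillation is linear in r b. The majorant is centred at x, not at
  its projection, so no widening occurs.\<close>

lemma sampled_smoothing_difference_bound:
  fixes \<rho> :: "real^'n::finite \<Rightarrow> real"
  assumes \<rho>: "dyadic_bump \<rho>" and p: "1 \<le> p"
  shows "\<exists>C>0. \<forall>S E b r (f :: real^'n \<Rightarrow> complex). cube_cover S E b D \<and> b > 0 \<and> r > 0 \<and> r * b \<le> 1 \<and> in_Lp p f \<longrightarrow>
     (cell_integral S E b (\<lambda>e x. ennreal (norm (smoothing \<rho> r f (graft S e x) - smoothing \<rho> r f x) powr p)))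
      \<le> ennreal ((C * (r * b)) powr p) * (Lp_power p f)"
proof -
  define d where "d = real CARD('n)"
  have d: "d > 0" by (simp add: d_def)
  \<comment> \<open>A point of a cell is moved by at most d b; together with r b at most 1 this
    keeps r |h| below d.\<close>
  obtain A where A: "A > 0" "\<And>r z h. r > 0 \<Longrightarrow> r * norm h \<le> d \<Longrightarrow>
      norm (mollifier \<rho> r (z + h) - mollifier \<rho> r z) \<le> A * (r * norm h) * r ^ CARD('n) * prod_weight (\<lambda>_. 1 / r) z"
    using mollifier_difference_bound[OF \<rho>, of d] by blast
  define B where "B = A * d * pi ^ CARD('n)"
  have B: "B > 0" using A d by (simp add: B_def)
  \<comment> \<open>The factor 1 + D replaces the root of D: its p-th power dominates D as p is at
    least 1, and it is positive even for D = 0.\<close>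
  define C where "C = B * (1 + real D)"
  have C: "C > 0" using B by (simp add: C_def)
  have main: "(cell_integral S E b (\<lambda>e x. ennreal (norm (smoothing \<rho> r f (graft S e x) - smoothing \<rho> r f x) powr p)))
      \<le> ennreal ((C * (r * b)) powr p) * (Lp_power p f)"
    if E: "cube_cover S E b D" and b: "b > 0" and r: "r > 0" and rb: "r * b \<le> 1" and f: "in_Lp p f"
    for S E b r and f :: "real^'n \<Rightarrow> complex"
  proof -
    define K where "K = B * (r * b)"
    have K: "K > 0" using B r b by (simp add: K_def)
    define a where "a = A * (r * (d * b))"
    have a: "a > 0" using A r b d by (simp add: a_def)
    have aK: "a * pi ^ CARD('n) = K" by (simp add: a_def K_def B_def mult_ac)
    have cE: "countable E" using E by (simp add: cube_cover_def)
    have kbound: "norm (mollifier \<rho> r (graft S e x - y) - mollifier \<rho> r (x - y)) \<le> a * (r ^ CARD('n) * prod_weight (\<lambda>_. 1 / r) (x - y))"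
      if x: "x \<in> cylinder S e b" for e x y
    proof -
      have n: "norm (graft S e x - x) \<le> d * b" unfolding d_def by (rule norm_graft_diff_le[OF x b])
      then have rn: "r * norm (graft S e x - x) \<le> r * (d * b)" using r by (intro mult_left_mono) auto
      also have "r * (d * b) \<le> d" using mult_left_mono[OF rb, of d] d by (simp add: mult_ac)
      finally have "norm (mollifier \<rho> r ((x - y) + (graft S e x - x)) - mollifier \<rho> r (x - y))
         \<le> A * (r * norm (graft S e x - x)) * r ^ CARD('n) * prod_weight (\<lambda>_. 1 / r) (x - y)"
        using r by (intro A(2)) auto
      also have "\<dots> \<le> A * (r * (d * b)) * r ^ CARD('n) * prod_weight (\<lambda>_. 1 / r) (x - y)"
        using A(1) r rn by (intro mult_right_mono mult_left_mono prod_weight_nonneg) auto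
      finally show ?thesis by (simp add: a_def mult.assoc)
    qed
    have "(cell_integral S E b (\<lambda>e x. ennreal (norm (smoothing \<rho> r f (graft S e x) - smoothing \<rho> r f x) powr p)))
        \<le> ennreal (K powr (p - 1) * (K * D)) * (Lp_power p f)"
    proof (rule cell_Schur[where k = "\<lambda>e x y. norm (mollifier \<rho> r (graft S e x - y) - mollifier \<rho> r (x - y))"])
      show "continuous_on UNIV (\<lambda>(x, y). norm (mollifier \<rho> r (graft S e x - y) - mollifier \<rho> r (x - y)))" for e
        unfolding split_beta' by (intro continuous_intros \<rho>)
      show "(\<integral>\<^sup>+y. ennreal (norm (mollifier \<rho> r (graft S e x - y) - mollifier \<rho> r (x - y))) \<partial>lborel) \<le> ennreal K"
        if "x \<in> cylinder S e b" for e x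
      proof -
        have "(\<integral>\<^sup>+y. ennreal (norm (mollifier \<rho> r (graft S e x - y) - mollifier \<rho> r (x - y))) \<partial>lborel)
          \<le> (\<integral>\<^sup>+y. ennreal a * ennreal (r ^ CARD('n) * prod_weight (\<lambda>_. 1 / r) (x - y)) \<partial>lborel)"
          using a r kbound[OF that]
          by (intro nn_integral_mono) (auto simp: ennreal_mult[symmetric] prod_weight_nonneg intro!: ennreal_leI)
        also have "\<dots> = ennreal a * ennreal (pi ^ CARD('n))"
          using r by (subst nn_integral_cmult) (auto simp: nn_integral_reflected_weight)
        also have "\<dots> = ennreal K" using a by (simp add: ennreal_mult[symmetric] aK)
        finally show ?thesis .
      qed
      show "(cell_integral S E b (\<lambda>e x. ennreal (norm (mollifier \<rho> r (graft S e x - y) - mollifier \<rho> r (x - y)))))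
          \<le> ennreal (K * D)" for y
      proof -
        have "(cell_integral S E b (\<lambda>e x. ennreal (norm (mollifier \<rho> r (graft S e x - y) - mollifier \<rho> r (x - y)))))
          \<le> (cell_integral S E b (\<lambda>e x. ennreal (a * (r ^ CARD('n) * prod_weight (\<lambda>_. 1 / r) (x - y)))))"
        proof (rule nn_integral_mono, clarify)
          fix e x
          show "ennreal (norm (mollifier \<rho> r (graft S e x - y) - mollifier \<rho> r (x - y))) * indicator (cylinder S e b) x
            \<le> ennreal (a * (r ^ CARD('n) * prod_weight (\<lambda>_. 1 / r) (x - y))) * indicator (cylinder S e b) x"
            using kbound[of x e y] by (cases "x \<in> cylinder S e b") (auto intro: ennreal_leI)
        qed
        also have "\<dots> \<le> of_nat D * (\<integral>\<^sup>+x. ennreal (a * (r ^ CARD('n) * prod_weight (\<lambda>_. 1 / r) (x - y))) \<partial>lborel)"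
          by (rule nn_integral_cell_le[OF E]) measurable
        also have "(\<integral>\<^sup>+x. ennreal (a * (r ^ CARD('n) * prod_weight (\<lambda>_. 1 / r) (x - y))) \<partial>lborel)
            = (\<integral>\<^sup>+x. ennreal a * ennreal (r ^ CARD('n) * prod_weight (\<lambda>_. 1 / r) (y - x)) \<partial>lborel)"
          using a r prod_weight_uminus[of "\<lambda>_. 1 / r" "y - _"]
          by (intro nn_integral_cong) (simp add: ennreal_mult[symmetric] prod_weight_nonneg)
        also have "\<dots> = ennreal a * ennreal (pi ^ CARD('n))"
          using r by (subst nn_integral_cmult) (auto simp: nn_integral_reflected_weight)
        also have "\<dots> = ennreal K" using a by (simp add: ennreal_mult[symmetric] aK)
        also have "of_nat D * ennreal K = ennreal (K * D)"
          using K by (simp add: ennreal_mult ennreal_of_nat_eq_real_of_nat mult.commute)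
        finally show ?thesis .
      qed
      show "ennreal (norm (smoothing \<rho> r f (graft S e x) - smoothing \<rho> r f x)) \<le>
          (\<integral>\<^sup>+y. ennreal (norm (f y) * norm (mollifier \<rho> r (graft S e x - y) - mollifier \<rho> r (x - y))) \<partial>lborel)" for e x
      proof -
        have eq: "smoothing \<rho> r f (graft S e x) - smoothing \<rho> r f x
          = (\<integral>y. f y * mollifier \<rho> r (graft S e x - y) - f y * mollifier \<rho> r (x - y) \<partial>lborel)"
          unfolding smoothing_def by (intro Bochner_Integration.integral_diff[symmetric] integrable_mollifier_conv[OF \<rho> r f p])
        have "integrable lborel (\<lambda>y. f y * mollifier \<rho> r (graft S e x - y) - f y * mollifier \<rho> r (x - y))"
          by (intro Bochner_Integration.integrable_diff integrable_mollifier_conv[OF \<rho> r f p])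
        from integral_norm_bound_ennreal[OF this] show ?thesis
          unfolding eq by (simp add: right_diff_distrib[symmetric] norm_mult)
      qed
    qed (use p K cE in \<open>auto intro: in_Lp_measurable[OF f]\<close>)
    also have "\<dots> \<le> ennreal ((C * (r * b)) powr p) * (Lp_power p f)"
    proof (intro mult_right_mono ennreal_leI)
      have "K powr (p - 1) * (K * D) = K powr p * D" using K by (simp add: powr_diff)
      also have "\<dots> \<le> K powr p * (1 + real D) powr p"
      proof (rule mult_left_mono)
        have "real D \<le> (1 + real D) powr 1" by simp
        also have "\<dots> \<le> (1 + real D) powr p" using p by (intro powr_mono) auto
        finally show "real D \<le> (1 + real D) powr p" .
      qed simp
      also have "\<dots> = (C * (r * b)) powr p"
        using K by (simp add: C_def K_def powr_mult[symmetric] mult_ac)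
      finally show "K powr (p - 1) * (K * D) \<le> (C * (r * b)) powr p" .
    qed simp
    finally show ?thesis .
  qed
  then show ?thesis using C by blast
qed

section \<open>Oscillation over the cells\<close>

lemma nn_integral_powr_Lp_norm:
  assumes "in_Lp p f" "1 \<le> p"
  shows "(Lp_power p f) = ennreal (Lp_norm p f powr p)"
    and "Lp_norm p f \<ge> 0" and "Lp_enorm p f = ennreal (Lp_norm p f)"
proof -
  obtain a where a: "(Lp_power p f) = ennreal a" "a \<ge> 0"
    using in_Lp_finite[OF assms(1)] by (cases "\<integral>\<^sup>+x. ennreal (norm (f x) powr p) \<partial>lborel") auto
  have e: "Lp_enorm p f = ennreal (a powr (1 / p))"
    using a by (simp add: Lp_enorm_def ennroot_def)
  then have n: "Lp_norm p f = a powr (1 / p)" by (simp add: Lp_norm_def)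
  show "(Lp_power p f) = ennreal (Lp_norm p f powr p)"
    using a assms(2) by (simp add: n powr_powr)
  show "Lp_norm p f \<ge> 0" by (simp add: n)
  show "Lp_enorm p f = ennreal (Lp_norm p f)" by (simp add: n e)
qed

lemma in_Lp_of_enorm_finite:
  assumes "g \<in> borel_measurable borel" "Lp_enorm p g < \<infinity>"
  shows "in_Lp p g"
  using assms by (auto simp: in_Lp_def Lp_enorm_def ennroot_def less_top[symmetric] split: if_splits)

text \<open>The indicator sits inside the p-th power, which makes this one function on the product
  space, ready for \<open>nn_Minkowski\<close>.\<close>

definition on_cells :: "'n::finite set \<Rightarrow> real \<Rightarrow> (real^'n \<Rightarrow> real^'n \<Rightarrow> real) \<Rightarrow> (real^'n) \<times> (real^'n) \<Rightarrow> real" where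
  "on_cells S b X q = indicator (cylinder S (fst q) b) (snd q) * X (fst q) (snd q)"

abbreviation cell_power :: "'n::finite set \<Rightarrow> (real^'n) set \<Rightarrow> real \<Rightarrow> real \<Rightarrow> (real^'n \<Rightarrow> real^'n \<Rightarrow> real) \<Rightarrow> ennreal" where
  "cell_power S E b p X \<equiv> (\<integral>\<^sup>+q. ennreal (on_cells S b X q powr p) \<partial>cell_measure E)"

lemma nn_integral_on_cells:
  assumes "1 \<le> p"
  shows "(cell_power S E b p X)
     = (cell_integral S E b (\<lambda>e x. ennreal (X e x powr p)))"
  using assms by (intro nn_integral_cong) (auto simp: on_cells_def indicator_def)

lemma measurable_on_cells:
  assumes "countable E" "\<And>e. X e \<in> borel_measurable borel"
  shows "on_cells S b X \<in> borel_measurable (cell_measure E)"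
proof -
  have [measurable]: "X e \<in> borel_measurable borel" for e by (rule assms(2))
  have "(\<lambda>(e, x). indicator (cylinder S e b) x * X e x) \<in> borel_measurable (cell_measure E)"
    by (rule measurable_cell[OF assms(1)]) measurable
  then show ?thesis by (simp add: on_cells_def[abs_def] split_beta')
qed

lemma on_cells_nonneg: "(\<And>e x. 0 \<le> X e x) \<Longrightarrow> 0 \<le> on_cells S b X q"
  by (simp add: on_cells_def)

lemma on_cells_mono_add:
  "(\<And>e x. X e x \<le> Y e x + Z e x) \<Longrightarrow> on_cells S b X q \<le> on_cells S b Y q + on_cells S b Z q"
  by (simp add: on_cells_def indicator_def)

lemma on_cells_Minkowski:
  assumes cE: "countable E" and p: "1 \<le> p"
    and meas: "\<And>e. Y e \<in> borel_measurable borel" "\<And>e. Z e \<in> borel_measurable borel"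
    and nn: "\<And>e x. 0 \<le> X e x" "\<And>e x. 0 \<le> Y e x" "\<And>e x. 0 \<le> Z e x" "0 \<le> s" "0 \<le> t"
    and Y: "(cell_power S E b p Y) \<le> ennreal (s powr p)"
    and Z: "(cell_power S E b p Z) \<le> ennreal (t powr p)"
    and X: "\<And>e x. X e x \<le> Y e x + Z e x"
  shows "(cell_power S E b p X) \<le> ennreal ((s + t) powr p)"
  by (rule nn_Minkowski[OF p measurable_on_cells[OF cE meas(1)] measurable_on_cells[OF cE meas(2)]
        on_cells_nonneg[OF nn(2)] on_cells_nonneg[OF nn(3)] nn(4,5) Y Z on_cells_nonneg[OF nn(1)] on_cells_mono_add[OF X]])

abbreviation oscillation :: "'n::finite set \<Rightarrow> (real^'n \<Rightarrow> complex) \<Rightarrow> real^'n \<Rightarrow> real^'n \<Rightarrow> real" where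
  "oscillation S u e x \<equiv> norm (u (graft S e x) - u x)"

lemma measurable_compose_graft:
  "u \<in> borel_measurable borel \<Longrightarrow> (\<lambda>x. u (graft S e x)) \<in> borel_measurable borel"
  using measurable_compose[OF measurable_graft] .

lemma measurable_oscillation:
  assumes [measurable]: "u \<in> borel_measurable borel"
  shows "oscillation S u e \<in> borel_measurable borel"
proof -
  have [measurable]: "(\<lambda>x. u (graft S e x)) \<in> borel_measurable borel" by (rule measurable_compose_graft[OF assms])
  show ?thesis by measurable
qed

lemma besov_partial_sum_le:
  fixes f :: "real^'n::finite \<Rightarrow> complex"
  assumes "finite J" "\<And>j. j \<in> J \<Longrightarrow> in_Lp p (lp_block \<rho> j f)" "1 \<le> p"
  shows "ennreal (\<Sum>j\<in>J. 2 powr (real_of_int j * s) * Lp_norm p (lp_block \<rho> j f)) \<le> besov_hom_1 \<rho> s p f"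
proof -
  have "ennreal (\<Sum>j\<in>J. 2 powr (real_of_int j * s) * Lp_norm p (lp_block \<rho> j f))
     = (\<Sum>j\<in>J. ennreal (2 powr (real_of_int j * s)) * Lp_enorm p (lp_block \<rho> j f))"
    using assms(2,3) by (subst sum_ennreal[symmetric]) (auto simp: nn_integral_powr_Lp_norm ennreal_mult intro!: sum.cong)
  also have "\<dots> = (\<integral>\<^sup>+j. ennreal (2 powr (real_of_int j * s)) * Lp_enorm p (lp_block \<rho> j f) \<partial>count_space J)"
    by (rule nn_integral_count_space_finite[OF assms(1), symmetric])
  also have "\<dots> = (\<integral>\<^sup>+j. ennreal (2 powr (real_of_int j * s)) * Lp_enorm p (lp_block \<rho> j f) * indicator J j \<partial>count_space UNIV)"
    by (rule nn_integral_count_space_indicator) auto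
  also have "\<dots> \<le> besov_hom_1 \<rho> s p f"
    unfolding besov_hom_1_def by (intro nn_integral_mono) (auto simp: indicator_def)
  finally show ?thesis .
qed

lemma lp_block_in_Lp:
  fixes f :: "real^'n::finite \<Rightarrow> complex"
  assumes \<rho>: "dyadic_bump \<rho>" and p: "1 \<le> p" and f: "in_besov_1 \<rho> s p f"
  shows "in_Lp p (lp_block \<rho> j f)"
proof (rule in_Lp_of_enorm_finite)
  have fL: "in_Lp p f" and fin: "besov_hom_1 \<rho> s p f < \<infinity>" using f by (auto simp: in_besov_1_def)
  show "lp_block \<rho> j f \<in> borel_measurable borel" by (rule borel_measurable_lp_block[OF \<rho> fL p])
  have "ennreal (2 powr (real_of_int j * s)) * Lp_enorm p (lp_block \<rho> j f) \<le> besov_hom_1 \<rho> s p f"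
    unfolding besov_hom_1_def by (rule nn_integral_ge_point) simp
  then have "ennreal (2 powr (real_of_int j * s)) * Lp_enorm p (lp_block \<rho> j f) < \<infinity>"
    using fin by (rule le_less_trans)
  then show "Lp_enorm p (lp_block \<rho> j f) < \<infinity>"
    by (auto simp: ennreal_mult_less_top)
qed

text \<open>No cancellation is used: sampled and unsampled values are bounded separately, the former
  by viewing the block as its own mollification at frequency 2^(j+1), the latter by the multiplicity
  D.\<close>

lemma high_frequency_oscillation:
  fixes \<rho> :: "real^'n::finite \<Rightarrow> real"
  assumes \<rho>: "dyadic_bump \<rho>" and p: "1 \<le> p" and D: "1 \<le> D"
  shows "\<exists>C>0. \<forall>S E b j (f :: real^'n \<Rightarrow> complex). cube_cover S E b D \<and> b > 0 \<and> in_Lp p f \<and> in_Lp p (lp_block \<rho> j f) \<longrightarrow>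
     (cell_power S E b p (oscillation S (lp_block \<rho> j f)))
      \<le> ennreal ((C * max 1 (2 powr (real_of_int j + 1) * b) powr (card S / p) * Lp_norm p (lp_block \<rho> j f)) powr p)"
proof -
  obtain A where A: "A > 0" "\<And>S E b r (f :: real^'n \<Rightarrow> complex). cube_cover S E b D \<Longrightarrow> b > 0 \<Longrightarrow> r > 0 \<Longrightarrow> in_Lp p f \<Longrightarrow>
     (cell_integral S E b (\<lambda>e x. ennreal (norm (smoothing \<rho> r f (graft S e x)) powr p)))
      \<le> ennreal (A * max 1 (r * b) ^ card S) * (Lp_power p f)"
    using sampled_smoothing_bound[OF \<rho> p, of D] by blast
  define C where "C = A powr (1 / p) + real D powr (1 / p)"
  have C: "C > 0" using A(1) by (simp add: C_def add_pos_nonneg)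
  have "(cell_power S E b p (oscillation S (lp_block \<rho> j f)))
      \<le> ennreal ((C * max 1 (2 powr (real_of_int j + 1) * b) powr (card S / p) * Lp_norm p (lp_block \<rho> j f)) powr p)"
    if E: "cube_cover S E b D" and b: "b > 0" and f: "in_Lp p f" and fj: "in_Lp p (lp_block \<rho> j f)"
    for S E b j and f :: "real^'n \<Rightarrow> complex"
  proof -
    define g where "g = lp_block \<rho> j f"
    define n where "n = Lp_norm p g"
    define R where "R = max 1 (2 powr (real_of_int j + 1) * b)"
    have R: "R \<ge> 1" by (simp add: R_def)
    have gL: "in_Lp p g" using fj by (simp add: g_def)
    have g[measurable]: "g \<in> borel_measurable borel" by (rule in_Lp_measurable[OF gL])
    have n: "n \<ge> 0" and gn: "(Lp_power p g) = ennreal (n powr p)"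
      using nn_integral_powr_Lp_norm[OF gL p] by (auto simp: n_def)
    have cE: "countable E" using E by (simp add: cube_cover_def)
    have rep: "smoothing \<rho> (2 powr (real_of_int j + 1)) g = g"
      using lp_block_reproducing[OF \<rho> f p] by (auto simp: g_def)
    have 1: "(cell_power S E b p (\<lambda>e x. norm (g (graft S e x)))) \<le> ennreal ((A powr (1 / p) * R powr (card S / p) * n) powr p)"
    proof -
      have "(cell_power S E b p (\<lambda>e x. norm (g (graft S e x))))
         \<le> ennreal (A * R ^ card S) * ennreal (n powr p)"
        using A(2)[OF E b _ gL, of "2 powr (real_of_int j + 1)"] p unfolding rep gn by (simp add: nn_integral_on_cells R_def)
      also have "\<dots> = ennreal (A * R ^ card S * n powr p)" using A(1) R by (simp add: ennreal_mult)
      also have "A * R ^ card S * n powr p = (A powr (1 / p) * R powr (card S / p) * n) powr p"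
        using A(1) R n p by (simp add: powr_mult powr_powr powr_realpow)
      finally show ?thesis .
    qed
    have 2: "(cell_power S E b p (\<lambda>e x. norm (g x))) \<le> ennreal ((real D powr (1 / p) * n) powr p)"
    proof -
      have "(cell_power S E b p (\<lambda>e x. norm (g x))) \<le> of_nat D * ennreal (n powr p)"
        unfolding nn_integral_on_cells[OF p] gn[symmetric] by (rule nn_integral_cell_le[OF E]) measurable
      also have "\<dots> = ennreal (real D * n powr p)" by (simp add: ennreal_mult ennreal_of_nat_eq_real_of_nat)
      also have "real D * n powr p = (real D powr (1 / p) * n) powr p"
        using D n p by (simp add: powr_mult powr_powr)
      finally show ?thesis .
    qed
    have "(cell_power S E b p (oscillation S g))
       \<le> ennreal ((A powr (1 / p) * R powr (card S / p) * n + real D powr (1 / p) * n) powr p)"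
      by (rule on_cells_Minkowski[OF cE p _ _ _ _ _ _ _ 1 2])
        (use n in \<open>auto intro!: norm_triangle_ineq4 borel_measurable_norm measurable_compose_graft\<close>)
    also have "\<dots> \<le> ennreal ((C * R powr (card S / p) * n) powr p)"
    proof (intro ennreal_leI powr_mono2)
      have "1 \<le> R powr (card S / p)" using R p by (intro ge_one_powr_ge_zero) auto
      then have "real D powr (1 / p) * 1 * n \<le> real D powr (1 / p) * R powr (card S / p) * n"
        using n by (intro mult_right_mono mult_left_mono) auto
      then show "A powr (1 / p) * R powr (card S / p) * n + real D powr (1 / p) * n \<le> C * R powr (card S / p) * n"
        by (simp add: C_def algebra_simps)
    qed (use p n in auto)
    finally show ?thesis by (simp add: g_def n_def R_def)
  qed
  then show ?thesis using C by blast
qed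

lemma exists_dyadic_scale:
  fixes c :: real
  assumes "c > 0"
  obtains J :: int where "2 powr real_of_int J \<le> c" "c < 2 powr (real_of_int J + 1)"
proof -
  have c: "c = 2 powr (log 2 c)" using assms by simp
  have "2 powr real_of_int \<lfloor>log 2 c\<rfloor> \<le> 2 powr (log 2 c)" by (rule powr_mono) auto
  moreover have "2 powr (log 2 c) < 2 powr (real_of_int \<lfloor>log 2 c\<rfloor> + 1)" by (rule powr_less_mono) auto
  ultimately show ?thesis using that[of "\<lfloor>log 2 c\<rfloor>"] c by simp
qed

text \<open>The mollifications converge at x and at its projection alike, so the oscillation
  converges at every pair (e, x) and Fatou's lemma transfers the uniform bound.\<close>

lemma oscillation_limit:
  fixes f :: "real^'n::finite \<Rightarrow> complex"
  assumes \<rho>: "dyadic_bump \<rho>" and p: "1 \<le> p" and f: "in_Lp p f" and cont: "continuous_on UNIV f" and cE: "countable E"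
    and B: "\<And>n. (cell_power S E b p (oscillation S (smoothing \<rho> (2 powr (real_of_int J + real n)) f))) \<le> ennreal B"
  shows "(cell_power S E b p (oscillation S f)) \<le> ennreal B"
proof -
  define P where "P n = smoothing \<rho> (2 powr (real_of_int J + real n)) f" for n
  have [measurable]: "P n \<in> borel_measurable borel" for n
    unfolding P_def by (rule borel_measurable_smoothing[OF \<rho> in_Lp_measurable[OF f]])
  have scale: "filterlim (\<lambda>n. 2 powr (real_of_int J + real n)) at_top sequentially"
    by real_asymp
  have P: "(\<lambda>n. P n x) \<longlonglongrightarrow> f x" for x
    unfolding P_def by (rule filterlim_compose[OF smoothing_tendsto[OF \<rho> f p cont] scale])
  have lim: "(\<lambda>n. ennreal (on_cells S b (oscillation S (P n)) q powr p)) \<longlonglongrightarrow> ennreal (on_cells S b (oscillation S f) q powr p)" for q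
    unfolding on_cells_def using p
    by (intro tendsto_ennrealI tendsto_powr' tendsto_mult tendsto_const tendsto_norm tendsto_diff P) (auto intro!: always_eventually)
  have "(cell_power S E b p (oscillation S f))
     = (\<integral>\<^sup>+q. liminf (\<lambda>n. ennreal (on_cells S b (oscillation S (P n)) q powr p)) \<partial>cell_measure E)"
    by (intro nn_integral_cong lim_imp_Liminf[OF _ lim, symmetric]) auto
  also have "\<dots> \<le> liminf (\<lambda>n. \<integral>\<^sup>+q. ennreal (on_cells S b (oscillation S (P n)) q powr p) \<partial>cell_measure E)"
  proof (rule nn_integral_liminf)
    fix n
    have [measurable]: "on_cells S b (oscillation S (P n)) \<in> borel_measurable (cell_measure E)"
      by (intro measurable_on_cells cE measurable_oscillation) auto
    show "(\<lambda>q. ennreal (on_cells S b (oscillation S (P n)) q powr p)) \<in> borel_measurable (cell_measure E)" by measurable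
  qed
  also have "\<dots> \<le> limsup (\<lambda>n. \<integral>\<^sup>+q. ennreal (on_cells S b (oscillation S (P n)) q powr p) \<partial>cell_measure E)"
    by (rule Liminf_le_Limsup) simp
  also have "\<dots> \<le> ennreal B"
    by (rule Limsup_bounded) (use B in \<open>auto simp: P_def\<close>)
  finally show ?thesis .
qed

text \<open>The factor 1/2 consists of 1/4 for the low frequencies, through \<open>\<eta>\<close>,
  and 1/4 for the sum of the high blocks, through \<open>\<delta>\<close>. Both are fixed before S,
  E, b, N and f.\<close>

lemma besov_oscillation_bound:
  fixes \<rho> :: "real^'n::finite \<Rightarrow> real"
  assumes \<rho>: "dyadic_bump \<rho>" and p: "1 \<le> p" and D: "1 \<le> D"
  shows "\<exists>\<delta>>0. \<forall>S E b N (f :: real^'n \<Rightarrow> complex). card S = m \<and> cube_cover S E b D \<and> b > 0 \<and> N > 0 \<and>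
      continuous_on UNIV f \<and> in_besov_1 \<rho> (real m / p) p f \<and>
      besov_hom_1 \<rho> (real m / p) p f \<le> ennreal N * ennreal (Lp_norm p f) \<and> b powr (real m / p) < \<delta> / N \<longrightarrow>
     (cell_power S E b p (oscillation S f)) \<le> ennreal ((1 / 2 * Lp_norm p f) powr p)"
proof -
  define s where "s = real m / p"
  have s: "s \<ge> 0" using p by (simp add: s_def)
  obtain A where A: "A > 0" "\<And>S E b r (f :: real^'n \<Rightarrow> complex). cube_cover S E b D \<Longrightarrow> b > 0 \<Longrightarrow> r > 0 \<Longrightarrow> r * b \<le> 1 \<Longrightarrow> in_Lp p f \<Longrightarrow>
     (cell_integral S E b (\<lambda>e x. ennreal (norm (smoothing \<rho> r f (graft S e x) - smoothing \<rho> r f x) powr p)))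
      \<le> ennreal ((A * (r * b)) powr p) * (Lp_power p f)"
    using sampled_smoothing_difference_bound[OF \<rho> p, of D] by blast
  obtain C where C: "C > 0" "\<And>S E b j (f :: real^'n \<Rightarrow> complex). cube_cover S E b D \<Longrightarrow> b > 0 \<Longrightarrow> in_Lp p f \<Longrightarrow> in_Lp p (lp_block \<rho> j f) \<Longrightarrow>
     (cell_power S E b p (oscillation S (lp_block \<rho> j f)))
      \<le> ennreal ((C * max 1 (2 powr (real_of_int j + 1) * b) powr (card S / p) * Lp_norm p (lp_block \<rho> j f)) powr p)"
    using high_frequency_oscillation[OF \<rho> p D] by blast
  \<comment> \<open>Makes the low-frequency factor A \<open>\<eta>\<close> at most 1/4; the minimum
    with 1 secures r b at most 1 in the hypothesis of the difference bound.\<close>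
  define \<eta> where "\<eta> = min 1 (1 / (4 * A))"
  have \<eta>: "0 < \<eta>" "\<eta> \<le> 1" "A * \<eta> \<le> 1 / 4" using A(1) by (auto simp: \<eta>_def min_def field_simps)
  define \<delta> where "\<delta> = 1 / (4 * C * (2 / \<eta>) powr s)"
  have \<delta>: "\<delta> > 0" "C * (2 / \<eta>) powr s * \<delta> = 1 / 4" using C(1) \<eta> by (auto simp: \<delta>_def)
  have "(cell_power S E b p (oscillation S f)) \<le> ennreal ((1 / 2 * Lp_norm p f) powr p)"
    if S: "card S = m" and E: "cube_cover S E b D" and b: "b > 0" and N: "N > 0" and cont: "continuous_on UNIV f"
      and f: "in_besov_1 \<rho> (real m / p) p f" and fN: "besov_hom_1 \<rho> (real m / p) p f \<le> ennreal N * ennreal (Lp_norm p f)"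
      and small: "b powr (real m / p) < \<delta> / N"
    for S E b N and f :: "real^'n \<Rightarrow> complex"
  proof -
    have fL: "in_Lp p f" using f by (simp add: in_besov_1_def)
    have cE: "countable E" using E by (simp add: cube_cover_def)
    define F where "F = Lp_norm p f"
    have F: "F \<ge> 0" "(Lp_power p f) = ennreal (F powr p)"
      using nn_integral_powr_Lp_norm[OF fL p] by (auto simp: F_def)
    obtain J :: int where J: "2 powr real_of_int J \<le> \<eta> / b" "\<eta> / b < 2 powr (real_of_int J + 1)"
      using exists_dyadic_scale[of "\<eta> / b"] \<eta> b by auto
    have bL: "in_Lp p (lp_block \<rho> j f)" for j by (rule lp_block_in_Lp[OF \<rho> p f])
    define \<nu> where "\<nu> j = Lp_norm p (lp_block \<rho> j f)" for j
    have \<nu>: "\<nu> j \<ge> 0" for j unfolding \<nu>_def by (rule nn_integral_powr_Lp_norm(2)[OF bL p])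
    \<comment> \<open>For j > J the choice of J gives 2^j b at least \<open>\<eta>\<close>, hence
      max 1 (2^(j+1) b) is at most (2 / \<open>\<eta>\<close>) 2^j b. The bound for block j thereby
      becomes a constant times b powr s times the j-th term of the Besov norm.\<close>
    define lam where "lam j = C * (2 / \<eta>) powr s * b powr s * (2 powr (real_of_int j * s) * \<nu> j)" for j
    have lam: "lam j \<ge> 0" for j using C(1) \<nu> by (simp add: lam_def)
    have high: "(cell_power S E b p (oscillation S (lp_block \<rho> j f))) \<le> ennreal (lam j powr p)"
      if j: "J < j" for j
    proof -
      have "real_of_int J + 1 \<le> real_of_int j" using j by linarith
      then have "2 powr (real_of_int J + 1) \<le> 2 powr real_of_int j" by (intro powr_mono) auto
      then have "\<eta> / b \<le> 2 powr real_of_int j" using J(2) by linarith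
      then have "\<eta> \<le> 2 powr real_of_int j * b" using b by (simp add: pos_divide_le_eq)
      then have "1 \<le> 2 / \<eta> * (2 powr real_of_int j * b)" using \<eta> by (simp add: field_simps)
      moreover have "2 powr (real_of_int j + 1) * b \<le> 2 / \<eta> * (2 powr real_of_int j * b)"
      proof -
        have "2 * (2 powr real_of_int j * b) \<le> 2 / \<eta> * (2 powr real_of_int j * b)"
          using \<eta> b by (intro mult_right_mono) (auto simp: field_simps)
        then show ?thesis by (simp add: powr_add mult_ac)
      qed
      ultimately have "max 1 (2 powr (real_of_int j + 1) * b) \<le> 2 / \<eta> * (2 powr real_of_int j * b)" by simp
      then have "max 1 (2 powr (real_of_int j + 1) * b) powr s \<le> (2 / \<eta> * (2 powr real_of_int j * b)) powr s"
        using s by (intro powr_mono2) auto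
      also have "\<dots> = (2 / \<eta>) powr s * b powr s * 2 powr (real_of_int j * s)"
        using \<eta> b by (simp add: powr_mult powr_powr powr_divide mult_ac)
      finally have M: "max 1 (2 powr (real_of_int j + 1) * b) powr s \<le> (2 / \<eta>) powr s * b powr s * 2 powr (real_of_int j * s)" .
      have "C * max 1 (2 powr (real_of_int j + 1) * b) powr s * \<nu> j \<le> C * ((2 / \<eta>) powr s * b powr s * 2 powr (real_of_int j * s)) * \<nu> j"
        using C(1) \<nu> by (intro mult_right_mono mult_left_mono M) auto
      also have "\<dots> = lam j" by (simp add: lam_def mult_ac)
      finally have "(C * max 1 (2 powr (real_of_int j + 1) * b) powr (card S / p) * Lp_norm p (lp_block \<rho> j f)) powr p \<le> lam j powr p"
        unfolding \<nu>_def s_def S using C(1) p nn_integral_powr_Lp_norm(2)[OF bL p] by (intro powr_mono2) auto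
      then show ?thesis by (intro order_trans[OF C(2)[OF E b fL bL]] ennreal_leI)
    qed
    \<comment> \<open>Induction over the number of blocks above J. Each step adds one block by
      Minkowski's inequality, so the bounds add before the p-th power is taken.\<close>
    have total: "(cell_power S E b p (oscillation S (smoothing \<rho> (2 powr (real_of_int J + real n)) f)))
        \<le> ennreal ((A * \<eta> * F + (\<Sum>i<n. lam (J + 1 + int i))) powr p)" for n
    proof (induction n)
      case 0
      have rb: "2 powr real_of_int J * b \<le> \<eta>" using J(1) b by (simp add: pos_le_divide_eq)
      have "(cell_power S E b p (oscillation S (smoothing \<rho> (2 powr real_of_int J) f)))
         \<le> ennreal ((A * (2 powr real_of_int J * b)) powr p) * ennreal (F powr p)"
        unfolding nn_integral_on_cells[OF p] F(2)[symmetric] using rb \<eta> by (intro A(2)[OF E b _ _ fL]) auto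
      also have "\<dots> = ennreal ((A * (2 powr real_of_int J * b) * F) powr p)"
        using A(1) b F by (simp add: ennreal_mult[symmetric] powr_mult)
      also have "\<dots> \<le> ennreal ((A * \<eta> * F) powr p)"
        using A(1) b F p rb by (intro ennreal_leI powr_mono2 mult_right_mono mult_left_mono) auto
      finally show ?case by simp
    next
      case (Suc n)
      \<comment> \<open>Passing from the cutoff 2^(J+n) to 2^(J+n+1) adds the block with index J + n
        + 1.\<close>
      define j where "j = J + 1 + int n"
      define u where "u = smoothing \<rho> (2 powr (real_of_int J + real n)) f"
      have u: "u \<in> borel_measurable borel"
        unfolding u_def by (rule borel_measurable_smoothing[OF \<rho> in_Lp_measurable[OF fL]])
      have g: "lp_block \<rho> j f \<in> borel_measurable borel" by (rule in_Lp_measurable[OF bL])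
      have split: "smoothing \<rho> (2 powr (real_of_int J + real (Suc n))) f x = u x + lp_block \<rho> j f x" for x
        using lp_block_eq_smoothing_diff[OF \<rho> fL p, of j x] by (simp add: u_def j_def algebra_simps)
      have "(cell_power S E b p (oscillation S (smoothing \<rho> (2 powr (real_of_int J + real (Suc n))) f)))
         \<le> ennreal ((A * \<eta> * F + (\<Sum>i<n. lam (J + 1 + int i)) + lam j) powr p)"
      proof (rule on_cells_Minkowski[OF cE p measurable_oscillation[OF u] measurable_oscillation[OF g] _ _ _ _ _ Suc[folded u_def] high])
        show "0 \<le> A * \<eta> * F + (\<Sum>i<n. lam (J + 1 + int i))"
          using A(1) \<eta> F lam by (intro add_nonneg_nonneg mult_nonneg_nonneg sum_nonneg) auto
        show "J < j" by (simp add: j_def)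
        show "oscillation S (smoothing \<rho> (2 powr (real_of_int J + real (Suc n))) f) e x \<le> oscillation S u e x + oscillation S (lp_block \<rho> j f) e x" for e x
          unfolding split using norm_triangle_ineq[of "u (graft S e x) - u x" "lp_block \<rho> j f (graft S e x) - lp_block \<rho> j f x"]
          by (simp add: algebra_simps)
      qed (use lam in auto)
      then show ?case by (simp add: j_def add.assoc)
    qed
    \<comment> \<open>A finite part of the Besov sum is at most N F, and b powr s N is at most
      \<open>\<delta>\<close>; the choice of \<open>\<delta>\<close> leaves F / 4, uniformly in
      n.\<close>
    have sum_le: "A * \<eta> * F + (\<Sum>i<n. lam (J + 1 + int i)) \<le> 1 / 2 * F" for n
    proof -
      have inj: "inj_on (\<lambda>i. J + 1 + int i) {..<n}" by (auto simp: inj_on_def)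
      define \<Sigma> where "\<Sigma> = (\<Sum>i<n. 2 powr (real_of_int (J + 1 + int i) * s) * \<nu> (J + 1 + int i))"
      have \<Sigma>0: "\<Sigma> \<ge> 0" unfolding \<Sigma>_def using \<nu> by (intro sum_nonneg) auto
      have "\<Sigma> = (\<Sum>j\<in>(\<lambda>i. J + 1 + int i) ` {..<n}. 2 powr (real_of_int j * s) * Lp_norm p (lp_block \<rho> j f))"
        unfolding \<Sigma>_def \<nu>_def by (simp add: sum.reindex[OF inj])
      then have "ennreal \<Sigma> \<le> ennreal N * ennreal F"
        using order_trans[OF besov_partial_sum_le[OF _ bL p] fN, of "(\<lambda>i. J + 1 + int i) ` {..<n}"] by (simp add: s_def F_def)
      then have \<Sigma>: "\<Sigma> \<le> N * F" using N F by (simp add: ennreal_mult[symmetric])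
      have "b powr s * N \<le> \<delta>" using small N by (simp add: s_def pos_less_divide_eq less_imp_le)
      have "(\<Sum>i<n. lam (J + 1 + int i)) = C * (2 / \<eta>) powr s * (b powr s * \<Sigma>)"
        unfolding lam_def \<Sigma>_def by (simp add: sum_distrib_left mult.assoc)
      also have "\<dots> \<le> C * (2 / \<eta>) powr s * (b powr s * (N * F))"
        using C(1) \<Sigma> by (intro mult_left_mono) auto
      also have "\<dots> = C * (2 / \<eta>) powr s * ((b powr s * N) * F)" by (simp add: mult.assoc)
      also have "\<dots> \<le> C * (2 / \<eta>) powr s * (\<delta> * F)"
        using C(1) F \<open>b powr s * N \<le> \<delta>\<close> by (intro mult_left_mono mult_right_mono) auto
      also have "\<dots> = 1 / 4 * F" using \<delta>(2) by (metis mult.assoc)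
      finally have "(\<Sum>i<n. lam (J + 1 + int i)) \<le> 1 / 4 * F" .
      moreover have "A * \<eta> * F \<le> 1 / 4 * F" using \<eta>(3) F(1) by (rule mult_right_mono)
      ultimately show ?thesis by simp
    qed
    have "(cell_power S E b p (oscillation S (smoothing \<rho> (2 powr (real_of_int J + real n)) f)))
        \<le> ennreal ((1 / 2 * F) powr p)" for n
    proof (rule order_trans[OF total], intro ennreal_leI powr_mono2 sum_le)
      show "0 \<le> A * \<eta> * F + (\<Sum>i<n. lam (J + 1 + int i))"
        using A(1) \<eta> F lam by (intro add_nonneg_nonneg mult_nonneg_nonneg sum_nonneg) auto
    qed (use p in auto)
    then show ?thesis unfolding F_def[symmetric] by (rule oscillation_limit[OF \<rho> p fL cont cE])
  qed
  then show ?thesis using \<delta>(1) by blast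
qed

section \<open>From cells to the sampling set\<close>

text \<open>Membership in a cylinder depends only on the projection to the coordinates in S, which
  yields the counts. For countability, every cylinder contains a point of a countable dense set, and
  each such point lies in finitely many of them.\<close>

lemma cube_cover_of_cubes:
  fixes S :: "'n::finite set"
  assumes b: "b > 0" and cover: "(\<Union>x\<in>E. cube_in S x b) = coord_subspace S"
    and mult: "\<forall>y \<in> coord_subspace S. finite {x\<in>E. y \<in> cube_in S x b} \<and> card {x\<in>E. y \<in> cube_in S x b} \<le> D"
  shows "cube_cover S E b D"
proof -
  have key: "finite {e \<in> E. x \<in> cylinder S e b} \<and> 1 \<le> card {e \<in> E. x \<in> cylinder S e b} \<and> card {e \<in> E. x \<in> cylinder S e b} \<le> D" for x
  proof -
    define y where "y = (\<chi> i. if i \<in> S then x $ i else 0)"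
    have y: "y \<in> coord_subspace S" by (simp add: y_def coord_subspace_def)
    have eq: "{e \<in> E. x \<in> cylinder S e b} = {e \<in> E. y \<in> cube_in S e b}"
      using y by (auto simp: cylinder_def cube_in_def y_def)
    have fin: "finite {e \<in> E. y \<in> cube_in S e b}" using mult y by blast
    have "{e \<in> E. y \<in> cube_in S e b} \<noteq> {}" using y cover by blast
    then have "card {e \<in> E. y \<in> cube_in S e b} \<ge> 1" using fin by (simp add: Suc_le_eq card_gt_0_iff)
    then show ?thesis unfolding eq using mult y by blast
  qed
  obtain Q :: "(real^'n) set" where Q: "countable Q" "\<And>X. open X \<Longrightarrow> X \<noteq> {} \<Longrightarrow> \<exists>d\<in>Q. d \<in> X"
    using countable_dense_exists by metis
  have "E \<subseteq> (\<Union>q\<in>Q. {e \<in> E. q \<in> cylinder S e b})"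
  proof
    fix e assume e: "e \<in> E"
    obtain q where q: "q \<in> Q" "q \<in> ball e b" using Q(2)[of "ball e b"] b by auto
    have "\<bar>q $ i - e $ i\<bar> \<le> b" for i
      using component_le_norm_cart[of "q - e" i] q(2) by (simp add: dist_norm norm_minus_commute)
    then show "e \<in> (\<Union>q\<in>Q. {e \<in> E. q \<in> cylinder S e b})" using e q(1) by (auto simp: cylinder_def)
  qed
  moreover have "countable (\<Union>q\<in>Q. {e \<in> E. q \<in> cylinder S e b})"
    by (rule countable_UN[OF Q(1)]) (simp add: countable_finite key)
  ultimately have "countable E" by (rule countable_subset)
  then show ?thesis using key by (simp add: cube_cover_def)
qed

text \<open>The slices through different points of E are disjoint, since points that vanish outside
  S and agree on S coincide. The indicator of the sampling set is then a countable sum, which may be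
  exchanged with the integral.\<close>

lemma nn_integral_sample_set:
  fixes S :: "'n::finite set" and h :: "real^'n \<Rightarrow> ennreal"
  assumes cE: "countable E" and sub: "E \<subseteq> coord_subspace S" and [measurable]: "h \<in> borel_measurable borel"
  shows "(\<integral>\<^sup>+x\<in>sample_set S E. h x \<partial>hausdorff_measure k)
     = (\<integral>\<^sup>+e. \<integral>\<^sup>+x. h x * indicator (slice S e) x \<partial>hausdorff_measure k \<partial>count_space E)"
proof -
  have "(\<integral>\<^sup>+x\<in>sample_set S E. h x \<partial>hausdorff_measure k) = (\<integral>\<^sup>+x. \<integral>\<^sup>+e. h x * indicator (slice S e) x \<partial>count_space E \<partial>hausdorff_measure k)"
  proof (rule nn_integral_cong)
    fix x
    show "h x * indicator (sample_set S E) x = (\<integral>\<^sup>+e. h x * indicator (slice S e) x \<partial>count_space E)"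
    proof (cases "x \<in> sample_set S E")
      case True
      then obtain e0 where e0: "e0 \<in> E" "x \<in> slice S e0" by (auto simp: sample_set_def slice_def)
      have uniq: "e = e0" if e: "e \<in> E" "x \<in> slice S e" for e
      proof -
        have "e \<in> coord_subspace S" "e0 \<in> coord_subspace S" using e e0 sub by auto
        then have "e $ i = e0 $ i" for i
          using e e0 by (cases "i \<in> S") (auto simp: slice_def coord_subspace_def)
        then show ?thesis by (simp add: vec_eq_iff)
      qed
      have "(\<integral>\<^sup>+e. h x * indicator (slice S e) x \<partial>count_space E) = (\<Sum>e\<in>{e0}. h x * indicator (slice S e) x)"
      proof (rule nn_integral_count_space')
        fix e assume "e \<in> E" "e \<notin> {e0}"
        then have "x \<notin> slice S e" using uniq by blast
        then show "h x * indicator (slice S e) x = 0" by simp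
      qed (use e0 in auto)
      then show ?thesis using True e0 by simp
    next
      case False
      then have "x \<notin> slice S e" if "e \<in> E" for e using that by (auto simp: sample_set_def slice_def)
      then have "(\<integral>\<^sup>+e. h x * indicator (slice S e) x \<partial>count_space E) = (\<integral>\<^sup>+e. 0 \<partial>count_space E)"
        by (intro nn_integral_cong) auto
      then show ?thesis using False by simp
    qed
  qed
  also have "\<dots> = (\<integral>\<^sup>+e. \<integral>\<^sup>+x. h x * indicator (slice S e) x \<partial>hausdorff_measure k \<partial>count_space E)"
    by (rule nn_integral_count_space_nn_integral[OF cE]) measurable
  finally show ?thesis .
qed

lemma sampled_integral_compare:
  fixes S :: "'n::finite set" and h :: "real^'n \<Rightarrow> ennreal"
  defines "k \<equiv> CARD('n) - card S"
  assumes cE: "countable E" and sub: "E \<subseteq> coord_subspace S" and h[measurable]: "h \<in> borel_measurable borel" and b: "b > 0"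
  shows "(cell_integral S E b (\<lambda>e x. h (graft S e x)))
      \<le> ennreal ((2 * b) ^ card S * 4 ^ k / unit_ball_vol k) * (\<integral>\<^sup>+x\<in>sample_set S E. h x \<partial>hausdorff_measure k)"
    and "ennreal ((2 * b) ^ card S / (unit_ball_vol k * (CARD('n) / 2) ^ k)) * (\<integral>\<^sup>+x\<in>sample_set S E. h x \<partial>hausdorff_measure k)
      \<le> (cell_integral S E b (\<lambda>e x. h (graft S e x)))"
proof -
  have [measurable]: "(\<lambda>x. h (graft S e x)) \<in> borel_measurable borel" for e
    using measurable_compose[OF measurable_graft h] .
  have meas: "(\<lambda>(e, x). h (graft S e x) * indicator (cylinder S e b) x) \<in> borel_measurable (cell_measure E)"
    by (rule measurable_cell[OF cE]) measurable
  have cells: "(cell_integral S E b (\<lambda>e x. h (graft S e x)))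
     = (\<integral>\<^sup>+e. \<integral>\<^sup>+x. h (graft S e x) * indicator (cylinder S e b) x \<partial>lborel \<partial>count_space E)"
    using lborel.nn_integral_fst[OF meas] by simp
  show "(cell_integral S E b (\<lambda>e x. h (graft S e x)))
      \<le> ennreal ((2 * b) ^ card S * 4 ^ k / unit_ball_vol k) * (\<integral>\<^sup>+x\<in>sample_set S E. h x \<partial>hausdorff_measure k)"
    unfolding cells nn_integral_sample_set[OF cE sub h] k_def
    by (subst nn_integral_cmult[symmetric], simp, intro nn_integral_mono nn_integral_slice_compare b h)
  show "ennreal ((2 * b) ^ card S / (unit_ball_vol k * (CARD('n) / 2) ^ k)) * (\<integral>\<^sup>+x\<in>sample_set S E. h x \<partial>hausdorff_measure k)
      \<le> (cell_integral S E b (\<lambda>e x. h (graft S e x)))"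
    unfolding cells nn_integral_sample_set[OF cE sub h] k_def
    by (subst nn_integral_cmult[symmetric], simp, intro nn_integral_mono nn_integral_slice_compare b h)
qed

lemma powr_le_imp_le_base:
  fixes x y p :: real
  assumes "x powr p \<le> y powr p" "0 \<le> y" "0 < p"
  shows "x \<le> y"
proof (rule ccontr)
  assume "\<not> x \<le> y"
  then have "y powr p < x powr p" using assms(2,3) by (intro powr_less_mono2) auto
  then show False using assms(1) by simp
qed

theorem theorem1p1:
  fixes S :: "'n::finite set" and m :: nat and p :: real and D :: nat
    and \<rho> :: "real^'n \<Rightarrow> real"
  assumes "card S = m" and "0 < m"
    and "1 \<le> p"
    and "1 \<le> D"
    and "dyadic_bump \<rho>"
  shows "\<exists>\<delta> C1 C2. \<delta> > 0 \<and> C1 > 0 \<and> C2 > 0 \<and>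
    (\<forall>(f :: real^'n \<Rightarrow> complex) (N :: real) (b :: real) (E :: (real^'n) set).
      continuous_on UNIV f \<and> in_besov_1 \<rho> (real m / p) p f \<and> N > 0 \<and>
      besov_hom_1 \<rho> (real m / p) p f \<le> ennreal N * ennreal (Lp_norm p f) \<and>
      b > 0 \<and> b powr (real m / p) < \<delta> / N \<and>
      E \<subseteq> coord_subspace S \<and> discrete_set E \<and>
      (\<Union>x\<in>E. cube_in S x b) = coord_subspace S \<and>
      (\<forall>y \<in> coord_subspace S. finite {x\<in>E. y \<in> cube_in S x b} \<and>
                               card {x\<in>E. y \<in> cube_in S x b} \<le> D)
      \<longrightarrow>
      ennreal (C1 * Lp_norm p f)
        \<le> ennreal (b powr (real m / p)) *
           ennroot p (\<integral>\<^sup>+ x \<in> sample_set S E. ennreal (norm (f x) powr p)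
                        \<partial>hausdorff_measure (CARD('n) - m))
      \<and> ennreal (b powr (real m / p)) *
           ennroot p (\<integral>\<^sup>+ x \<in> sample_set S E. ennreal (norm (f x) powr p)
                        \<partial>hausdorff_measure (CARD('n) - m))
        \<le> ennreal (C2 * Lp_norm p f))"
proof -
  note S = assms(1) and p = assms(3) and D = assms(4) and \<rho> = assms(5)
  define k where "k = CARD('n) - m"
  \<comment> \<open>\<open>\<alpha>\<close> and \<open>\<beta>\<close> are the slice constants with
    b ^ m removed; that power is returned as \<open>B powr p\<close> below.\<close>
  define \<alpha> where "\<alpha> = 2 ^ m * 4 ^ k / unit_ball_vol (real k)"
  define \<beta> where "\<beta> = 2 ^ m / (unit_ball_vol (real k) * (real CARD('n) / 2) ^ k)"
  have "unit_ball_vol (real k) > 0" by simp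
  then have \<alpha>: "\<alpha> > 0" and \<beta>: "\<beta> > 0" by (auto simp: \<alpha>_def \<beta>_def)
  define c where "c = real D powr (1 / p) + 1 / 2"
  have c: "c > 0" by (simp add: c_def add_nonneg_pos)
  obtain \<delta> where \<delta>: "\<delta> > 0" "\<And>E b N (f :: real^'n \<Rightarrow> complex). cube_cover S E b D \<Longrightarrow> b > 0 \<Longrightarrow> N > 0 \<Longrightarrow>
      continuous_on UNIV f \<Longrightarrow> in_besov_1 \<rho> (real m / p) p f \<Longrightarrow>
      besov_hom_1 \<rho> (real m / p) p f \<le> ennreal N * ennreal (Lp_norm p f) \<Longrightarrow> b powr (real m / p) < \<delta> / N \<Longrightarrow>
     (cell_power S E b p (oscillation S f)) \<le> ennreal ((1 / 2 * Lp_norm p f) powr p)"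
    using besov_oscillation_bound[OF \<rho> p D, of m] S by blast
  show ?thesis
  \<comment> \<open>The lower constant combines F at most 2 \<open>\<xi>\<close> with the root of
    \<open>\<alpha>\<close>, the upper one \<open>\<xi>\<close> at most c F with the root of
    \<open>\<beta>\<close>, where \<open>\<xi>\<close> is the norm of the sampled f over the
    cells.\<close>
  proof (rule exI[of _ \<delta>], rule exI[of _ "1 / (2 * \<alpha> powr (1 / p))"], rule exI[of _ "c / \<beta> powr (1 / p)"],
      intro conjI allI impI)
    show "\<delta> > 0" "1 / (2 * \<alpha> powr (1 / p)) > 0" "c / \<beta> powr (1 / p) > 0" using \<delta>(1) \<alpha> \<beta> c by auto
  next
    fix f :: "real^'n \<Rightarrow> complex" and N b :: real and E :: "(real^'n) set"
    assume H: "continuous_on UNIV f \<and> in_besov_1 \<rho> (real m / p) p f \<and> N > 0 \<and>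
      besov_hom_1 \<rho> (real m / p) p f \<le> ennreal N * ennreal (Lp_norm p f) \<and>
      b > 0 \<and> b powr (real m / p) < \<delta> / N \<and>
      E \<subseteq> coord_subspace S \<and> discrete_set E \<and>
      (\<Union>x\<in>E. cube_in S x b) = coord_subspace S \<and>
      (\<forall>y \<in> coord_subspace S. finite {x\<in>E. y \<in> cube_in S x b} \<and> card {x\<in>E. y \<in> cube_in S x b} \<le> D)"
    then have b: "b > 0" and sub: "E \<subseteq> coord_subspace S" by auto
    have E: "cube_cover S E b D" using H by (intro cube_cover_of_cubes) auto
    then have cE: "countable E" by (simp add: cube_cover_def)
    have fL: "in_Lp p f" using H by (simp add: in_besov_1_def)
    have f[measurable]: "f \<in> borel_measurable borel" by (rule in_Lp_measurable[OF fL])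
    define F where "F = Lp_norm p f"
    have F: "F \<ge> 0" "(Lp_power p f) = ennreal (F powr p)"
      using nn_integral_powr_Lp_norm[OF fL p] by (auto simp: F_def)
    have osc: "(cell_power S E b p (oscillation S f)) \<le> ennreal ((1 / 2 * F) powr p)"
      unfolding F_def using H by (intro \<delta>(2)[OF E]) auto
    define X where "X = (cell_power S E b p (\<lambda>e x. norm (f (graft S e x))))"
    define Y where "Y = (cell_power S E b p (\<lambda>e x. norm (f x)))"
    define I where "I = (\<integral>\<^sup>+ x \<in> sample_set S E. ennreal (norm (f x) powr p) \<partial>hausdorff_measure k)"
    have Y_ge: "ennreal (F powr p) \<le> Y"
      unfolding Y_def nn_integral_on_cells[OF p] F(2)[symmetric] by (rule nn_integral_cell_ge[OF E]) measurable
    have Y_le: "Y \<le> ennreal ((real D powr (1 / p) * F) powr p)"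
    proof -
      have "Y \<le> of_nat D * ennreal (F powr p)"
        unfolding Y_def nn_integral_on_cells[OF p] F(2)[symmetric] by (rule nn_integral_cell_le[OF E]) measurable
      also have "\<dots> = ennreal (real D * F powr p)" by (simp add: ennreal_mult ennreal_of_nat_eq_real_of_nat)
      also have "real D * F powr p = (real D powr (1 / p) * F) powr p"
        using D F p by (simp add: powr_mult powr_powr)
      finally show ?thesis .
    qed
    have tri1: "norm (f (graft S e x)) \<le> norm (f x) + oscillation S f e x" for e x
      using norm_triangle_sub[of "f (graft S e x)" "f x"] by simp
    have tri2: "norm (f x) \<le> norm (f (graft S e x)) + oscillation S f e x" for e x
      using norm_triangle_sub[of "f x" "f (graft S e x)"] by (simp add: norm_minus_commute)
    have mg: "(\<lambda>x. norm (f (graft S e x))) \<in> borel_measurable borel" for e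
      using measurable_compose_graft[OF f, of S e] by measurable
    have X_le: "X \<le> ennreal ((c * F) powr p)"
    proof -
      have "X \<le> ennreal ((real D powr (1 / p) * F + 1 / 2 * F) powr p)"
        unfolding X_def
        by (rule on_cells_Minkowski[OF cE p _ measurable_oscillation[OF f] _ _ _ _ _ Y_le[unfolded Y_def] osc tri1])
          (use F in auto)
      then show ?thesis by (simp add: c_def distrib_right)
    qed
    \<comment> \<open>X is finite by \<open>X_le\<close>, so \<open>enn2real\<close> loses nothing
      and \<open>\<xi>\<close> is the true p-th root.\<close>
    define \<xi> where "\<xi> = enn2real X powr (1 / p)"
    have \<xi>: "\<xi> \<ge> 0" "X = ennreal (\<xi> powr p)"
      using X_le p by (auto simp: \<xi>_def powr_powr ennreal_enn2real_if top_unique)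
    have \<xi>_le: "\<xi> \<le> c * F"
      using X_le p c F unfolding \<xi>(2) by (intro powr_le_imp_le_base[of \<xi> p]) (auto simp: ennreal_le_iff)
    \<comment> \<open>Absorption: the oscillation contributes half of F, and since F is finite this
      half moves to the left-hand side.\<close>
    have F_le: "F \<le> 2 * \<xi>"
    proof -
      have "Y \<le> ennreal ((\<xi> + 1 / 2 * F) powr p)"
        unfolding Y_def
        by (rule on_cells_Minkowski[OF cE p mg measurable_oscillation[OF f] _ _ _ _ _ _ osc tri2])
          (use F \<xi> in \<open>auto simp: X_def\<close>)
      then have "ennreal (F powr p) \<le> ennreal ((\<xi> + 1 / 2 * F) powr p)" using Y_ge by (rule order_trans[rotated])
      then have "F powr p \<le> (\<xi> + 1 / 2 * F) powr p" by (simp add: ennreal_le_iff)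
      then have "F \<le> \<xi> + 1 / 2 * F" using F \<xi> p by (intro powr_le_imp_le_base[of F p]) auto
      then show ?thesis by simp
    qed
    have hm: "(\<lambda>x. ennreal (norm (f x) powr p)) \<in> borel_measurable borel" by measurable
    have X_I: "X \<le> ennreal (\<alpha> * b ^ m) * I"
      using sampled_integral_compare(1)[OF cE sub hm b] unfolding X_def nn_integral_on_cells[OF p] I_def k_def \<alpha>_def S
      by (simp add: power_mult_distrib mult_ac)
    have I_X: "ennreal (\<beta> * b ^ m) * I \<le> X"
      using sampled_integral_compare(2)[OF cE sub hm b] unfolding X_def nn_integral_on_cells[OF p] I_def k_def \<beta>_def S
      by (simp add: power_mult_distrib mult_ac)
    \<comment> \<open>\<open>ennroot\<close> is infinite at infinity, so finiteness of the sampled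
      integral must be settled before real roots are used; it follows from finiteness of X.\<close>
    have "I \<noteq> \<infinity>"
    proof
      assume "I = \<infinity>"
      then have "ennreal (\<beta> * b ^ m) * I = \<infinity>" using \<beta> b by (simp add: ennreal_mult_top)
      then show False using I_X \<xi>(2) by (simp add: top_unique)
    qed
    define \<iota> where "\<iota> = enn2real I powr (1 / p)"
    have \<iota>: "\<iota> \<ge> 0" "I = ennreal (\<iota> powr p)" "ennroot p I = ennreal \<iota>"
      using \<open>I \<noteq> \<infinity>\<close> p by (auto simp: \<iota>_def powr_powr ennroot_def ennreal_enn2real_if)
    define B where "B = b powr (real m / p)"
    have B: "B > 0" "B powr p = b ^ m" using b p by (auto simp: B_def powr_powr powr_realpow)
    have "\<xi> powr p \<le> \<alpha> * b ^ m * \<iota> powr p"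
      using X_I \<alpha> b unfolding \<xi>(2) \<iota>(2) by (simp add: ennreal_mult[symmetric])
    also have "\<dots> = (\<alpha> powr (1 / p) * (B * \<iota>)) powr p"
      using \<alpha> B \<iota>(1) p by (simp add: powr_mult powr_powr)
    finally have low: "\<xi> \<le> \<alpha> powr (1 / p) * (B * \<iota>)"
      by (rule powr_le_imp_le_base) (use p B \<iota>(1) in auto)
    have "(\<beta> powr (1 / p) * (B * \<iota>)) powr p = \<beta> * b ^ m * \<iota> powr p"
      using \<beta> B \<iota>(1) p by (simp add: powr_mult powr_powr)
    also have "\<dots> \<le> \<xi> powr p"
      using I_X \<beta> b unfolding \<xi>(2) \<iota>(2) by (simp add: ennreal_mult[symmetric])
    finally have high: "\<beta> powr (1 / p) * (B * \<iota>) \<le> \<xi>"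
      by (rule powr_le_imp_le_base) (use p \<xi>(1) in auto)
    have prod: "ennreal B * ennreal \<iota> = ennreal (B * \<iota>)" using B \<iota>(1) by (simp add: ennreal_mult)
    have "1 / (2 * \<alpha> powr (1 / p)) * F \<le> B * \<iota>"
    proof -
      have "F \<le> 2 * \<alpha> powr (1 / p) * (B * \<iota>)" using F_le low by linarith
      then show ?thesis using \<alpha> by (simp add: pos_divide_le_eq mult.commute)
    qed
    moreover have "B * \<iota> \<le> c / \<beta> powr (1 / p) * F"
    proof -
      have "\<beta> powr (1 / p) * (B * \<iota>) \<le> c * F" using high \<xi>_le by linarith
      then show ?thesis using \<beta> by (simp add: pos_le_divide_eq mult.commute)
    qed
    ultimately show "ennreal (1 / (2 * \<alpha> powr (1 / p)) * Lp_norm p f)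
        \<le> ennreal (b powr (real m / p)) *
           ennroot p (\<integral>\<^sup>+ x \<in> sample_set S E. ennreal (norm (f x) powr p) \<partial>hausdorff_measure (CARD('n) - m))"
      and "ennreal (b powr (real m / p)) *
           ennroot p (\<integral>\<^sup>+ x \<in> sample_set S E. ennreal (norm (f x) powr p) \<partial>hausdorff_measure (CARD('n) - m))
        \<le> ennreal (c / \<beta> powr (1 / p) * Lp_norm p f)"
      unfolding k_def[symmetric] I_def[symmetric] B_def[symmetric] F_def[symmetric] \<iota>(3) prod
      by (auto intro: ennreal_leI)
  qed
qed

end
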